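(* Let $0<\alpha\le 1$, $1<p<\infty$, $0<\kappa<1$ and $w\in A_p$. Then there is a constant $C>0$ such that for every sequence $\vec f=(f_1,f_2,\ldots)$ of locally integrable functions on $\mathbb R^n$ ($C$ being independent of $\vec f$), $$\bigg\|\bigg(\sum_{j=1}^\infty\big|\mathcal S_\alpha(f_j)\big|^2\bigg)^{1/2}\bigg\|_{L^{p,\kappa}(w)}\leq C\,\bigg\|\bigg(\sum_{j=1}^\infty\big|f_j\big|^2\bigg)^{1/2}\bigg\|_{L^{p,\kappa}(w)}.$$
   Context: Intrinsic square function. For $0<\alpha\le1$, let $\mathcal C_\alpha$ be the family of functions $\varphi$ on $\mathbb R^n$ such that $\varphi$ is supported in $\{x\in\mathbb R^n:|x|\le1\}$, $\int_{\mathbb R^n}\varphi(x)\,dx=0$, and $|\varphi(x)-\varphi(x')|\le|x-x'|^\alpha$ for all $x,x'\in\mathbb R^n$. Write $\varphi_t(x)=t^{-n}\varphi(x/t)$ for $t>0$. For $f\in L^1_{loc}(\mathbb R^n)$ and $(y,t)\in\mathbb R^{n+1}_+=\mathbb R^n\times(0,\infty)$ set $$A_\alpha(f)(y,t)=\sup_{\varphi\in\mathcal C_\alpha}|f*\varphi_t(y)|=\sup_{\varphi\in\mathcal C_\alpha}\left|\int_{\mathbb R^n}\varphi_t(y-z)f(z)\,dz\right|,$$ and $$\mathcal S_\alpha(f)(x)=\left(\iint_{\Gamma(x)}\big(A_\alpha(f)(y,t)\big)^2\frac{dy\,dt}{t^{n+1}}\right)^{1/2},\qquad \Gamma(x)=\{(y,t)\in\mathbb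 R^{n+1}_+:|x-y|<t\}.$$ Weights. A weight $w$ is a nonnegative, locally integrable function on $\mathbb R^n$; $w(E)=\int_E w(x)\,dx$ for measurable $E$, and $|E|$ is Lebesgue measure. For $1<p<\infty$, $w\in A_p$ means there is a constant $C>0$ such that for every ball $B\subseteq\mathbb R^n$, $$\left(\frac1{|B|}\int_B w(x)\,dx\right)\left(\frac1{|B|}\int_B w(x)^{-1/(p-1)}\,dx\right)^{p-1}\le C.$$ Weighted Morrey space. For $1\le p<\infty$, $0<\kappa<1$ and a weight $w$, $L^{p,\kappa}(w)$ is the space of $f\in L^p_{loc}(w)$ with $\|f\|_{L^{p,\kappa}(w)}<\infty$, where $$\|f\|_{L^{p,\kappa}(w)}=\sup_B\left(\frac1{w(B)^\kappa}\int_B|f(x)|^p w(x)\,dx\right)^{1/p},$$ the supremum being over all balls $B$ in $\mathbb R^n$. Norms are understood as values in $[0,\infty]$. *)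

theory Defs
  imports "HOL-Analysis.Analysis"
begin

text \<open>
  The role of \<open>n\<close>-dimensional Euclidean space is played by an arbitrary type of class
  \<^class>\<open>euclidean_space\<close>, with \<open>n = DIM('a)\<close>. Functions \<open>f\<close> and test functions
  \<open>\<phi>\<close> are complex-valued. When \<open>f\<close> is real-valued, the supremum over complex test functions
  equals the one over real test functions: multiply \<open>\<phi>\<close> by a unimodular constant making the
  integral nonnegative and pass to real parts.
\<close>

text \<open>
  Powers of extended nonnegative reals, for exponents \<open>a > 0\<close> only: \<open>0\<close> is mapped to \<open>0\<close> and
  \<open>\<infinity>\<close> to \<open>\<infinity>\<close>. Negative powers are written as powers of the inverse, so that
  \<open>0\<close> raised to a negative power is \<open>\<infinity>\<close> (in contrast to real \<open>0 powr a = 0\<close>).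
\<close>

definition ennpow :: "ennreal \<Rightarrow> real \<Rightarrow> ennreal" where
  "ennpow x a = (if x = \<infinity> then \<infinity> else ennreal (enn2real x powr a))"

definition locally_integrable ::
  "('a::euclidean_space \<Rightarrow> 'b::{banach, second_countable_topology}) \<Rightarrow> bool" where
  "locally_integrable f \<longleftrightarrow> (\<forall>K. compact K \<longrightarrow> set_integrable lebesgue K f)"

definition C_class :: "real \<Rightarrow> ('a::euclidean_space \<Rightarrow> complex) set" where
  "C_class \<alpha> = {\<phi>. (\<forall>x. \<phi> x \<noteq> 0 \<longrightarrow> norm x \<le> 1) \<and>
                   (LINT x|lebesgue. \<phi> x) = 0 \<and>
                   (\<forall>x x'. norm (\<phi> x - \<phi> x') \<le> norm (x - x') powr \<alpha>)}"

definition dilate :: "('a::euclidean_space \<Rightarrow> complex) \<Rightarrow> real \<Rightarrow> 'a \<Rightarrow> complex" where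
  "dilate \<phi> t x = (1 / t ^ DIM('a)) *\<^sub>R \<phi> ((1 / t) *\<^sub>R x)"

definition A_fun :: "real \<Rightarrow> ('a::euclidean_space \<Rightarrow> complex) \<Rightarrow> 'a \<Rightarrow> real \<Rightarrow> ennreal" where
  "A_fun \<alpha> f y t =
     (SUP \<phi> \<in> C_class \<alpha>. ennreal (norm (LINT z|lebesgue. dilate \<phi> t (y - z) * f z)))"

definition cone :: "'a::euclidean_space \<Rightarrow> ('a \<times> real) set" where
  "cone x = {(y, t). t > 0 \<and> norm (x - y) < t}"

definition intrinsic_square_fun ::
  "real \<Rightarrow> ('a::euclidean_space \<Rightarrow> complex) \<Rightarrow> 'a \<Rightarrow> ennreal" where
  "intrinsic_square_fun \<alpha> f x =
     ennpow (\<integral>\<^sup>+ q \<in> cone x. ((A_fun \<alpha> f (fst q) (snd q))\<^sup>2 / ennreal (snd q ^ (DIM('a) + 1))) \<partial>lebesgue)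
            (1 / 2)"

definition weight :: "('a::euclidean_space \<Rightarrow> real) \<Rightarrow> bool" where
  "weight w \<longleftrightarrow> (\<forall>x. 0 \<le> w x) \<and> locally_integrable w"

definition weight_meas :: "('a::euclidean_space \<Rightarrow> real) \<Rightarrow> 'a set \<Rightarrow> ennreal" where
  "weight_meas w E = (\<integral>\<^sup>+ x \<in> E. ennreal (w x) \<partial>lebesgue)"

definition A_class :: "real \<Rightarrow> ('a::euclidean_space \<Rightarrow> real) set" where
  "A_class p = {w. weight w \<and>
     (\<exists>C>0. \<forall>c r. r > 0 \<longrightarrow>
        ((\<integral>\<^sup>+ x \<in> ball c r. ennreal (w x) \<partial>lebesgue) / emeasure lebesgue (ball c r)) *
        ennpow ((\<integral>\<^sup>+ x \<in> ball c r. ennpow (inverse (ennreal (w x))) (1 / (p - 1)) \<partial>lebesgue)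
                  / emeasure lebesgue (ball c r)) (p - 1)
        \<le> ennreal C)}"

text \<open>
  The argument \<open>g\<close> plays the role of \<open>\<bar>f\<bar>\<close>; it is extended-valued because square functions and
  infinite sums may take the value \<open>\<infinity>\<close>. In the degenerate case where \<open>w\<close> vanishes almost
  everywhere on the ball, the quotient \<open>0 / 0\<close> is \<open>0\<close>.
\<close>

definition morrey_norm ::
  "real \<Rightarrow> real \<Rightarrow> ('a::euclidean_space \<Rightarrow> real) \<Rightarrow> ('a \<Rightarrow> ennreal) \<Rightarrow> ennreal" where
  "morrey_norm p \<kappa> w g =
     (SUP (c, r) \<in> {(c, r). r > 0}.
        ennpow ((\<integral>\<^sup>+ x \<in> ball c r. (ennpow (g x) p * ennreal (w x)) \<partial>lebesgue)
                  / ennpow (weight_meas w (ball c r)) \<kappa>) (1 / p))"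

definition ell2 :: "(nat \<Rightarrow> ennreal) \<Rightarrow> ennreal" where
  "ell2 a = ennpow (\<Sum>j. (a j)\<^sup>2) (1 / 2)"

end

theory Submission
  imports Defs
begin

text \<open>
  Fix \<open>(y, t)\<close>. By the one-third trick one of finitely many shifted dyadic grids contains a cube \<open>Q\<close> of
  side comparable to \<open>t\<close> around the ball of radius \<open>t\<close> about \<open>y\<close>. The martingale differences of \<open>f\<close>
  above \<open>Q\<close> are constant on \<open>Q\<close> and pair to \<open>0\<close> with a test function of mean zero, so Hoelder continuity
  gives \<open>A\<^sub>\<alpha> f (y, t) \<le> C a\<^sub>Q\<close>, where \<open>\<bar>Q\<bar> a\<^sub>Q = \<Sum>\<^bsub>R \<subseteq> Q\<^esub> (\<ell>(R) / \<ell>(Q))\<^sup>\<alpha> \<parallel>\<Delta>\<^sub>R f\<parallel>\<^sub>1\<close>; the square function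
  is thereby dominated by the dyadic sums \<open>\<Sum>\<^bsub>Q \<ni> x\<^esub> a\<^sub>Q\<^sup>2\<close>, and the \<open>\<ell>\<^sup>2\<close>-valued case by Minkowski's inequality.
  Since \<open>a\<^sub>Q\<close> depends only on \<open>f\<close> restricted to \<open>Q\<close>, the operator is local. A stopping-time argument, with
  a weak-type estimate proved by a Bellman function, compares \<open>\<Sum>\<^bsub>Q \<subseteq> P\<^esub> a\<^sub>Q\<^sup>2\<close> with sparse averages of
  \<open>\<bar>f\<bar>\<close>; pairing with a function in the dual space and using Doob's inequality for the measures
  \<open>w\<close> and \<open>w\<^bsup>-1/(p-1)\<^esup>\<close> gives the weighted \<open>L\<^sup>p\<close> bound on every cube \<open>P\<close>. In the Morrey
  norm of a ball, cubes smaller than the ball are handled by this bound, and larger cubes by Hoelder's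
  inequality, the \<open>A\<^sub>p\<close> condition and the resulting reverse doubling, which makes the sum geometric.
\<close>

section \<open>Martingale differences on trees\<close>

text \<open>The tree is abstract: an additive function on nodes stands for a measure, so the
  functions, the weight and the dual weight enter only through their masses on cubes, and the
  estimates become inductions on depth over finite sums. Stopping regions and maximal functions
  never appear as sets or functions; the recursions \<open>Ev\<close> and \<open>Mx\<close> carry
  their masses instead. The bound of \<open>a\<close> by averages of the norm alone would not be
  square summable over scales, so the cancellation in the martingale differences must be kept. The
  geometric weights turn the sum over all descendants into the one-step recursion
  \<open>b_rec\<close>, which a Bellman function can follow. No constant may depend on the depth, on
  the number of functions or on the number of scales. Everything is proved for finite families and
  truncated sums, where all quantities are finite and may be absorbed; monotone convergence removes
  the truncation once, at the end. In the Morrey setting a global weighted bound would not help,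
  because a function of finite Morrey norm need not lie in the weighted Lp space of the whole space.
  This is why the bound is proved cube by cube, with the mass of that cube alone on the
  right.\<close>

locale vtree =
  fixes ch :: "'n \<Rightarrow> 'n set" and vol :: "'n \<Rightarrow> real" and A :: real
  assumes finite_ch [simp]: "finite (ch Q)"
    and vol_pos: "vol Q > 0"
    and vol_sum: "(\<Sum>R\<in>ch Q. vol R) = vol Q"
    and vol_ch: "R \<in> ch Q \<Longrightarrow> vol Q \<le> A * vol R"
begin

definition additive :: "('n \<Rightarrow> 'b::comm_monoid_add) \<Rightarrow> bool" where
  "additive \<mu> \<longleftrightarrow> (\<forall>Q. (\<Sum>R\<in>ch Q. \<mu> R) = \<mu> Q)"

lemma additiveD: "additive \<mu> \<Longrightarrow> (\<Sum>R\<in>ch Q. \<mu> R) = \<mu> Q"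
  by (simp add: additive_def)

lemma additive_vol: "additive vol"
  by (simp add: additive_def vol_sum)

lemma additive_child_le:
  assumes "additive (m :: 'n \<Rightarrow> real)" "\<And>Q. 0 \<le> m Q" "R \<in> ch Q"
  shows "m R \<le> m Q"
  using member_le_sum[of R "ch Q" m] assms additiveD[of m Q] by simp

lemma A_ge_1: "A \<ge> 1"
proof -
  obtain Q :: 'n where True by simp
  have "ch Q \<noteq> {}" using vol_sum[of Q] vol_pos[of Q] by auto
  then obtain R where R: "R \<in> ch Q" by blast
  have "vol R \<le> vol Q"
    using additive_child_le[OF additive_vol _ R] vol_pos less_imp_le by blast
  also have "vol Q \<le> A * vol R" by (rule vol_ch[OF R])
  finally show ?thesis using vol_pos[of R] by simp
qed

lemma sum_square_le:
  "(\<Sum>R\<in>ch Q. x R)\<^sup>2 \<le> vol Q * (\<Sum>R\<in>ch Q. (x R)\<^sup>2 / vol R)"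
proof -
  have "(\<Sum>R\<in>ch Q. x R) = (\<Sum>R\<in>ch Q. sqrt (vol R) * (x R / sqrt (vol R)))"
    by (rule sum.cong) (use vol_pos in \<open>auto simp: less_imp_neq[THEN not_sym]\<close>)
  then have "(\<Sum>R\<in>ch Q. x R)\<^sup>2 \<le> (\<Sum>R\<in>ch Q. (sqrt (vol R))\<^sup>2) * (\<Sum>R\<in>ch Q. (x R / sqrt (vol R))\<^sup>2)"
    using Cauchy_Schwarz_ineq_sum[of "\<lambda>R. sqrt (vol R)" "\<lambda>R. x R / sqrt (vol R)" "ch Q"] by simp
  also have "(\<Sum>R\<in>ch Q. (sqrt (vol R))\<^sup>2) = vol Q"
    using vol_pos vol_sum[of Q] by (simp add: less_imp_le)
  also have "(\<Sum>R\<in>ch Q. (x R / sqrt (vol R))\<^sup>2) = (\<Sum>R\<in>ch Q. (x R)\<^sup>2 / vol R)"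
    using vol_pos by (intro sum.cong) (auto simp: power_divide less_imp_le)
  finally show ?thesis .
qed

text \<open>The martingale difference at \<open>Q\<close> is constant on each child \<open>R\<close>
  and has integral \<open>\<mu> j R - (vol R / vol Q) *\<^sub>R \<mu> j Q\<close> over it, so this
  is its L1 norm as an ell2-valued function.\<close>

definition osc :: "'j set \<Rightarrow> ('j \<Rightarrow> 'n \<Rightarrow> 'b::real_inner) \<Rightarrow> 'n \<Rightarrow> real" where
  "osc J \<mu> Q = (\<Sum>R\<in>ch Q. L2_set (\<lambda>j. norm (\<mu> j R - (vol R / vol Q) *\<^sub>R \<mu> j Q)) J)"

text \<open>The squared L2 norm over \<open>Q\<close> of the constant function whose value is the
  average on \<open>Q\<close>.\<close>

definition energy :: "'j set \<Rightarrow> ('j \<Rightarrow> 'n \<Rightarrow> 'b::real_inner) \<Rightarrow> 'n \<Rightarrow> real" where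
  "energy J \<mu> Q = (\<Sum>j\<in>J. (norm (\<mu> j Q))\<^sup>2) / vol Q"

lemma osc_nonneg: "0 \<le> osc J \<mu> Q"
  by (simp add: osc_def sum_nonneg)

text \<open>Pythagoras: the martingale difference is orthogonal to constants on \<open>Q\<close>, so
  its squared L2 norm equals the increase of energy from \<open>Q\<close> to its children.
  Cauchy-Schwarz bounds the squared L1 norm by \<open>vol Q\<close> times that.\<close>

lemma osc_energy:
  assumes "finite J" "\<And>j. j \<in> J \<Longrightarrow> additive (\<mu> j)"
  shows "(osc J \<mu> Q)\<^sup>2 / vol Q + energy J \<mu> Q \<le> (\<Sum>R\<in>ch Q. energy J \<mu> R)"
proof -
  let ?L = "\<lambda>R. L2_set (\<lambda>j. norm (\<mu> j R - (vol R / vol Q) *\<^sub>R \<mu> j Q)) J"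
  have "(osc J \<mu> Q)\<^sup>2 \<le> vol Q * (\<Sum>R\<in>ch Q. (?L R)\<^sup>2 / vol R)"
    unfolding osc_def by (rule sum_square_le)
  also have "(\<Sum>R\<in>ch Q. (?L R)\<^sup>2 / vol R) =
      (\<Sum>R\<in>ch Q. \<Sum>j\<in>J. (norm (\<mu> j R - (vol R / vol Q) *\<^sub>R \<mu> j Q))\<^sup>2 / vol R)"
    by (intro sum.cong) (auto simp: L2_set_def sum_nonneg sum_divide_distrib)
  also have "\<dots> = (\<Sum>j\<in>J. \<Sum>R\<in>ch Q. (norm (\<mu> j R - (vol R / vol Q) *\<^sub>R \<mu> j Q))\<^sup>2 / vol R)"
    by (rule sum.swap)
  also have "\<dots> = (\<Sum>j\<in>J. (\<Sum>R\<in>ch Q. (norm (\<mu> j R))\<^sup>2 / vol R) - (norm (\<mu> j Q))\<^sup>2 / vol Q)"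
  proof (rule sum.cong[OF refl])
    fix j assume j: "j \<in> J"
    let ?q = "\<mu> j Q"
    have "(\<Sum>R\<in>ch Q. (norm (\<mu> j R - (vol R / vol Q) *\<^sub>R ?q))\<^sup>2 / vol R) =
        (\<Sum>R\<in>ch Q. (norm (\<mu> j R))\<^sup>2 / vol R - (2 / vol Q) * (\<mu> j R \<bullet> ?q) + vol R * ((?q \<bullet> ?q) / (vol Q)\<^sup>2))"
    proof (rule sum.cong[OF refl])
      fix R assume "R \<in> ch Q"
      define r where "r = vol R / vol Q"
      have *: "(norm (\<mu> j R - r *\<^sub>R ?q))\<^sup>2 = (norm (\<mu> j R))\<^sup>2 - 2 * r * (\<mu> j R \<bullet> ?q) + r\<^sup>2 * (?q \<bullet> ?q)"
        unfolding power2_norm_eq_inner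
        by (simp add: inner_diff_left inner_diff_right inner_commute power2_eq_square algebra_simps)
      have "vol R > 0" "vol Q > 0" by (auto intro: vol_pos)
      then show "(norm (\<mu> j R - (vol R / vol Q) *\<^sub>R ?q))\<^sup>2 / vol R =
        (norm (\<mu> j R))\<^sup>2 / vol R - (2 / vol Q) * (\<mu> j R \<bullet> ?q) + vol R * ((?q \<bullet> ?q) / (vol Q)\<^sup>2)"
        unfolding r_def[symmetric] * by (simp add: r_def field_simps power2_eq_square)
    qed
    \<comment> \<open>By additivity the middle term becomes minus twice, and the last term plus
      once, the quotient \<open>(norm ?q)\<^sup>2 / vol Q\<close>.\<close>
    also have "\<dots> = (\<Sum>R\<in>ch Q. (norm (\<mu> j R))\<^sup>2 / vol R) - (2 / vol Q) * ((\<Sum>R\<in>ch Q. \<mu> j R) \<bullet> ?q)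
        + (\<Sum>R\<in>ch Q. vol R) * ((?q \<bullet> ?q) / (vol Q)\<^sup>2)"
      by (simp add: sum.distrib sum_subtractf sum_distrib_left sum_distrib_right inner_sum_left sum_divide_distrib)
    also have "\<dots> = (\<Sum>R\<in>ch Q. (norm (\<mu> j R))\<^sup>2 / vol R) - (norm ?q)\<^sup>2 / vol Q"
      using additiveD[OF assms(2)[OF j]] vol_pos[of Q]
      unfolding power2_norm_eq_inner by (simp add: vol_sum field_simps power2_eq_square)
    finally show "(\<Sum>R\<in>ch Q. (norm (\<mu> j R - (vol R / vol Q) *\<^sub>R ?q))\<^sup>2 / vol R) =
       (\<Sum>R\<in>ch Q. (norm (\<mu> j R))\<^sup>2 / vol R) - (norm ?q)\<^sup>2 / vol Q" .
  qed
  also have "\<dots> = (\<Sum>R\<in>ch Q. energy J \<mu> R) - energy J \<mu> Q"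
    unfolding energy_def sum_subtractf sum_divide_distrib by (subst sum.swap) simp
  finally show ?thesis using vol_pos[of Q] by (simp add: field_simps)
qed

text \<open>The quantity \<open>\<bar>Q\<bar> a\<^sub>Q\<close> of the introduction, truncated at depth \<open>d\<close>.\<close>

primrec bdepth :: "real \<Rightarrow> 'j set \<Rightarrow> ('j \<Rightarrow> 'n \<Rightarrow> 'b::real_inner) \<Rightarrow> nat \<Rightarrow> 'n \<Rightarrow> real" where
  "bdepth \<theta> J \<mu> 0 Q = 0"
| "bdepth \<theta> J \<mu> (Suc d) Q = osc J \<mu> Q + \<theta> * (\<Sum>R\<in>ch Q. bdepth \<theta> J \<mu> d R)"

text \<open>The limit is meaningful only for a bounded sequence of depths;
  \<open>vtree_martingale\<close> provides this through \<open>bdepth_le\<close>.\<close>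

definition blim :: "real \<Rightarrow> 'j set \<Rightarrow> ('j \<Rightarrow> 'n \<Rightarrow> 'b::real_inner) \<Rightarrow> 'n \<Rightarrow> real" where
  "blim \<theta> J \<mu> Q = lim (\<lambda>d. bdepth \<theta> J \<mu> d Q)"

lemma bdepth_mono_Suc:
  assumes "0 \<le> \<theta>"
  shows "bdepth \<theta> J \<mu> d Q \<le> bdepth \<theta> J \<mu> (Suc d) Q"
proof (induction d arbitrary: Q)
  case 0
  then show ?case by (simp add: osc_nonneg)
next
  case (Suc d)
  then show ?case using assms by (auto intro!: mult_left_mono sum_mono simp del: bdepth.simps(2)
        simp: bdepth.simps(2)[of _ _ _ d] bdepth.simps(2)[of _ _ _ "Suc d"])
qed

text \<open>Minkowski's inequality at every generation: the ell2 norm in \<open>j\<close> moves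
  inside the sums over children and turns scalar oscillations into the vector-valued one. This
  reduces a sequence of functions to one function with values in a Hilbert space.\<close>

lemma L2_set_bdepth:
  assumes "finite J" "0 \<le> \<theta>"
  shows "L2_set (\<lambda>j. bdepth \<theta> {j} \<mu> d Q) J \<le> bdepth \<theta> J \<mu> d Q"
proof (induction d arbitrary: Q)
  case 0
  then show ?case by (simp add: L2_set_def)
next
  have sumle: "L2_set (\<lambda>j. \<Sum>R\<in>S. g j R) J \<le> (\<Sum>R\<in>S. L2_set (\<lambda>j. g j R) J)" if "finite S"
    for S :: "'n set" and g :: "'a \<Rightarrow> 'n \<Rightarrow> real"
    using that
  proof induction
    case empty
    then show ?case by (simp add: L2_set_def)
  next
    case (insert x F)
    then show ?case using L2_set_triangle_ineq[of "\<lambda>j. g j x" "\<lambda>j. \<Sum>R\<in>F. g j R" J] by simp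
  qed
  case (Suc d)
  have "L2_set (\<lambda>j. bdepth \<theta> {j} \<mu> (Suc d) Q) J
     \<le> L2_set (\<lambda>j. osc {j} \<mu> Q) J + L2_set (\<lambda>j. \<theta> * (\<Sum>R\<in>ch Q. bdepth \<theta> {j} \<mu> d R)) J"
    by (simp add: L2_set_triangle_ineq)
  also have "L2_set (\<lambda>j. osc {j} \<mu> Q) J \<le> osc J \<mu> Q"
    using sumle[of "ch Q" "\<lambda>j R. norm (\<mu> j R - (vol R / vol Q) *\<^sub>R \<mu> j Q)"] by (simp add: osc_def)
  also have "L2_set (\<lambda>j. \<theta> * (\<Sum>R\<in>ch Q. bdepth \<theta> {j} \<mu> d R)) J
      = \<theta> * L2_set (\<lambda>j. \<Sum>R\<in>ch Q. bdepth \<theta> {j} \<mu> d R) J"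
    using assms by (simp add: L2_set_right_distrib)
  also have "\<dots> \<le> \<theta> * (\<Sum>R\<in>ch Q. L2_set (\<lambda>j. bdepth \<theta> {j} \<mu> d R) J)"
    using assms by (intro mult_left_mono sumle) auto
  also have "\<dots> \<le> \<theta> * (\<Sum>R\<in>ch Q. bdepth \<theta> J \<mu> d R)"
    using assms Suc by (intro mult_left_mono sum_mono) auto
  finally show ?case by simp
qed

end

text \<open>\<open>m\<close> stands for the integral of the ell2 norm of the sequence. In the
  application \<open>\<theta>\<close> is 2 to the power -\<alpha>, the factor by which the
  oscillation of a Hoelder function shrinks from a cube to its child.\<close>

locale vtree_martingale = vtree ch vol A for ch :: "'n \<Rightarrow> 'n set" and vol A +
  fixes \<theta> :: real and J :: "'j set" and \<mu> :: "'j \<Rightarrow> 'n \<Rightarrow> 'b::real_inner" and m :: "'n \<Rightarrow> real"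
  assumes theta: "0 < \<theta>" "\<theta> < 1"
    and finite_J: "finite J"
    and additive_mu: "j \<in> J \<Longrightarrow> additive (\<mu> j)"
    and additive_m: "additive m"
    and mu_le_m: "L2_set (\<lambda>j. norm (\<mu> j Q)) J \<le> m Q"
begin

abbreviation "b \<equiv> blim \<theta> J \<mu>"
abbreviation "B \<equiv> 2 / (1 - \<theta>)"

lemma m_nonneg: "0 \<le> m Q"
  using mu_le_m[of Q] L2_set_nonneg order_trans by blast

lemma osc_le: "osc J \<mu> Q \<le> 2 * m Q"
proof -
  have "osc J \<mu> Q \<le> (\<Sum>R\<in>ch Q. m R + (vol R / vol Q) * m Q)"
    unfolding osc_def
  proof (rule sum_mono)
    fix R assume "R \<in> ch Q"
    have "L2_set (\<lambda>j. norm (\<mu> j R - (vol R / vol Q) *\<^sub>R \<mu> j Q)) J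
       \<le> L2_set (\<lambda>j. norm (\<mu> j R) + (vol R / vol Q) * norm (\<mu> j Q)) J"
      using vol_pos[of R] vol_pos[of Q]
      by (intro L2_set_mono order_trans[OF norm_triangle_ineq4]) auto
    also have "\<dots> \<le> L2_set (\<lambda>j. norm (\<mu> j R)) J + L2_set (\<lambda>j. (vol R / vol Q) * norm (\<mu> j Q)) J"
      by (rule L2_set_triangle_ineq)
    also have "L2_set (\<lambda>j. (vol R / vol Q) * norm (\<mu> j Q)) J = (vol R / vol Q) * L2_set (\<lambda>j. norm (\<mu> j Q)) J"
      using vol_pos[of R] vol_pos[of Q] by (intro L2_set_right_distrib[symmetric]) auto
    also have "L2_set (\<lambda>j. norm (\<mu> j R)) J + (vol R / vol Q) * L2_set (\<lambda>j. norm (\<mu> j Q)) J \<le> m R + (vol R / vol Q) * m Q"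
      using vol_pos[of R] vol_pos[of Q] by (intro add_mono mult_left_mono mu_le_m) auto
    finally show "L2_set (\<lambda>j. norm (\<mu> j R - (vol R / vol Q) *\<^sub>R \<mu> j Q)) J \<le> m R + (vol R / vol Q) * m Q" .
  qed
  also have "\<dots> = (\<Sum>R\<in>ch Q. m R) + (\<Sum>R\<in>ch Q. vol R) / vol Q * m Q"
    by (simp add: sum.distrib sum_distrib_right sum_divide_distrib)
  also have "\<dots> = 2 * m Q"
    using vol_pos[of Q] by (simp add: vol_sum additiveD[OF additive_m])
  finally show ?thesis .
qed

text \<open>\<open>B\<close> is the fixed point of x = 2 + \<theta> x, with the 2 from
  \<open>osc_le\<close>, so the bound reproduces itself at every depth.\<close>

lemma bdepth_le: "bdepth \<theta> J \<mu> d Q \<le> B * m Q"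
proof (induction d arbitrary: Q)
  case 0
  then show ?case using theta m_nonneg by simp
next
  case (Suc d)
  have "bdepth \<theta> J \<mu> (Suc d) Q \<le> 2 * m Q + \<theta> * (\<Sum>R\<in>ch Q. B * m R)"
    unfolding bdepth.simps using theta by (intro add_mono osc_le mult_left_mono sum_mono Suc) simp
  also have "\<dots> = 2 * m Q + \<theta> * (B * m Q)"
    by (simp only: sum_distrib_left[symmetric] additiveD[OF additive_m])
  also have "\<dots> = B * m Q" using theta by (simp add: field_simps)
  finally show ?case .
qed

lemma bdepth_tendsto: "(\<lambda>d. bdepth \<theta> J \<mu> d Q) \<longlonglongrightarrow> b Q"
proof -
  have "incseq (\<lambda>d. bdepth \<theta> J \<mu> d Q)"
    using theta by (intro incseq_SucI bdepth_mono_Suc) auto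
  then have "convergent (\<lambda>d. bdepth \<theta> J \<mu> d Q)"
    by (metis bdepth_le convergentI incseq_convergent)
  then show ?thesis unfolding blim_def by (simp add: convergent_LIMSEQ_iff)
qed

lemma b_le: "b Q \<le> B * m Q"
  by (rule LIMSEQ_le_const2[OF bdepth_tendsto]) (use bdepth_le in blast)

lemma b_nonneg: "0 \<le> b Q"
proof -
  have "0 \<le> bdepth \<theta> J \<mu> d Q" for d
    using theta by (induction d arbitrary: Q) (auto intro!: add_nonneg_nonneg mult_nonneg_nonneg sum_nonneg osc_nonneg)
  then show ?thesis by (intro LIMSEQ_le_const[OF bdepth_tendsto]) auto
qed

lemma b_rec: "b Q = osc J \<mu> Q + \<theta> * (\<Sum>R\<in>ch Q. b R)"
proof (rule LIMSEQ_unique)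
  show "(\<lambda>d. bdepth \<theta> J \<mu> (Suc d) Q) \<longlonglongrightarrow> b Q"
    using bdepth_tendsto by (rule LIMSEQ_Suc)
  show "(\<lambda>d. bdepth \<theta> J \<mu> (Suc d) Q) \<longlonglongrightarrow> osc J \<mu> Q + \<theta> * (\<Sum>R\<in>ch Q. b R)"
    unfolding bdepth.simps by (intro tendsto_intros bdepth_tendsto)
qed

definition a :: "'n \<Rightarrow> real" where "a Q = b Q / vol Q"

lemma a_nonneg: "0 \<le> a Q"
  using b_nonneg vol_pos[of Q] by (simp add: a_def)

lemma a_le: "a Q \<le> B * (m Q / vol Q)"
  using divide_right_mono[OF b_le[of Q], of "vol Q"] vol_pos[of Q] by (simp add: a_def)

text \<open>These values close the recursion in \<open>V_step\<close>: the factor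
  \<open>1 / (1 - \<theta>)\<close> equals \<open>1 + c3\<close>, and \<open>c2\<close> is its
  square because the oscillation term picks it up twice.\<close>

abbreviation "c3 \<equiv> \<theta> / (1 - \<theta>)"
abbreviation "c2 \<equiv> 1 / (1 - \<theta>)\<^sup>2"
text \<open>Both negative terms of \<open>V\<close> are at most multiples of m squared over vol,
  with total factor \<open>c2 + c3 * B\<^sup>2\<close>; the density bound 4 A F makes this linear in
  \<open>m\<close>.\<close>

definition c1 :: real where "c1 = 4 * A * (c2 + c3 * B\<^sup>2)"
text \<open>The summand \<open>4 * c1\<close> lets at most half of the volume be stopped
  (\<open>Ev_half\<close>); the summand \<open>B\<^sup>2\<close> keeps the root itself from being
  stopped (\<open>root_not_stopped\<close>).\<close>

definition T :: real where "T = 4 * c1 + B\<^sup>2"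

text \<open>Bellman function of the weak-type estimate: the term \<open>- energy\<close> pays for the oscillations and \<open>- b\<^sup>2 / vol\<close>
  for the recursion \<open>b = osc + \<theta> \<Sum> b\<close>; the constants make \<open>V\<close> nonnegative as long as \<open>m / vol \<le> 4 A F\<close>.\<close>

definition V :: "real \<Rightarrow> 'n \<Rightarrow> real" where
  "V F Q = c1 * F * m Q - c2 * energy J \<mu> Q - c3 * ((b Q)\<^sup>2 / vol Q)"

lemma energy_le: "energy J \<mu> Q \<le> (m Q)\<^sup>2 / vol Q"
proof -
  have "(\<Sum>j\<in>J. (norm (\<mu> j Q))\<^sup>2) = (L2_set (\<lambda>j. norm (\<mu> j Q)) J)\<^sup>2"
    by (simp add: L2_set_def sum_nonneg)
  also have "\<dots> \<le> (m Q)\<^sup>2" by (intro power_mono mu_le_m) auto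
  finally show ?thesis using vol_pos[of Q] by (simp add: energy_def divide_right_mono less_imp_le)
qed

lemma V_nonneg:
  assumes "m Q \<le> 4 * A * F * vol Q"
  shows "0 \<le> V F Q"
proof -
  have m2: "(m Q)\<^sup>2 / vol Q \<le> 4 * A * F * m Q"
    using mult_left_mono[OF assms m_nonneg[of Q]] vol_pos[of Q] by (simp add: field_simps power2_eq_square)
  have "(b Q)\<^sup>2 / vol Q \<le> (B * m Q)\<^sup>2 / vol Q"
    using b_le[of Q] b_nonneg[of Q] vol_pos[of Q] by (intro divide_right_mono power_mono) auto
  also have "\<dots> = B\<^sup>2 * ((m Q)\<^sup>2 / vol Q)" by (simp only: power_mult_distrib times_divide_eq_right)
  finally have "c2 * energy J \<mu> Q + c3 * ((b Q)\<^sup>2 / vol Q) \<le> c2 * ((m Q)\<^sup>2 / vol Q) + c3 * (B\<^sup>2 * ((m Q)\<^sup>2 / vol Q))"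
    using theta energy_le by (intro add_mono mult_left_mono) auto
  also have "\<dots> = (c2 + c3 * B\<^sup>2) * ((m Q)\<^sup>2 / vol Q)" by (simp only: algebra_simps)
  also have "\<dots> \<le> (c2 + c3 * B\<^sup>2) * (4 * A * F * m Q)"
    using theta by (intro mult_left_mono m2 add_nonneg_nonneg mult_nonneg_nonneg) auto
  finally show ?thesis unfolding V_def c1_def by (simp only: algebra_simps)
qed

lemma V_step: "(b Q)\<^sup>2 / vol Q + (\<Sum>R\<in>ch Q. V F R) \<le> V F Q"
proof -
  let ?S = "\<Sum>R\<in>ch Q. b R" and ?D = "osc J \<mu> Q"
  have vQ: "vol Q > 0" by (rule vol_pos)
  have S: "?S\<^sup>2 / vol Q \<le> (\<Sum>R\<in>ch Q. (b R)\<^sup>2 / vol R)"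
    using sum_square_le[of b Q] vQ by (simp add: field_simps)
  \<comment> \<open>Convexity of the square with weights 1 - \<theta> and \<theta>, applied to D /
    (1 - \<theta>) and S. The S part keeps a coefficient below 1, which is the reserve that
    \<open>c3\<close> exploits.\<close>
  have "(b Q)\<^sup>2 \<le> ?D\<^sup>2 / (1 - \<theta>) + \<theta> * ?S\<^sup>2"
  proof -
    have "0 \<le> \<theta> / (1 - \<theta>) * (?D - (1 - \<theta>) * ?S)\<^sup>2" using theta by simp
    also have "\<dots> = ?D\<^sup>2 / (1 - \<theta>) + \<theta> * ?S\<^sup>2 - (?D + \<theta> * ?S)\<^sup>2"
      using theta by (simp add: field_simps power2_eq_square)
    finally show ?thesis using b_rec[of Q] by simp
  qed
  then have "(b Q)\<^sup>2 / vol Q \<le> (?D\<^sup>2 / (1 - \<theta>) + \<theta> * ?S\<^sup>2) / vol Q"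
    using vQ by (simp add: divide_right_mono)
  also have "\<dots> = (1 / (1 - \<theta>)) * (?D\<^sup>2 / vol Q) + \<theta> * (?S\<^sup>2 / vol Q)"
    by (simp add: add_divide_distrib)
  also have "\<dots> \<le> (1 / (1 - \<theta>)) * ((\<Sum>R\<in>ch Q. energy J \<mu> R) - energy J \<mu> Q) + \<theta> * (\<Sum>R\<in>ch Q. (b R)\<^sup>2 / vol R)"
    using theta S osc_energy[of J \<mu>, OF finite_J additive_mu, of Q] by (intro add_mono mult_left_mono) auto
  finally have "(1 / (1 - \<theta>)) * ((b Q)\<^sup>2 / vol Q) \<le> (1 / (1 - \<theta>)) * ((1 / (1 - \<theta>)) * ((\<Sum>R\<in>ch Q. energy J \<mu> R) - energy J \<mu> Q) + \<theta> * (\<Sum>R\<in>ch Q. (b R)\<^sup>2 / vol R))"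
    using theta by (intro mult_left_mono) auto
  also have "\<dots> = c2 * (\<Sum>R\<in>ch Q. energy J \<mu> R) - c2 * energy J \<mu> Q + c3 * (\<Sum>R\<in>ch Q. (b R)\<^sup>2 / vol R)"
  proof -
    have "1 / t * (1 / t * (X - E) + \<theta> * Y) = 1 / t\<^sup>2 * X - 1 / t\<^sup>2 * E + \<theta> / t * Y" for t X E Y :: real
      by (simp add: power2_eq_square algebra_simps diff_divide_distrib add_divide_distrib)
    then show ?thesis .
  qed
  finally have "(1 / (1 - \<theta>)) * ((b Q)\<^sup>2 / vol Q) \<le> c2 * (\<Sum>R\<in>ch Q. energy J \<mu> R) - c2 * energy J \<mu> Q + c3 * (\<Sum>R\<in>ch Q. (b R)\<^sup>2 / vol R)" .
  \<comment> \<open>The 1 is the term to be extracted; \<open>c3\<close> times the same quotient is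
    the term in \<open>V F Q\<close>.\<close>
  moreover have "1 / (1 - \<theta>) * ((b Q)\<^sup>2 / vol Q) = (b Q)\<^sup>2 / vol Q + c3 * ((b Q)\<^sup>2 / vol Q)"
  proof -
    have "1 / (1 - \<theta>) = 1 + c3" using theta by (simp add: field_simps)
    then show ?thesis by (simp only: distrib_right mult_1_left)
  qed
  moreover have "(\<Sum>R\<in>ch Q. V F R) = c1 * F * m Q - c2 * (\<Sum>R\<in>ch Q. energy J \<mu> R) - c3 * (\<Sum>R\<in>ch Q. (b R)\<^sup>2 / vol R)"
    by (simp only: V_def sum_subtractf sum_distrib_left[symmetric] additiveD[OF additive_m])
  ultimately show ?thesis using V_def[of F Q] by linarith
qed

end

section \<open>Doob's inequality and stopping times\<close>

lemma Young_0:
  fixes x y :: real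
  assumes "0 \<le> \<alpha>" "0 \<le> \<beta>" "\<alpha> + \<beta> = 1" "0 \<le> x" "0 \<le> y"
  shows "x powr \<alpha> * y powr \<beta> \<le> \<alpha> * x + \<beta> * y"
  using Youngs_inequality_0[of \<alpha> \<beta> x y] assms
  by (cases "x = 0 \<or> y = 0") auto

lemma Holder_sum2:
  fixes x y :: "'i \<Rightarrow> real"
  assumes ab: "0 < \<alpha>" "0 < \<beta>" "\<alpha> + \<beta> = 1" and x: "\<And>i. i \<in> S \<Longrightarrow> 0 \<le> x i" and y: "\<And>i. i \<in> S \<Longrightarrow> 0 \<le> y i"
    and "finite S"
  shows "(\<Sum>i\<in>S. x i powr \<alpha> * y i powr \<beta>) \<le> (\<Sum>i\<in>S. x i) powr \<alpha> * (\<Sum>i\<in>S. y i) powr \<beta>"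
proof -
  let ?X = "\<Sum>i\<in>S. x i" and ?Y = "\<Sum>i\<in>S. y i"
  have X: "0 \<le> ?X" and Y: "0 \<le> ?Y" using x y by (auto intro: sum_nonneg)
  show ?thesis
  proof (cases "?X = 0 \<or> ?Y = 0")
    case True
    then have "(\<Sum>i\<in>S. x i powr \<alpha> * y i powr \<beta>) = 0"
      using x y \<open>finite S\<close> by (intro sum.neutral) (auto simp: sum_nonneg_eq_0_iff)
    then show ?thesis using X Y by simp
  next
    case False
    then have pos: "?X > 0" "?Y > 0" using X Y by auto
    have "(\<Sum>i\<in>S. x i powr \<alpha> * y i powr \<beta>)
       = (\<Sum>i\<in>S. (x i / ?X) powr \<alpha> * (y i / ?Y) powr \<beta>) * (?X powr \<alpha> * ?Y powr \<beta>)"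
      unfolding sum_distrib_right
      by (intro sum.cong refl) (use pos x y in \<open>simp add: powr_divide\<close>)
    also have "(\<Sum>i\<in>S. (x i / ?X) powr \<alpha> * (y i / ?Y) powr \<beta>) \<le> (\<Sum>i\<in>S. \<alpha> * (x i / ?X) + \<beta> * (y i / ?Y))"
      using pos x y ab by (intro sum_mono Young_0) auto
    also have "\<dots> = \<alpha> * (?X / ?X) + \<beta> * (?Y / ?Y)"
      by (simp only: sum.distrib sum_distrib_left[symmetric] sum_divide_distrib[symmetric])
    also have "\<dots> = 1" using pos ab by simp
    finally show ?thesis using pos by (simp add: mult_right_mono)
  qed
qed

section \<open>Doob's maximal inequality on a tree\<close>

context vtree
begin

text \<open>The \<nu>-integral over \<open>Q\<close> of the r-th power of the maximal function of
  the quotients \<eta> / \<nu>, truncated after \<open>e\<close> generations; \<open>m\<close> is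
  the running maximum inherited from the ancestors.\<close>

primrec Mx :: "('n \<Rightarrow> real) \<Rightarrow> ('n \<Rightarrow> real) \<Rightarrow> real \<Rightarrow> nat \<Rightarrow> 'n \<Rightarrow> real \<Rightarrow> real" where
  "Mx \<nu> \<eta> r 0 Q m = (max m (\<eta> Q / \<nu> Q)) powr r * \<nu> Q"
| "Mx \<nu> \<eta> r (Suc e) Q m = (\<Sum>R\<in>ch Q. Mx \<nu> \<eta> r e R (max m (\<eta> Q / \<nu> Q)))"

lemma Mx_mono:
  assumes "\<And>Q. 0 < \<nu> Q" "0 \<le> m" "m \<le> m'" "0 < r"
  shows "Mx \<nu> \<eta> r e Q m \<le> Mx \<nu> \<eta> r e Q m'"
  using assms(2,3)
proof (induction e arbitrary: Q m m')
  case 0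
  then show ?case using assms(1)[of Q] assms(4) by (auto intro!: mult_right_mono powr_mono2)
next
  case (Suc e)
  then show ?case by (auto intro!: sum_mono Suc.IH)
qed

lemma Mx_nonneg: "(\<And>Q. 0 < \<nu> Q) \<Longrightarrow> 0 \<le> Mx \<nu> \<eta> r e Q m"
  by (induction e arbitrary: Q m) (auto intro!: sum_nonneg simp: less_imp_le)

text \<open>Bellman function proof of Doob's maximal inequality: the bound is affine in
  \<open>(y, \<eta>, \<nu>)\<close> for fixed \<open>m\<close>, hence additive over children, and raising \<open>m\<close> to
  \<open>max m (\<eta> / \<nu>)\<close> does not increase it.\<close>

lemma Mx_bellman:
  fixes r :: real and \<nu> \<eta> y :: "'n \<Rightarrow> real"
  assumes r: "r > 1" and c: "c = 2 * r / (r - 1)"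
    and add: "additive \<nu>" "additive \<eta>" "additive y"
    and pos: "\<And>Q. 0 < \<nu> Q" "\<And>Q. 0 \<le> \<eta> Q" "\<And>Q. 0 \<le> y Q"
    and holder: "\<And>Q. \<eta> Q \<le> y Q powr (1 / r) * \<nu> Q powr (1 - 1 / r)"
    and m: "0 \<le> m"
  shows "Mx \<nu> \<eta> r e Q m \<le> c powr r * y Q - c * m powr (r - 1) * \<eta> Q + 2 * m powr r * \<nu> Q"
  using m
proof (induction e arbitrary: Q m)
  have c0: "c > 0" using r c by simp
  have raise: "c powr r * y Q - c * (max m (\<eta> Q / \<nu> Q)) powr (r - 1) * \<eta> Q + 2 * (max m (\<eta> Q / \<nu> Q)) powr r * \<nu> Q
      \<le> c powr r * y Q - c * m powr (r - 1) * \<eta> Q + 2 * m powr r * \<nu> Q" if m0: "0 \<le> m" for m Q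
  proof (cases "\<eta> Q / \<nu> Q \<le> m")
    case True
    then show ?thesis by (simp add: max_absorb1)
  next
    case False
    define x where "x = \<eta> Q / \<nu> Q"
    have x: "0 \<le> x" "m < x" using False pos(1)[of Q] pos(2)[of Q] by (auto simp: x_def)
    have eta: "\<eta> Q = x * \<nu> Q" using pos(1)[of Q] by (simp add: x_def)
    \<comment> \<open>Multiplied by \<open>c\<close>, the coefficients 1 / r and 1 - 1 / r of
      Young's inequality become exactly c - 2 and 2. This determines the value of
      \<open>c\<close>.\<close>
    have "x * m powr (r - 1) = (x powr r) powr (1 / r) * (m powr r) powr (1 - 1 / r)"
      using x m0 r by (simp add: powr_powr right_diff_distrib)
    also have "\<dots> \<le> (1 / r) * x powr r + (1 - 1 / r) * m powr r"
      using r by (intro Young_0) auto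
    finally have "2 * r * (x * m powr (r - 1)) \<le> 2 * r * ((1 / r) * x powr r + (1 - 1 / r) * m powr r)"
      using r by (intro mult_left_mono) auto
    also have "\<dots> = 2 * x powr r + 2 * (r - 1) * m powr r"
      using r by (simp add: field_simps)
    finally have "2 * r * (x * m powr (r - 1)) / (r - 1) \<le> (2 * x powr r + 2 * (r - 1) * m powr r) / (r - 1)"
      using r by (intro divide_right_mono) auto
    also have "\<dots> = 2 / (r - 1) * x powr r + 2 * m powr r"
    proof -
      have "2 * (r - 1) * m powr r / (r - 1) = 2 * m powr r" using r by (simp del: right_diff_distrib_numeral)
      then show ?thesis by (simp only: add_divide_distrib times_divide_eq_left)
    qed
    finally have "2 * r * (x * m powr (r - 1)) / (r - 1) \<le> 2 / (r - 1) * x powr r + 2 * m powr r" .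
    moreover have "c - 2 = 2 / (r - 1)" using r unfolding c by (simp add: field_simps)
    ultimately have "c * (x * m powr (r - 1)) \<le> (c - 2) * x powr r + 2 * m powr r"
      by (simp add: c)
    moreover have "x powr r = x * x powr (r - 1)"
      using x m0 by (simp add: powr_mult_base)
    ultimately have "(- c * x * x powr (r - 1) + 2 * x powr r) * \<nu> Q \<le> (- c * x * m powr (r - 1) + 2 * m powr r) * \<nu> Q"
      using pos(1)[of Q] by (intro mult_right_mono) (auto simp: algebra_simps)
    then show ?thesis
      using x unfolding x_def[symmetric] eta by (simp add: max_absorb2 algebra_simps)
  qed
  {
    case 0
    define x where "x = \<eta> Q / \<nu> Q"
    define M where "M = max m x"
    have M: "0 \<le> M" "x \<le> M" using 0 by (auto simp: M_def)
    have x: "0 \<le> x" using pos(1)[of Q] pos(2)[of Q] by (auto simp: x_def)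
    have eta: "\<eta> Q = x * \<nu> Q" using pos(1)[of Q] by (simp add: x_def)
    have "(x * \<nu> Q) powr r \<le> (y Q powr (1 / r) * \<nu> Q powr (1 - 1 / r)) powr r"
      using holder[of Q] r pos(2)[of Q] unfolding eta by (intro powr_mono2) auto
    then have "x powr r * \<nu> Q powr r \<le> y Q * \<nu> Q powr (r - 1)"
      using r pos(1)[of Q] pos(3)[of Q] x by (simp add: powr_mult powr_powr left_diff_distrib)
    also have "\<nu> Q powr r = \<nu> Q * \<nu> Q powr (r - 1)"
      using pos(1)[of Q] by (simp add: powr_mult_base)
    finally have "(x powr r * \<nu> Q) * \<nu> Q powr (r - 1) \<le> y Q * \<nu> Q powr (r - 1)" by (simp add: mult.assoc)
    moreover have "\<nu> Q powr (r - 1) > 0" using pos(1)[of Q] by simp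
    ultimately have y: "x powr r * \<nu> Q \<le> y Q"
      using mult_le_cancel_right_pos by blast
    \<comment> \<open>What a leaf requires, divided by \<open>\<nu> Q\<close> and with
      \<open>y Q\<close> replaced by its lower bound from Hoelder: the left side is at most M^r if c
      x is below M, and at most (c x)^r otherwise.\<close>
    have "c * M powr (r - 1) * x \<le> c powr r * x powr r + M powr r"
    proof (cases "c * x \<le> M")
      case True
      have "c * M powr (r - 1) * x = (c * x) * M powr (r - 1)" by simp
      also have "\<dots> \<le> M * M powr (r - 1)" using True by (intro mult_right_mono) auto
      also have "\<dots> = M powr r" using M by (simp add: powr_mult_base)
      finally show ?thesis by (simp add: add_increasing)
    next
      case False
      then have "M powr (r - 1) \<le> (c * x) powr (r - 1)"
        using M r by (intro powr_mono2) auto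
      then have "(c * x) * M powr (r - 1) \<le> (c * x) * (c * x) powr (r - 1)"
        using c0 x by (intro mult_left_mono) auto
      also have "\<dots> = c powr r * x powr r" using c0 x by (subst powr_mult_base) (auto simp: powr_mult)
      finally have "c * M powr (r - 1) * x \<le> c powr r * x powr r" by (simp add: mult_ac)
      then show ?thesis by (simp add: add_increasing2)
    qed
    then have "(c * M powr (r - 1) * x) * \<nu> Q \<le> (c powr r * x powr r + M powr r) * \<nu> Q"
      using pos(1)[of Q] by (intro mult_right_mono) auto
    also have "\<dots> \<le> c powr r * y Q + M powr r * \<nu> Q"
      using mult_left_mono[OF y, of "c powr r"] by (simp add: algebra_simps)
    finally have "M powr r * \<nu> Q \<le> c powr r * y Q - c * M powr (r - 1) * \<eta> Q + 2 * M powr r * \<nu> Q"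
      by (simp add: eta algebra_simps)
    then show ?case
      unfolding Mx.simps M_def x_def by (rule order_trans[OF _ raise[OF 0]])
  next
    case (Suc e)
    define M where "M = max m (\<eta> Q / \<nu> Q)"
    have M: "0 \<le> M" using Suc.prems by (auto simp: M_def)
    have "Mx \<nu> \<eta> r (Suc e) Q m = (\<Sum>R\<in>ch Q. Mx \<nu> \<eta> r e R M)" by (simp add: M_def)
    also have "\<dots> \<le> (\<Sum>R\<in>ch Q. c powr r * y R - c * M powr (r - 1) * \<eta> R + 2 * M powr r * \<nu> R)"
      by (intro sum_mono Suc.IH M)
    also have "\<dots> = c powr r * y Q - c * M powr (r - 1) * \<eta> Q + 2 * M powr r * \<nu> Q"
      by (simp only: sum.distrib sum_subtractf sum_distrib_left[symmetric] add[THEN additiveD])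
    also have "\<dots> \<le> c powr r * y Q - c * m powr (r - 1) * \<eta> Q + 2 * m powr r * \<nu> Q"
      unfolding M_def by (rule raise[OF Suc.prems])
    finally show ?case .
  }
qed

lemma Mx_doob:
  fixes r :: real and \<nu> \<eta> y :: "'n \<Rightarrow> real"
  assumes "r > 1" "additive \<nu>" "additive \<eta>" "additive y"
    and "\<And>Q. 0 < \<nu> Q" "\<And>Q. 0 \<le> \<eta> Q" "\<And>Q. 0 \<le> y Q"
    and "\<And>Q. \<eta> Q \<le> y Q powr (1 / r) * \<nu> Q powr (1 - 1 / r)"
  shows "Mx \<nu> \<eta> r e Q 0 \<le> (2 * r / (r - 1)) powr r * y Q"
  using Mx_bellman[OF assms(1) refl assms(2-8), of 0 e Q] by simp

end

section \<open>Stopping on the accumulated square sum\<close>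

context vtree_martingale
begin

text \<open>\<open>Ev \<tau> \<nu> e Q s\<close> is the \<open>\<nu>\<close>-mass of the part of \<open>Q\<close>, resolved down to depth \<open>e\<close>, on which \<open>s\<close> (the sum
  of \<open>a\<^sup>2\<close> accumulated over the ancestors) plus the sum of \<open>a\<^sup>2\<close> along the branch never exceeds \<open>\<tau>\<close>.\<close>

primrec Ev :: "real \<Rightarrow> ('n \<Rightarrow> real) \<Rightarrow> nat \<Rightarrow> 'n \<Rightarrow> real \<Rightarrow> real" where
  "Ev \<tau> \<nu> 0 Q s = \<nu> Q"
| "Ev \<tau> \<nu> (Suc e) Q s = (if s + (a Q)\<^sup>2 > \<tau> then 0 else \<Sum>R\<in>ch Q. Ev \<tau> \<nu> e R (s + (a Q)\<^sup>2))"

lemma Ev_nonneg: "(\<And>Q. 0 \<le> \<nu> Q) \<Longrightarrow> 0 \<le> Ev \<tau> \<nu> e Q s"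
  by (induction e arbitrary: Q s) (auto intro!: sum_nonneg)

lemma Ev_le:
  assumes "additive \<nu>" "\<And>Q. 0 \<le> \<nu> Q"
  shows "Ev \<tau> \<nu> e Q s \<le> \<nu> Q"
proof (induction e arbitrary: Q s)
  case 0
  then show ?case by simp
next
  case (Suc e)
  have "(\<Sum>R\<in>ch Q. Ev \<tau> \<nu> e R (s + (a Q)\<^sup>2)) \<le> (\<Sum>R\<in>ch Q. \<nu> R)"
    by (intro sum_mono Suc)
  then show ?case using assms additiveD[of \<nu> Q] by simp
qed

text \<open>Hoelder's inequality on the region that is not stopped. All three masses are stopped by
  the same rule, so the discrete inequality over children can be iterated.\<close>

lemma Ev_Holder:
  assumes ab: "0 < \<alpha>" "0 < \<beta>" "\<alpha> + \<beta> = 1" and pos: "\<And>Q. 0 \<le> u Q" "\<And>Q. 0 \<le> v Q"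
    and "\<And>Q. \<nu> Q \<le> u Q powr \<alpha> * v Q powr \<beta>"
  shows "Ev \<tau> \<nu> e Q s \<le> Ev \<tau> u e Q s powr \<alpha> * Ev \<tau> v e Q s powr \<beta>"
proof (induction e arbitrary: Q s)
  case 0
  then show ?case using assms by simp
next
  case (Suc e)
  let ?s = "s + (a Q)\<^sup>2"
  have "(\<Sum>R\<in>ch Q. Ev \<tau> \<nu> e R ?s) \<le> (\<Sum>R\<in>ch Q. Ev \<tau> u e R ?s powr \<alpha> * Ev \<tau> v e R ?s powr \<beta>)"
    by (intro sum_mono Suc)
  also have "\<dots> \<le> (\<Sum>R\<in>ch Q. Ev \<tau> u e R ?s) powr \<alpha> * (\<Sum>R\<in>ch Q. Ev \<tau> v e R ?s) powr \<beta>"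
    by (intro Holder_sum2 ab Ev_nonneg pos finite_ch)
  finally show ?case by simp
qed

lemma constants_pos: "0 < c1" "0 < T" "0 \<le> c3" "0 < c2"
proof -
  show "0 \<le> c3" "0 < c2" using theta by auto
  then show "0 < c1" unfolding c1_def using A_ge_1 by (intro mult_pos_pos add_pos_nonneg mult_nonneg_nonneg) auto
  then show "0 < T" unfolding T_def by (intro add_pos_nonneg) auto
qed

text \<open>The right side is a budget that does not increase in total when passing to the children,
  since \<open>V_step\<close> pays for each new term of the square sum. Volume is lost in two ways:
  where the sum passes the threshold, \<open>s * vol\<close> pays; on a child of density above 4 F,
  which is abandoned at once, the \<open>m\<close> term pays.\<close>

lemma Ev_weak_type:
  assumes "m Q \<le> 4 * F * vol Q" "0 \<le> s" "0 \<le> F"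
  shows "T * F\<^sup>2 * (vol Q - Ev (T * F\<^sup>2) vol e Q s) \<le> s * vol Q + V F Q + T / 4 * F * m Q"
  using assms
proof (induction e arbitrary: Q s)
  have Vn: "0 \<le> V F Q" if "m Q \<le> 4 * F * vol Q" for Q
  proof (rule V_nonneg)
    have "1 * (4 * F * vol Q) \<le> A * (4 * F * vol Q)"
      using A_ge_1 assms(3) vol_pos[of Q] by (intro mult_right_mono) auto
    with that show "m Q \<le> 4 * A * F * vol Q" by (simp add: mult_ac)
  qed
  {
    case 0
    then show ?case using Vn[of Q] constants_pos m_nonneg[of Q] vol_pos[of Q] by simp
  next
    case (Suc e)
    let ?s = "s + (a Q)\<^sup>2" and ?\<tau> = "T * F\<^sup>2"
    have vQ: "0 < vol Q" by (rule vol_pos)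
    have aV: "(a Q)\<^sup>2 * vol Q + (\<Sum>R\<in>ch Q. V F R) \<le> V F Q"
      using V_step[of Q F] vQ by (simp add: a_def power_divide power2_eq_square)
    \<comment> \<open>A child of a node of density at most 4 F has density at most 4 A F. So
      \<open>V\<close> is still nonnegative on the first child that is too dense.\<close>
    have Vch: "0 \<le> V F R" if "R \<in> ch Q" for R
    proof (rule V_nonneg)
      have "m R \<le> 4 * F * vol Q"
        using additive_child_le[OF additive_m m_nonneg that] Suc.prems by linarith
      also have "\<dots> \<le> 4 * F * (A * vol R)"
        using vol_ch[OF that] Suc.prems by (intro mult_left_mono) auto
      finally show "m R \<le> 4 * A * F * vol R" by (simp add: mult_ac)
    qed
    then have sV: "0 \<le> (\<Sum>R\<in>ch Q. V F R)" by (rule sum_nonneg)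
    show ?case
    proof (cases "?s > ?\<tau>")
      case True
      have "?\<tau> * (vol Q - Ev ?\<tau> vol (Suc e) Q s) = ?\<tau> * vol Q" using True by simp
      also have "\<dots> \<le> ?s * vol Q" using True vQ by (intro mult_right_mono) auto
      also have "\<dots> \<le> s * vol Q + V F Q" using aV sV by (simp add: distrib_right)
      also have "\<dots> \<le> s * vol Q + V F Q + T / 4 * F * m Q"
        using constants_pos m_nonneg[of Q] Suc.prems by simp
      finally show ?thesis .
    next
      case False
      have "?\<tau> * (vol Q - Ev ?\<tau> vol (Suc e) Q s) = ?\<tau> * ((\<Sum>R\<in>ch Q. vol R) - (\<Sum>R\<in>ch Q. Ev ?\<tau> vol e R ?s))"
        using False by (simp add: vol_sum)
      also have "\<dots> = (\<Sum>R\<in>ch Q. ?\<tau> * (vol R - Ev ?\<tau> vol e R ?s))"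
        by (simp only: sum_subtractf[symmetric] sum_distrib_left)
      also have "\<dots> \<le> (\<Sum>R\<in>ch Q. ?s * vol R + V F R + T / 4 * F * m R)"
      proof (rule sum_mono)
        fix R assume R: "R \<in> ch Q"
        show "?\<tau> * (vol R - Ev ?\<tau> vol e R ?s) \<le> ?s * vol R + V F R + T / 4 * F * m R"
        proof (cases "m R \<le> 4 * F * vol R")
          case True
          then show ?thesis using Suc.prems by (intro Suc.IH) auto
        next
          \<comment> \<open>The whole child is written off: T F^2 times its volume is less than (T /
            4) F times its mass.\<close>
          case big: False
          have "?\<tau> * (vol R - Ev ?\<tau> vol e R ?s) \<le> ?\<tau> * vol R"
            using constants_pos Ev_nonneg[of vol ?\<tau> e R ?s] vol_pos
            by (intro mult_left_mono) (auto simp: less_imp_le)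
          also have "\<dots> = T / 4 * F * (4 * F * vol R)" by (simp add: power2_eq_square)
          also have "\<dots> \<le> T / 4 * F * m R"
            using big constants_pos Suc.prems by (intro mult_left_mono) auto
          also have "\<dots> \<le> ?s * vol R + V F R + T / 4 * F * m R"
            using Vch[OF R] Suc.prems vol_pos[of R] by simp
          finally show ?thesis .
        qed
      qed
      also have "\<dots> = ?s * vol Q + (\<Sum>R\<in>ch Q. V F R) + T / 4 * F * m Q"
        by (simp only: sum.distrib sum_distrib_left[symmetric] vol_sum additiveD[OF additive_m])
      also have "\<dots> \<le> s * vol Q + V F Q + T / 4 * F * m Q"
        using aV by (simp add: distrib_right)
      finally show ?thesis .
    qed
  }
qed

text \<open>At the root \<open>m P = F * vol P\<close>, so the \<open>V\<close> term and the
  \<open>m\<close> term of the weak-type bound are each at most a quarter of T F^2 vol P, and at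
  most half of the volume is lost.\<close>

lemma Ev_half:
  assumes F: "F = m P / vol P"
  shows "vol P \<le> 2 * Ev (T * F\<^sup>2) vol e P 0"
proof (cases "F = 0")
  case False
  have vP: "0 < vol P" by (rule vol_pos)
  have F0: "0 < F" using False m_nonneg[of P] vP by (simp add: F)
  have mP: "m P = F * vol P" using vP by (simp add: F)
  have "T * F\<^sup>2 * (vol P - Ev (T * F\<^sup>2) vol e P 0) \<le> 0 * vol P + V F P + T / 4 * F * m P"
    using F0 vP m_nonneg[of P] by (intro Ev_weak_type) (auto simp: mP)
  also have "\<dots> \<le> T / 4 * F * m P + T / 4 * F * m P"
  proof -
    have "c1 \<le> T / 4" by (simp add: T_def)
    then have "c1 * (F * m P) \<le> T / 4 * (F * m P)"
      using F0 m_nonneg[of P] by (intro mult_right_mono) auto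
    moreover have "V F P \<le> c1 * F * m P"
      unfolding V_def using constants_pos vP
      by (smt (verit) divide_nonneg_pos energy_def mult_nonneg_nonneg sum_nonneg zero_le_power2)
    ultimately show ?thesis unfolding mult.assoc by linarith
  qed
  also have "\<dots> = T * F\<^sup>2 * (vol P / 2)" by (simp add: mP power2_eq_square field_simps)
  finally have "vol P - Ev (T * F\<^sup>2) vol e P 0 \<le> vol P / 2"
    using constants_pos F0 by (elim mult_left_le_imp_le) auto
  then show ?thesis by simp
next
  case True
  \<comment> \<open>Here the threshold is 0, but every descendant has mass 0 and hence a = 0; as
    stopping requires strict excess, nothing is stopped.\<close>
  then have "m P = 0" using F vol_pos[of P] by simp
  then have "Ev 0 vol e P 0 = vol P"
  proof (induction e arbitrary: P)
    case (Suc e)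
    have "a P = 0" using a_le[of P] a_nonneg[of P] Suc.prems by simp
    moreover have "m R = 0" if "R \<in> ch P" for R
      using additive_child_le[OF additive_m m_nonneg that] m_nonneg[of R] Suc.prems by simp
    ultimately show ?case using Suc.IH by (simp add: vol_sum)
  qed simp
  then show ?thesis using True vol_pos[of P] by simp
qed

lemma root_not_stopped: "(a P)\<^sup>2 \<le> T * (m P / vol P)\<^sup>2"
proof -
  have "(a P)\<^sup>2 \<le> (B * (m P / vol P))\<^sup>2" using a_le a_nonneg by (intro power_mono)
  also have "\<dots> \<le> T * (m P / vol P)\<^sup>2"
    using constants_pos unfolding power_mult_distrib T_def by (intro mult_right_mono) auto
  finally show ?thesis .
qed

end

text \<open>\<open>\<sigma>\<close> stands for the mass of the dual weight. The bound
  \<open>vol_le\<close> is Hoelder's inequality, and the assumption \<open>Ap\<close> is its reverse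
  up to \<open>K\<close>, that is, the Muckenhoupt condition raised to the power 1 / p.\<close>

locale vtree_weighted = vtree_martingale ch vol A \<theta> J \<mu> m
  for ch :: "'n \<Rightarrow> 'n set" and vol A \<theta> and J :: "'j set" and \<mu> :: "'j \<Rightarrow> 'n \<Rightarrow> 'b::real_inner" and m +
  fixes p K :: real and w \<sigma> :: "'n \<Rightarrow> real"
  assumes p: "1 < p" and K: "0 < K"
    and additive_w: "additive w" and additive_sigma: "additive \<sigma>"
    and w_pos: "0 < w Q" and sigma_pos: "0 < \<sigma> Q"
    and vol_le: "vol Q \<le> w Q powr (1 / p) * \<sigma> Q powr (1 - 1 / p)"
    and Ap: "w Q powr (1 / p) * \<sigma> Q powr (1 - 1 / p) \<le> K * vol Q"
begin

abbreviation "q \<equiv> p / (p - 1)"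
text \<open>The price of one stopping step: \<open>sqrt T\<close> from the threshold,
  \<open>K\<close> from the Muckenhoupt condition, and the powers of 2 K from
  \<open>Ev_weights\<close>.\<close>

definition C0 :: real where "C0 = sqrt T * K * ((2 * K) powr q + (2 * K) powr p)"

lemma q: "1 < q" "1 / q = 1 - 1 / p" "0 < 1 - 1 / p" "0 < 1 / p" "1 - 1 / q = 1 / p"
  using p by (auto simp: field_simps)

text \<open>The unstopped region has half of the volume, and therefore a fixed share of both
  weights: Hoelder's inequality bounds its volume by the product of its two masses, and replacing
  one of them by the full mass of \<open>P\<close> leaves a lower bound for the other.\<close>

lemma Ev_weights:
  assumes F: "F = m P / vol P"
  shows "\<sigma> P \<le> (2 * K) powr q * Ev (T * F\<^sup>2) \<sigma> e P 0" (is ?thesis1)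
    and "w P \<le> (2 * K) powr p * Ev (T * F\<^sup>2) w e P 0" (is ?thesis2)
proof -
  let ?Ew = "Ev (T * F\<^sup>2) w e P 0" and ?Es = "Ev (T * F\<^sup>2) \<sigma> e P 0"
  have nn: "0 \<le> ?Ew" "0 \<le> ?Es" "?Ew \<le> w P" "?Es \<le> \<sigma> P"
    using w_pos sigma_pos Ev_nonneg Ev_le additive_w additive_sigma by (auto simp: less_imp_le)
  have wP: "0 < w P" and sP: "0 < \<sigma> P" by (auto intro: w_pos sigma_pos)
  have "w P powr (1 / p) * \<sigma> P powr (1 - 1 / p) \<le> K * vol P" by (rule Ap)
  also have "\<dots> \<le> K * (2 * Ev (T * F\<^sup>2) vol e P 0)"
    using K by (intro mult_left_mono Ev_half F) auto
  also have "\<dots> \<le> K * (2 * (?Ew powr (1 / p) * ?Es powr (1 - 1 / p)))"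
    using K q w_pos sigma_pos vol_le by (intro mult_left_mono Ev_Holder) (auto simp: less_imp_le)
  finally have main: "w P powr (1 / p) * \<sigma> P powr (1 - 1 / p) \<le> 2 * K * ?Ew powr (1 / p) * ?Es powr (1 - 1 / p)"
    by (simp add: mult_ac)
  have "2 * K * ?Ew powr (1 / p) * ?Es powr (1 - 1 / p) \<le> 2 * K * w P powr (1 / p) * ?Es powr (1 - 1 / p)"
    using K nn q by (intro mult_right_mono mult_left_mono powr_mono2) auto
  with main have "w P powr (1 / p) * \<sigma> P powr (1 - 1 / p) \<le> w P powr (1 / p) * (2 * K * ?Es powr (1 - 1 / p))"
    by (simp add: mult_ac)
  then have "\<sigma> P powr (1 - 1 / p) \<le> 2 * K * ?Es powr (1 - 1 / p)"
    using wP by (subst (asm) mult_le_cancel_left_pos) auto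
  then have "(\<sigma> P powr (1 - 1 / p)) powr q \<le> (2 * K * ?Es powr (1 - 1 / p)) powr q"
    using q by (intro powr_mono2) auto
  moreover have "(1 - 1 / p) * q = 1" using p by (simp add: field_simps)
  ultimately show ?thesis1
    using K nn sP by (simp add: powr_mult powr_powr del: times_divide_eq_right)
  have "2 * K * ?Ew powr (1 / p) * ?Es powr (1 - 1 / p) \<le> 2 * K * ?Ew powr (1 / p) * \<sigma> P powr (1 - 1 / p)"
    using K nn q by (intro mult_left_mono powr_mono2) auto
  with main have "\<sigma> P powr (1 - 1 / p) * w P powr (1 / p) \<le> \<sigma> P powr (1 - 1 / p) * (2 * K * ?Ew powr (1 / p))"
    by (simp add: mult_ac)
  then have "w P powr (1 / p) \<le> 2 * K * ?Ew powr (1 / p)"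
    using sP by (subst (asm) mult_le_cancel_left_pos) auto
  then have "(w P powr (1 / p)) powr p \<le> (2 * K * ?Ew powr (1 / p)) powr p"
    using p by (intro powr_mono2) auto
  then show ?thesis2
    using K nn wP p by (simp add: powr_mult powr_powr)
qed

lemma C0_nonneg: "0 \<le> C0"
  using K constants_pos by (simp add: C0_def)

text \<open>\<open>Jf e Q s\<close> abstracts the integral of \<open>sqrt (s + H) g w\<close> over \<open>Q\<close>, where \<open>H\<close> is the sum of \<open>a\<^sup>2\<close> over the
  \<open>e\<close> generations from \<open>Q\<close> on, and \<open>\<gamma>\<close> the integral of \<open>g w\<close>.\<close>

context
  fixes Jf :: "nat \<Rightarrow> 'n \<Rightarrow> real \<Rightarrow> real" and \<gamma> :: "'n \<Rightarrow> real"
  assumes J0: "0 \<le> s \<Longrightarrow> Jf 0 Q s \<le> sqrt s * \<gamma> Q"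
    and JS: "0 \<le> s \<Longrightarrow> Jf (Suc e) Q s \<le> (\<Sum>R\<in>ch Q. Jf e R (s + (a Q)\<^sup>2))"
    and Jadd: "0 \<le> s \<Longrightarrow> Jf e Q s \<le> sqrt s * \<gamma> Q + Jf e Q 0"
    and additive_gamma: "additive \<gamma>"
    and gamma_nonneg: "0 \<le> \<gamma> Q"
begin

abbreviation "Ms e Q h \<equiv> Mx \<sigma> m p e Q h"
abbreviation "Mw e Q g \<equiv> Mx w \<gamma> q e Q g"

text \<open>Along unstopped branches the square sum stays below \<tau>, which costs
  \<open>sqrt \<tau> * \<gamma>\<close>; there the maximal functions are at least \<open>h\<close>
  and \<open>g\<close>, so the \<open>Ev\<close> terms fit on the left as a credit. At a stopped
  node the assumed estimate for the same depth takes over.\<close>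

lemma stopping_claim:
  assumes "\<And>e' Q. e' \<le> e \<Longrightarrow> Jf e' Q 0 \<le> C0 * (Ms e' Q 0 + Mw e' Q 0)"
    and "0 \<le> s" "s \<le> \<tau>" "0 \<le> h" "0 \<le> g"
  shows "Jf e Q s + C0 * (h powr p * Ev \<tau> \<sigma> e Q s + g powr q * Ev \<tau> w e Q s)
     \<le> sqrt \<tau> * \<gamma> Q + C0 * (Ms e Q h + Mw e Q g)"
  using assms(1-3)
proof (induction e arbitrary: Q s)
  have mono: "Ms e Q h \<le> Ms e Q h'" "Mw e Q h \<le> Mw e Q h'" if "0 \<le> h" "h \<le> h'" for e Q h h'
    using that p q by (auto intro!: Mx_mono sigma_pos w_pos)
  have sq: "sqrt s * \<gamma> Q \<le> sqrt \<tau> * \<gamma> Q" if "s \<le> \<tau>" for s Q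
    using that gamma_nonneg by (intro mult_right_mono) auto
  {
    case 0
    have "h powr p * \<sigma> Q \<le> Ms 0 Q h" "g powr q * w Q \<le> Mw 0 Q g"
      using assms p q sigma_pos[of Q] w_pos[of Q] by (auto intro!: mult_right_mono powr_mono2)
    then have "C0 * (h powr p * \<sigma> Q + g powr q * w Q) \<le> C0 * (Ms 0 Q h + Mw 0 Q g)"
      by (intro mult_left_mono C0_nonneg add_mono)
    then show ?case using J0[OF 0(2), of Q] sq[OF 0(3), of Q] by simp
  next
    case (Suc e)
    let ?s = "s + (a Q)\<^sup>2"
    show ?case
    proof (cases "?s > \<tau>")
      case True
      \<comment> \<open>\<open>Jadd\<close> separates the contribution of the ancestors, at most
        \<open>sqrt \<tau>\<close>, from a fresh start at \<open>Q\<close>. The credit vanishes at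
        such a node.\<close>
      have "Jf (Suc e) Q s \<le> sqrt s * \<gamma> Q + Jf (Suc e) Q 0" by (rule Jadd[OF Suc.prems(2)])
      also have "\<dots> \<le> sqrt \<tau> * \<gamma> Q + C0 * (Ms (Suc e) Q 0 + Mw (Suc e) Q 0)"
        using Suc.prems(1)[of "Suc e" Q] Suc.prems(3) by (intro add_mono sq) (simp_all only: order_refl)
      also have "\<dots> \<le> sqrt \<tau> * \<gamma> Q + C0 * (Ms (Suc e) Q h + Mw (Suc e) Q g)"
        using assms(4,5) by (intro add_left_mono mult_left_mono[OF _ C0_nonneg] add_mono mono) auto
      finally show ?thesis using True by simp
    next
      case False
      have "Jf (Suc e) Q s + C0 * (h powr p * Ev \<tau> \<sigma> (Suc e) Q s + g powr q * Ev \<tau> w (Suc e) Q s)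
        \<le> (\<Sum>R\<in>ch Q. Jf e R ?s + C0 * (h powr p * Ev \<tau> \<sigma> e R ?s + g powr q * Ev \<tau> w e R ?s))"
        using JS[OF Suc.prems(2), of e Q] False
        by (simp add: sum.distrib sum_distrib_left distrib_left)
      also have "\<dots> \<le> (\<Sum>R\<in>ch Q. sqrt \<tau> * \<gamma> R + C0 * (Ms e R h + Mw e R g))"
        using Suc.prems False by (intro sum_mono Suc.IH) auto
      also have "\<dots> \<le> (\<Sum>R\<in>ch Q. sqrt \<tau> * \<gamma> R + C0 * (Ms e R (max h (m Q / \<sigma> Q)) + Mw e R (max g (\<gamma> Q / w Q))))"
        using assms(4,5) by (intro sum_mono add_left_mono mult_left_mono[OF _ C0_nonneg] add_mono mono) auto
      also have "\<dots> = sqrt \<tau> * \<gamma> Q + C0 * (Ms (Suc e) Q h + Mw (Suc e) Q g)"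
        by (simp only: sum.distrib sum_distrib_left[symmetric] additiveD[OF additive_gamma] Mx.simps)
      finally show ?thesis .
    qed
  }
qed

text \<open>A sparse bound without a sparse family. The term
  \<open>sqrt ?\<tau> * \<gamma> P\<close> of a starting node is paid by the \<sigma>- and w-masses
  of its unstopped region. These regions are disjoint for different starting nodes, which the
  recursion uses implicitly by handing out each credit only once.\<close>

lemma stopping_main: "Jf e P 0 \<le> C0 * (Ms e P 0 + Mw e P 0)"
proof (induction e arbitrary: P rule: less_induct)
  case (less e)
  show ?case
  proof (cases e)
    case 0
    then show ?thesis
      using J0[of 0 P] mult_nonneg_nonneg[OF C0_nonneg, of "Ms 0 P 0 + Mw 0 P 0"]
        Mx_nonneg[of \<sigma> m p 0 P 0, OF sigma_pos] Mx_nonneg[of w \<gamma> q 0 P 0, OF w_pos]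
      by (simp del: Mx.simps)
  next
    case (Suc d)
    define F where "F = m P / vol P"
    define h where "h = m P / \<sigma> P"
    define g where "g = \<gamma> P / w P"
    let ?\<tau> = "T * F\<^sup>2"
    let ?Ew = "Ev ?\<tau> w e P 0" and ?Es = "Ev ?\<tau> \<sigma> e P 0"
    have vP: "0 < vol P" "0 < w P" "0 < \<sigma> P" by (auto intro: vol_pos w_pos sigma_pos)
    have h: "0 \<le> h" and g: "0 \<le> g" and F: "0 \<le> F"
      using vP m_nonneg[of P] gamma_nonneg[of P] by (auto simp: h_def g_def F_def)
    have a: "(a P)\<^sup>2 \<le> ?\<tau>" unfolding F_def by (rule root_not_stopped)
    have "sqrt ?\<tau> * \<gamma> P = sqrt T * (F * \<gamma> P)"
      using F constants_pos by (simp add: real_sqrt_mult)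
    \<comment> \<open>The Lebesgue average is rewritten by averages with respect to \<sigma> and w,
      the ones that Doob's inequality for these two measures controls.\<close>
    also have "F * \<gamma> P = h * g * (\<sigma> P * (w P / vol P))"
      using vP by (simp add: F_def h_def g_def field_simps)
    finally have 1: "sqrt ?\<tau> * \<gamma> P = sqrt T * (h * g * (\<sigma> P * (w P / vol P)))" .
    \<comment> \<open>The Muckenhoupt condition removes the volume and leaves exponents 1 / p and 1
      - 1 / p, matching the p-th power of \<open>h\<close> and the q-th power of \<open>g\<close> in
      Young's inequality below.\<close>
    have 2: "\<sigma> P * (w P / vol P) \<le> K * (\<sigma> P powr (1 / p) * w P powr (1 - 1 / p))"
    proof -
      have "\<sigma> P * w P = (w P powr (1 / p) * \<sigma> P powr (1 - 1 / p)) * (\<sigma> P powr (1 / p) * w P powr (1 - 1 / p))"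
        using vP by (simp add: powr_diff)
      also have "\<dots> \<le> (K * vol P) * (\<sigma> P powr (1 / p) * w P powr (1 - 1 / p))"
        by (intro mult_right_mono Ap) auto
      finally show ?thesis using vP by (simp add: field_simps)
    qed
    have "h * g * (K * (\<sigma> P powr (1 / p) * w P powr (1 - 1 / p)))
        = K * ((h powr p * \<sigma> P) powr (1 / p) * (g powr q * w P) powr (1 - 1 / p))"
    proof -
      have "q * (1 - 1 / p) = 1" using p by (simp add: field_simps)
      then show ?thesis using h g vP p by (simp add: powr_mult powr_powr del: times_divide_eq_left)
    qed
    also have "\<dots> \<le> K * ((1 / p) * (h powr p * \<sigma> P) + (1 - 1 / p) * (g powr q * w P))"
      using vP q K by (intro mult_left_mono Young_0) auto
    also have "\<dots> \<le> K * (1 * (h powr p * \<sigma> P) + 1 * (g powr q * w P))"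
      using vP p K by (intro mult_left_mono[of _ _ K] add_mono mult_right_mono) auto
    also have "\<dots> \<le> K * (1 * (h powr p * ((2 * K) powr q * ?Es)) + 1 * (g powr q * ((2 * K) powr p * ?Ew)))"
      using K by (intro mult_left_mono add_mono Ev_weights F_def) auto
    also have "\<dots> \<le> K * (h powr p * (((2 * K) powr q + (2 * K) powr p) * ?Es)
         + g powr q * (((2 * K) powr q + (2 * K) powr p) * ?Ew))"
      unfolding mult_1_left
      using w_pos sigma_pos Ev_nonneg K by (intro add_mono mult_left_mono mult_right_mono) (auto simp: less_imp_le)
    finally have 3: "h * g * (K * (\<sigma> P powr (1 / p) * w P powr (1 - 1 / p)))
      \<le> K * (h powr p * (((2 * K) powr q + (2 * K) powr p) * ?Es)
         + g powr q * (((2 * K) powr q + (2 * K) powr p) * ?Ew))" .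
    have "h * g * (\<sigma> P * (w P / vol P)) \<le> h * g * (K * (\<sigma> P powr (1 / p) * w P powr (1 - 1 / p)))"
      using h g by (intro mult_left_mono 2) auto
    from order_trans[OF this 3] have key: "sqrt ?\<tau> * \<gamma> P \<le> C0 * (h powr p * ?Es + g powr q * ?Ew)"
      using constants_pos unfolding 1 C0_def mult.assoc[of "sqrt T"]
      by (intro mult_left_mono) (auto simp: algebra_simps)
    have "Jf e P 0 + C0 * (h powr p * ?Es + g powr q * ?Ew)
       \<le> (\<Sum>R\<in>ch P. Jf d R ((a P)\<^sup>2) + C0 * (h powr p * Ev ?\<tau> \<sigma> d R ((a P)\<^sup>2) + g powr q * Ev ?\<tau> w d R ((a P)\<^sup>2)))"
      using JS[of 0 d P] a Suc by (simp add: sum.distrib sum_distrib_left distrib_left)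
    also have "\<dots> \<le> (\<Sum>R\<in>ch P. sqrt ?\<tau> * \<gamma> R + C0 * (Ms d R h + Mw d R g))"
      using a Suc h g by (intro sum_mono stopping_claim less.IH) auto
    also have "\<dots> = sqrt ?\<tau> * \<gamma> P + C0 * ((\<Sum>R\<in>ch P. Ms d R h) + (\<Sum>R\<in>ch P. Mw d R g))"
      by (simp only: sum.distrib sum_distrib_left[symmetric] additiveD[OF additive_gamma])
    also have "(\<Sum>R\<in>ch P. Ms d R h) = Ms e P 0"
      using h by (simp add: Suc h_def)
    also have "(\<Sum>R\<in>ch P. Mw d R g) = Mw e P 0"
      using g by (simp add: Suc g_def)
    finally show ?thesis using key by linarith
  qed
qed

text \<open>Doob's inequality for \<sigma> with exponent p and for w with exponent q. Its constants
  2 p / (p - 1) and 2 q / (q - 1) are 2 q and 2 p.\<close>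

lemma stopping_bound:
  assumes "additive y" "additive Y" "\<And>Q. 0 \<le> y Q" "\<And>Q. 0 \<le> Y Q"
    and "\<And>Q. m Q \<le> y Q powr (1 / p) * \<sigma> Q powr (1 - 1 / p)"
    and "\<And>Q. \<gamma> Q \<le> Y Q powr (1 - 1 / p) * w Q powr (1 / p)"
  shows "Jf e P 0 \<le> C0 * (2 * q) powr p * y P + C0 * (2 * p) powr q * Y P"
proof -
  have eq: "2 * p / (p - 1) = 2 * q" "2 * q / (q - 1) = 2 * p" using p by (auto simp: field_simps)
  have "Ms e P 0 \<le> (2 * q) powr p * y P"
    using Mx_doob[OF p additive_sigma additive_m assms(1) sigma_pos m_nonneg assms(3,5)] unfolding eq .
  moreover have "Mw e P 0 \<le> (2 * p) powr q * Y P"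
    using Mx_doob[OF q(1) additive_w additive_gamma assms(2) w_pos gamma_nonneg assms(4)] assms(6)
    unfolding eq q(2,5) by simp
  ultimately have "C0 * (Ms e P 0 + Mw e P 0) \<le> C0 * ((2 * q) powr p * y P + (2 * p) powr q * Y P)"
    by (intro mult_left_mono C0_nonneg add_mono)
  then show ?thesis using stopping_main[of e P] by (simp add: algebra_simps)
qed

end

end

section \<open>Dyadic cubes\<close>

definition side :: "int \<Rightarrow> real" where "side k = 2 powi (- k)"

lemma side_pos [simp]: "side k > 0"
  by (simp add: side_def)

lemma side_nonneg [simp]: "side k \<ge> 0" and side_neq_0 [simp]: "side k \<noteq> 0"
  using side_pos[of k] by linarith+

lemma side_half: "side k = 2 * side (k + 1)"
  using power_int_add_1[of "2::real" "- (k + 1)"] by (simp add: side_def)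

type_synonym 'a cube = "'a \<times> int"

fun cell :: "'a::euclidean_space cube \<Rightarrow> 'a set" where
  "cell (c, k) = {y. \<forall>b\<in>Basis. c \<bullet> b \<le> y \<bullet> b \<and> y \<bullet> b < c \<bullet> b + side k}"

fun children :: "'a::euclidean_space cube \<Rightarrow> 'a cube set" where
  "children (c, k) = (\<lambda>T. (c + side (k + 1) *\<^sub>R \<Sum>T, k + 1)) ` Pow Basis"

definition cvol :: "'a::euclidean_space cube \<Rightarrow> real" where
  "cvol Q = side (snd Q) ^ DIM('a)"

lemma cvol_pos: "cvol Q > 0"
  by (simp add: cvol_def)

lemma snd_children: "R \<in> children Q \<Longrightarrow> snd R = snd Q + 1"
  by (cases Q) auto

lemma cvol_child: "R \<in> children Q \<Longrightarrow> cvol Q = 2 ^ DIM('a) * cvol (R :: 'a::euclidean_space cube)"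
  using snd_children[of R Q] side_half[of "snd Q"] by (simp add: cvol_def power_mult_distrib)

lemma cell_borel [measurable]: "cell Q \<in> sets borel"
proof (cases Q)
  case (Pair c k)
  have "cell Q = (\<Inter>b\<in>Basis. {y. c \<bullet> b \<le> y \<bullet> b \<and> y \<bullet> b < c \<bullet> b + side k})"
    by (auto simp: Pair)
  also have "\<dots> \<in> sets borel"
    by (intro sets.finite_INT finite_Basis nonempty_Basis) measurable
  finally show ?thesis .
qed

lemma cell_lebesgue [measurable]: "cell Q \<in> sets lebesgue"
  using cell_borel[of Q] by (simp add: sets_completionI_sets)

lemma emeasure_cell: "emeasure lebesgue (cell Q) = ennreal (cvol Q)"
proof (cases Q)
  case (Pair c k)
  let ?d = "c + side k *\<^sub>R One"
  have le: "\<And>b. b \<in> Basis \<Longrightarrow> c \<bullet> b \<le> ?d \<bullet> b" by (simp add: inner_add_left)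
  have diff: "(\<Prod>b\<in>Basis. (?d - c) \<bullet> b) = cvol Q" by (simp add: Pair cvol_def)
  have "emeasure lborel (box c ?d) \<le> emeasure lborel (cell Q)"
    by (intro emeasure_mono) (auto simp: Pair mem_box inner_add_left less_imp_le)
  moreover have "emeasure lborel (cell Q) \<le> emeasure lborel (cbox c ?d)"
    by (intro emeasure_mono) (auto simp: Pair mem_box inner_add_left less_imp_le)
  ultimately have "emeasure lborel (cell Q) = ennreal (cvol Q)"
    using emeasure_lborel_box[OF le] emeasure_lborel_cbox[OF le] by (simp only: diff antisym)
  then show ?thesis by simp
qed

lemma inner_sum_Basis_subset:
  "T \<subseteq> Basis \<Longrightarrow> b \<in> Basis \<Longrightarrow> \<Sum>T \<bullet> b = (if b \<in> T then 1 else 0)"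
  by (simp add: inner_sum_left inner_Basis finite_subset[OF _ finite_Basis] subset_iff if_distrib cong: if_cong)

lemma cell_children: "cell Q = (\<Union>R\<in>children Q. cell R)"
proof (cases Q)
  case (Pair c k)
  have sd: "side k = 2 * side (k + 1)" by (rule side_half)
  show ?thesis
  proof safe
    fix y assume y: "y \<in> cell Q"
    define T where "T = {b\<in>Basis. c \<bullet> b + side (k + 1) \<le> y \<bullet> b}"
    have T: "T \<subseteq> Basis" by (auto simp: T_def)
    have "y \<in> cell (c + side (k + 1) *\<^sub>R \<Sum>T, k + 1)"
      using y sd by (auto simp: Pair inner_add_left inner_sum_Basis_subset[OF T]) (auto simp: T_def)
    then show "y \<in> (\<Union>R\<in>children Q. cell R)" using T by (auto simp: Pair)
  next
    fix y R assume R: "R \<in> children Q" "y \<in> cell R"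
    then obtain T where T: "T \<subseteq> Basis" "R = (c + side (k + 1) *\<^sub>R \<Sum>T, k + 1)" by (auto simp: Pair)
    show "y \<in> cell Q"
      unfolding Pair cell.simps
    proof safe
      fix b :: 'a assume b: "b \<in> Basis"
      then have "c \<bullet> b + side (k + 1) * (if b \<in> T then 1 else 0) \<le> y \<bullet> b"
        "y \<bullet> b < c \<bullet> b + side (k + 1) * (if b \<in> T then 1 else 0) + side (k + 1)"
        using R(2) by (auto simp: T(2) inner_add_left inner_sum_Basis_subset[OF T(1)])
      then show "c \<bullet> b \<le> y \<bullet> b" "y \<bullet> b < c \<bullet> b + side k"
        using sd side_pos[of "k + 1"] by (auto split: if_splits)
    qed
  qed
qed

lemma cell_child_subset: "R \<in> children Q \<Longrightarrow> cell R \<subseteq> cell Q"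
  using cell_children[of Q] by blast

lemma cell_children_unique:
  assumes "R \<in> children Q" "R' \<in> children Q" "y \<in> cell R" "y \<in> cell R'"
  shows "R = R'"
proof (cases Q)
  case (Pair c k)
  obtain T T' where T: "T \<subseteq> Basis" "R = (c + side (k + 1) *\<^sub>R \<Sum>T, k + 1)"
    and T': "T' \<subseteq> Basis" "R' = (c + side (k + 1) *\<^sub>R \<Sum>T', k + 1)"
    using assms by (auto simp: Pair)
  have "b \<in> T \<longleftrightarrow> b \<in> T'" if b: "b \<in> Basis" for b
  proof -
    have "c \<bullet> b + side (k + 1) * (if b \<in> T then 1 else 0) \<le> y \<bullet> b"
      "y \<bullet> b < c \<bullet> b + side (k + 1) * (if b \<in> T then 1 else 0) + side (k + 1)"
      "c \<bullet> b + side (k + 1) * (if b \<in> T' then 1 else 0) \<le> y \<bullet> b"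
      "y \<bullet> b < c \<bullet> b + side (k + 1) * (if b \<in> T' then 1 else 0) + side (k + 1)"
      using assms(3,4) b by (auto simp: T(2) T'(2) inner_add_left inner_sum_Basis_subset[OF T(1)] inner_sum_Basis_subset[OF T'(1)])
    then show ?thesis by (auto split: if_splits)
  qed
  then have "T = T'" using T T' by blast
  then show ?thesis using T T' by simp
qed

lemma disjoint_children: "disjoint_family_on cell (children Q)"
  unfolding disjoint_family_on_def by (metis cell_children_unique disjoint_iff)

lemma finite_children [simp]: "finite (children Q)"
  by (cases Q) simp

lemma set_integrable_cell_subset:
  fixes f :: "'a::euclidean_space \<Rightarrow> 'b::{banach, second_countable_topology}"
  shows "set_integrable lebesgue (cell Q) f \<Longrightarrow> R \<in> children Q \<Longrightarrow> set_integrable lebesgue (cell R) f"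
  by (rule set_integrable_subset) (auto dest: cell_child_subset)

lemma set_integral_cell_children:
  fixes f :: "'a::euclidean_space \<Rightarrow> 'b::{banach, second_countable_topology}"
  assumes "set_integrable lebesgue (cell Q) f"
  shows "(\<Sum>R\<in>children Q. LINT x:cell R|lebesgue. f x) = (LINT x:cell Q|lebesgue. f x)"
  by (subst cell_children, subst set_integral_finite_Union)
    (auto intro: disjoint_children set_integrable_cell_subset[OF assms])

lemma measure_cell: "measure lebesgue (cell Q) = cvol Q"
  using emeasure_cell[of Q] cvol_pos[of Q] by (simp add: measure_def)

lemma cvol_sum: "(\<Sum>R\<in>children Q. cvol R) = cvol Q"
proof -
  have "cvol Q = measure lebesgue (\<Union>R\<in>children Q. cell R)"
    by (simp add: measure_cell cell_children[symmetric])
  also have "\<dots> = (\<Sum>R\<in>children Q. measure lebesgue (cell R))"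
    by (intro measure_finite_Union disjoint_children) (auto simp: emeasure_cell)
  finally show ?thesis by (simp add: measure_cell)
qed

global_interpretation cubes: vtree children "cvol :: 'a::euclidean_space cube \<Rightarrow> real" "2 ^ DIM('a)"
proof
  fix R Q :: "'a cube"
  assume "R \<in> children Q"
  then show "cvol Q \<le> 2 ^ DIM('a) * cvol R" by (simp add: cvol_child)
qed (simp_all add: cvol_pos cvol_sum)

lemma additive_set_integral:
  fixes f :: "'a::euclidean_space \<Rightarrow> 'b::{banach, second_countable_topology}"
  assumes "\<And>Q. set_integrable lebesgue (cell Q) f"
  shows "cubes.additive (\<lambda>Q. LINT x:cell Q|lebesgue. f x)"
  using assms by (simp add: cubes.additive_def set_integral_cell_children)

lemma norm_diff_cell:
  assumes "x \<in> cell Q" "y \<in> cell Q"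
  shows "norm (x - y) \<le> DIM('a) * side (snd (Q :: 'a::euclidean_space cube))"
proof (cases Q)
  case (Pair c k)
  have "norm (x - y) \<le> (\<Sum>b\<in>Basis. \<bar>(x - y) \<bullet> b\<bar>)" by (rule norm_le_l1)
  also have "\<dots> \<le> (\<Sum>b\<in>(Basis :: 'a set). side k)"
    using assms by (intro sum_mono) (auto simp: Pair inner_diff_left abs_le_iff dest!: bspec)
  finally show ?thesis by (simp add: Pair)
qed

lemma corner_in_cell: "fst Q \<in> cell Q"
  by (cases Q) simp

lemma cell_subset_cball: "x \<in> cell Q \<Longrightarrow> cell Q \<subseteq> cball x (DIM('a) * side (snd (Q :: 'a::euclidean_space cube)))"
  using norm_diff_cell[of x Q] by (auto simp del: cell.simps simp: dist_norm)

declare cell.simps [simp del] children.simps [simp del]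

section \<open>Shifted dyadic grids\<close>

text \<open>Displacement of the grid in units of the side length, with \<open>S\<close> the set of
  shifted coordinates. The sign alternates with the level because 2/3 and -1/3 differ by an integer,
  which keeps consecutive levels nested.\<close>

definition shift :: "'a::euclidean_space set \<Rightarrow> int \<Rightarrow> 'a \<Rightarrow> real" where
  "shift S k b = (if b \<in> S then if even k then 1 / 3 else - 1 / 3 else 0)"

definition cube_at :: "'a::euclidean_space set \<Rightarrow> int \<Rightarrow> 'a \<Rightarrow> 'a cube" where
  "cube_at S k x = (\<Sum>b\<in>Basis. (side k * (of_int \<lfloor>x \<bullet> b / side k - shift S k b\<rfloor> + shift S k b)) *\<^sub>R b, k)"

lemma snd_cube_at [simp]: "snd (cube_at S k x) = k"
  by (simp add: cube_at_def)

lemma mem_cell_cube_at: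
  "y \<in> cell (cube_at S k x) \<longleftrightarrow>
    (\<forall>b\<in>Basis. \<lfloor>y \<bullet> b / side k - shift S k b\<rfloor> = \<lfloor>x \<bullet> b / side k - shift S k b\<rfloor>)"
proof -
  have "side k * (of_int n + s) \<le> z \<and> z < side k * (of_int n + s) + side k \<longleftrightarrow> \<lfloor>z / side k - s\<rfloor> = n"
    for n :: int and s z :: real
  proof -
    have "side k * (of_int n + s) \<le> z \<longleftrightarrow> of_int n \<le> z / side k - s"
      using side_pos[of k] by (simp add: field_simps)
    moreover have "z < side k * (of_int n + s) + side k \<longleftrightarrow> z / side k - s < of_int n + 1"
      using side_pos[of k] by (simp add: field_simps)
    ultimately show ?thesis by (simp add: floor_eq_iff)
  qed
  then show ?thesis
    by (simp add: cell.simps cube_at_def inner_sum_left inner_Basis if_distrib cong: if_cong)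
qed

lemma in_cell_cube_at [simp]: "x \<in> cell (cube_at S k x)"
  by (simp add: mem_cell_cube_at)

lemma cube_at_eq: "y \<in> cell (cube_at S k x) \<Longrightarrow> cube_at S k y = cube_at S k x"
  unfolding mem_cell_cube_at by (simp add: cube_at_def)

lemma cube_at_child: "cube_at S (k + 1) x \<in> children (cube_at S k x)"
proof -
  define d where "d b = \<lfloor>2 * (x \<bullet> b / side k - shift S k b)\<rfloor> - 2 * \<lfloor>x \<bullet> b / side k - shift S k b\<rfloor>" for b
  define T where "T = {b\<in>Basis. d b = 1}"
  have T: "T \<subseteq> Basis" by (auto simp: T_def)
  have "\<lfloor>2 * r\<rfloor> - 2 * \<lfloor>r\<rfloor> = 0 \<or> \<lfloor>2 * r\<rfloor> - 2 * \<lfloor>r\<rfloor> = 1" for r :: real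
    by linarith
  then have d: "d b = 0 \<or> d b = 1" for b
    unfolding d_def by blast
  have "side (k + 1) * (of_int \<lfloor>x \<bullet> b / side (k + 1) - shift S (k + 1) b\<rfloor> + shift S (k + 1) b)
      = side k * (of_int \<lfloor>x \<bullet> b / side k - shift S k b\<rfloor> + shift S k b) + side (k + 1) * of_int (d b)" for b
  proof -
    define u where "u = x \<bullet> b / side k"
    \<comment> \<open>Twice the shift at level k minus the shift at level k + 1 is three times the
      former, an integer; floors at the two levels therefore correspond.\<close>
    obtain z :: int where z: "3 * shift S k b = of_int z" "shift S (k + 1) b = - shift S k b"
    proof
      show "3 * shift S k b = of_int (if b \<in> S then if even k then 1 else -1 else 0)"
        "shift S (k + 1) b = - shift S k b"
        by (auto simp: shift_def)
    qed
    have u2: "x \<bullet> b / side (k + 1) = 2 * u" using side_half[of k] by (simp add: u_def)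
    have "2 * u - shift S (k + 1) b = 2 * (u - shift S k b) + of_int z"
      using z by (simp add: algebra_simps)
    then have "\<lfloor>2 * u - shift S (k + 1) b\<rfloor> = \<lfloor>2 * (u - shift S k b)\<rfloor> + z"
      by (metis floor_add_int)
    moreover define f g where "f = \<lfloor>2 * (u - shift S k b)\<rfloor>" and "g = \<lfloor>u - shift S k b\<rfloor>"
    moreover define h where "h = side (k + 1)"
    moreover have "h * (of_int (f + z) + - shift S k b) = 2 * h * (of_int g + shift S k b) + h * of_int (f - 2 * g)"
      by (simp add: z(1)[symmetric] algebra_simps)
    ultimately show ?thesis
      unfolding u2 d_def unfolding u_def[symmetric] unfolding side_half[of k] using z(2) by simp
  qed
  then have "cube_at S (k + 1) x = (\<Sum>b\<in>Basis. (side k * (of_int \<lfloor>x \<bullet> b / side k - shift S k b\<rfloor> + shift S k b) + side (k + 1) * of_int (d b)) *\<^sub>R b, k + 1)"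
    by (simp add: cube_at_def)
  also have "\<dots> = (fst (cube_at S k x) + side (k + 1) *\<^sub>R (\<Sum>b\<in>Basis. of_int (d b) *\<^sub>R b), k + 1)"
    by (simp add: cube_at_def scaleR_add_left sum.distrib scaleR_sum_right)
  also have "(\<Sum>b\<in>Basis. of_int (d b) *\<^sub>R b) = (\<Sum>b\<in>Basis. if b \<in> T then b else 0)"
    using d by (intro sum.cong) (auto simp: T_def)
  also have "\<dots> = \<Sum>T" using T by (simp add: sum.inter_restrict[symmetric] Int_absorb1)
  finally show ?thesis using T by (auto simp: cube_at_def children.simps)
qed

lemma floor_shift:
  fixes u d :: real
  assumes "0 \<le> d" "d < 1 / 3" "\<lfloor>u\<rfloor> \<noteq> \<lfloor>u + d\<rfloor>"
  shows "\<lfloor>u - 1 / 3\<rfloor> = \<lfloor>u + d - 1 / 3\<rfloor>" "\<lfloor>u + 1 / 3\<rfloor> = \<lfloor>u + d + 1 / 3\<rfloor>"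
proof -
  define n where "n = \<lfloor>u + d\<rfloor>"
  have n: "of_int n \<le> u + d" "u < of_int n" using assms unfolding n_def by linarith+
  have "\<lfloor>u - 1 / 3\<rfloor> = n - 1" "\<lfloor>u + d - 1 / 3\<rfloor> = n - 1" "\<lfloor>u + 1 / 3\<rfloor> = n" "\<lfloor>u + d + 1 / 3\<rfloor> = n"
    using n assms(1,2) by (auto simp: floor_eq_iff)
  then show "\<lfloor>u - 1 / 3\<rfloor> = \<lfloor>u + d - 1 / 3\<rfloor>" "\<lfloor>u + 1 / 3\<rfloor> = \<lfloor>u + d + 1 / 3\<rfloor>"
    by simp_all
qed

text \<open>The one-third trick: in each coordinate an interval shorter than a third of the side length
  is cut by at most one of the two grids.\<close>

lemma one_third_trick:
  fixes y :: "'a::euclidean_space"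
  assumes t: "0 < t" "6 * t < side k"
  obtains S where "S \<subseteq> Basis" "\<And>x. x \<in> cball y t \<Longrightarrow> cball y t \<subseteq> cell (cube_at S k x)"
proof
  define u where "u b = (y \<bullet> b - t) / side k" for b
  define d where "d = 2 * t / side k"
  \<comment> \<open>Exactly the coordinates in which the unshifted grid cuts the interval are
    shifted. As d is below 1/3, \<open>floor_shift\<close> excludes a second cut for either sign of
    the shift.\<close>
  define S where "S = {b\<in>Basis. \<lfloor>u b\<rfloor> \<noteq> \<lfloor>u b + d\<rfloor>}"
  show "S \<subseteq> Basis" by (auto simp: S_def)
  have d: "0 \<le> d" "d < 1 / 3" using t by (auto simp: d_def field_simps)
  have fl: "\<lfloor>u b - shift S k b\<rfloor> = \<lfloor>u b + d - shift S k b\<rfloor>" if "b \<in> Basis" for b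
    using floor_shift[OF d, of "u b"] that by (auto simp: shift_def S_def)
  have fz: "\<lfloor>z \<bullet> b / side k - shift S k b\<rfloor> = \<lfloor>u b - shift S k b\<rfloor>" if "b \<in> Basis" "z \<in> cball y t" for b z
  proof -
    have "\<bar>(y - z) \<bullet> b\<bar> \<le> t" using Basis_le_norm[OF that(1), of "y - z"] that(2) by (simp add: dist_norm)
    then have "y \<bullet> b - t \<le> z \<bullet> b" "z \<bullet> b \<le> y \<bullet> b + t" by (auto simp: inner_diff_left)
    then have "u b \<le> z \<bullet> b / side k" "z \<bullet> b / side k \<le> u b + d"
      using side_pos[of k] by (simp_all add: u_def d_def divide_right_mono add_divide_distrib[symmetric])
    then have "\<lfloor>u b - shift S k b\<rfloor> \<le> \<lfloor>z \<bullet> b / side k - shift S k b\<rfloor>"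
      "\<lfloor>z \<bullet> b / side k - shift S k b\<rfloor> \<le> \<lfloor>u b + d - shift S k b\<rfloor>"
      by (auto intro!: floor_mono)
    then show ?thesis using fl[OF that(1)] by simp
  qed
  show "cball y t \<subseteq> cell (cube_at S k x)" if "x \<in> cball y t" for x
    using that by (auto simp: mem_cell_cube_at fz simp del: mem_cball)
qed

text \<open>The sum of a^2 over the chain of cubes through \<open>x\<close>, from \<open>Q\<close>
  down through \<open>e\<close> generations. The form with indicators over children matches the tree
  recursion and gives measurability and boundedness by induction.\<close>

primrec Hsum :: "('a::euclidean_space cube \<Rightarrow> real) \<Rightarrow> nat \<Rightarrow> 'a cube \<Rightarrow> 'a \<Rightarrow> real" where
  "Hsum a 0 Q x = 0"
| "Hsum a (Suc e) Q x = (a Q)\<^sup>2 + (\<Sum>R\<in>children Q. indicator (cell R) x * Hsum a e R x)"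

lemma sum_indicator_child:
  assumes "R \<in> children Q" "x \<in> cell R"
  shows "(\<Sum>R\<in>children Q. indicator (cell R) x * (g R :: real)) = g R"
proof -
  have "(\<Sum>R'\<in>children Q. indicator (cell R') x * g R') = (\<Sum>R'\<in>children Q. if R' = R then g R' else 0)"
  proof (rule sum.cong[OF refl])
    fix R' assume "R' \<in> children Q"
    then have "x \<in> cell R' \<longleftrightarrow> R' = R"
      using assms cell_children_unique[of R' Q R x] by metis
    then show "indicator (cell R') x * g R' = (if R' = R then g R' else 0)"
      by (auto simp: indicator_def)
  qed
  also have "\<dots> = g R" using assms by simp
  finally show ?thesis .
qed

lemma Hsum_child: "R \<in> children Q \<Longrightarrow> x \<in> cell R \<Longrightarrow> Hsum a (Suc e) Q x = (a Q)\<^sup>2 + Hsum a e R x"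
  unfolding Hsum.simps by (subst sum_indicator_child) auto

lemma Hsum_cube_at: "Hsum a e (cube_at S k x) x = (\<Sum>i<e. (a (cube_at S (k + int i) x))\<^sup>2)"
proof (induction e arbitrary: k)
  case (Suc e)
  have "Hsum a (Suc e) (cube_at S k x) x = (a (cube_at S k x))\<^sup>2 + Hsum a e (cube_at S (k + 1) x) x"
    by (rule Hsum_child[OF cube_at_child]) simp
  then show ?case
    unfolding Suc.IH sum.lessThan_Suc_shift by (simp add: algebra_simps)
qed simp

lemma Hsum_measurable [measurable]: "(\<lambda>x. Hsum a e Q x) \<in> borel_measurable borel"
proof (induction e arbitrary: Q)
  case 0
  then show ?case by simp
next
  case (Suc e)
  note [measurable] = Suc
  show ?case unfolding Hsum.simps by measurable
qed

lemma Hsum_nonneg: "0 \<le> Hsum a e Q x"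
  by (induction e arbitrary: Q) (auto intro!: add_nonneg_nonneg sum_nonneg mult_nonneg_nonneg)

lemma Hsum_bounded: "\<exists>M. \<forall>x. Hsum a e Q x \<le> M"
proof (induction e arbitrary: Q)
  case (Suc e)
  then obtain M where M: "\<And>R x. Hsum a e R x \<le> M R" by metis
  have "Hsum a (Suc e) Q x \<le> (a Q)\<^sup>2 + (\<Sum>R\<in>children Q. M R)" for x
    unfolding Hsum.simps
  proof (intro add_left_mono sum_mono)
    show "indicator (cell R) x * Hsum a e R x \<le> M R" for R
      using M[of R x] Hsum_nonneg[of a e R x] by (simp add: indicator_def)
  qed
  then show ?case by blast
qed auto

section \<open>The weighted estimate on a cube\<close>

lemma Holder_integral:
  fixes u v f :: "'a \<Rightarrow> real"
  assumes ab: "0 < \<alpha>" "0 < \<beta>" "\<alpha> + \<beta> = 1"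
    and int: "integrable M u" "integrable M v" "integrable M f"
    and nn: "AE x in M. 0 \<le> u x" "AE x in M. 0 \<le> v x"
    and le: "AE x in M. f x \<le> u x powr \<alpha> * v x powr \<beta>"
  shows "(LINT x|M. f x) \<le> (LINT x|M. u x) powr \<alpha> * (LINT x|M. v x) powr \<beta>"
proof -
  let ?X = "LINT x|M. u x" and ?Y = "LINT x|M. v x"
  have XY: "0 \<le> ?X" "0 \<le> ?Y" using nn by (auto intro: integral_nonneg_AE)
  show ?thesis
  proof (cases "?X = 0 \<or> ?Y = 0")
    case True
    then have "(AE x in M. u x = 0) \<or> (AE x in M. v x = 0)"
      using integral_nonneg_eq_0_iff_AE[OF int(1) nn(1)] integral_nonneg_eq_0_iff_AE[OF int(2) nn(2)] by blast
    then have "AE x in M. u x = 0 \<or> v x = 0"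
      by (auto elim!: eventually_mono)
    then have "AE x in M. f x \<le> 0"
      using le by eventually_elim auto
    then have "(LINT x|M. f x) \<le> (LINT x|M. 0)"
      by (intro integral_mono_AE int) auto
    then show ?thesis using XY by (simp add: order_trans[OF _ mult_nonneg_nonneg])
  next
    case False
    then have pos: "0 < ?X" "0 < ?Y" using XY by auto
    define c where "c = ?X powr \<alpha> * ?Y powr \<beta>"
    have c: "0 < c" using pos by (simp add: c_def)
    have "AE x in M. f x \<le> c * (\<alpha> / ?X * u x + \<beta> / ?Y * v x)"
      using le nn
    proof eventually_elim
      case (elim x)
      have "u x powr \<alpha> * v x powr \<beta> = c * ((u x / ?X) powr \<alpha> * (v x / ?Y) powr \<beta>)"
        using pos elim by (simp add: c_def powr_divide)
      also have "\<dots> \<le> c * (\<alpha> * (u x / ?X) + \<beta> * (v x / ?Y))"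
        using ab pos elim c by (intro mult_left_mono Young_0) auto
      finally show ?case using elim by simp
    qed
    then have "(LINT x|M. f x) \<le> (LINT x|M. c * (\<alpha> / ?X * u x + \<beta> / ?Y * v x))"
      using int by (intro integral_mono_AE) auto
    also have "\<dots> = c * (\<alpha> / ?X * ?X + \<beta> / ?Y * ?Y)"
      using int by simp
    also have "\<dots> = c" using pos ab by simp
    finally show ?thesis by (simp add: c_def)
  qed
qed

lemma Holder_set_integral:
  fixes u v f :: "'a \<Rightarrow> real"
  assumes "0 < \<alpha>" "0 < \<beta>" "\<alpha> + \<beta> = 1"
    and "set_integrable M S u" "set_integrable M S v" "set_integrable M S f"
    and "AE x in M. x \<in> S \<longrightarrow> 0 \<le> u x" "AE x in M. x \<in> S \<longrightarrow> 0 \<le> v x"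
    and "AE x in M. x \<in> S \<longrightarrow> f x \<le> u x powr \<alpha> * v x powr \<beta>"
  shows "(LINT x:S|M. f x) \<le> (LINT x:S|M. u x) powr \<alpha> * (LINT x:S|M. v x) powr \<beta>"
  unfolding set_lebesgue_integral_def
proof (rule Holder_integral[OF assms(1-3)])
  show "AE x in M. indicat_real S x *\<^sub>R f x \<le> (indicat_real S x *\<^sub>R u x) powr \<alpha> * (indicat_real S x *\<^sub>R v x) powr \<beta>"
    using assms(9) by eventually_elim (auto simp: indicator_def)
  show "AE x in M. 0 \<le> indicat_real S x *\<^sub>R u x" "AE x in M. 0 \<le> indicat_real S x *\<^sub>R v x"
    using assms(7,8) by (eventually_elim; auto simp: indicator_def)+
qed (use assms in \<open>auto simp: set_integrable_def\<close>)

lemma set_integrable_bounded_mult: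
  fixes h w :: "'a \<Rightarrow> real"
  assumes "set_integrable M S w" "h \<in> borel_measurable M" "\<And>x. \<bar>h x\<bar> \<le> C"
  shows "set_integrable M S (\<lambda>x. h x * w x)"
proof -
  have "integrable M (\<lambda>x. C * (indicator S x *\<^sub>R w x))"
    using assms(1) by (simp add: set_integrable_def)
  moreover have "(\<lambda>x. indicator S x *\<^sub>R (h x * w x)) \<in> borel_measurable M"
  proof -
    have "(\<lambda>x. h x * (indicator S x *\<^sub>R w x)) \<in> borel_measurable M"
      using assms(1,2) by (auto simp: set_integrable_def)
    then show ?thesis by (simp add: mult_ac)
  qed
  moreover have "AE x in M. norm (indicator S x *\<^sub>R (h x * w x)) \<le> norm (C * (indicator S x *\<^sub>R w x))"
    using assms(3) by (auto simp: indicator_def abs_mult intro!: mult_right_mono order_trans[OF assms(3)] )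
  ultimately show ?thesis
    unfolding set_integrable_def by (rule Bochner_Integration.integrable_bound)
qed

lemma nn_set_integral_eq:
  fixes u :: "'a \<Rightarrow> real"
  assumes "set_integrable M S u" "\<And>x. 0 \<le> u x"
  shows "(\<integral>\<^sup>+x\<in>S. ennreal (u x) \<partial>M) = ennreal (LINT x:S|M. u x)"
proof -
  have "(\<integral>\<^sup>+x\<in>S. ennreal (u x) \<partial>M) = (\<integral>\<^sup>+x. ennreal (indicator S x *\<^sub>R u x) \<partial>M)"
    by (intro nn_integral_cong) (auto simp: indicator_def)
  also have "\<dots> = ennreal (LINT x:S|M. u x)"
    unfolding set_lebesgue_integral_def using assms
    by (intro nn_integral_eq_integral) (auto simp: set_integrable_def)
  finally show ?thesis .
qed

text \<open>The coefficient a_Q of the overview for the ell2-valued function with components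
  \<open>f j\<close>, \<open>j\<close> in \<open>J\<close>.\<close>

definition acoef :: "real \<Rightarrow> 'j set \<Rightarrow> ('j \<Rightarrow> 'a::euclidean_space \<Rightarrow> complex) \<Rightarrow> 'a cube \<Rightarrow> real" where
  "acoef \<theta> J f Q = cubes.blim \<theta> J (\<lambda>j Q. LINT x:cell Q|lebesgue. f j x) Q / cvol Q"

text \<open>Minkowski's integral inequality by duality: with \<open>v\<close> the vector of
  integrals, the square of its norm is the integral of the inner product of \<open>v\<close> with
  the function. Cauchy-Schwarz under the integral leaves one factor of the norm to cancel.\<close>

lemma L2_set_integral_le:
  fixes f :: "'j \<Rightarrow> 'a \<Rightarrow> complex"
  assumes "finite J" "\<And>j. j \<in> J \<Longrightarrow> set_integrable M S (f j)"
  shows "set_integrable M S (\<lambda>x. L2_set (\<lambda>j. norm (f j x)) J)"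
    and "L2_set (\<lambda>j. norm (LINT x:S|M. f j x)) J \<le> (LINT x:S|M. L2_set (\<lambda>j. norm (f j x)) J)"
proof -
  let ?g = "\<lambda>j x. indicator S x *\<^sub>R f j x"
  let ?F = "\<lambda>x. L2_set (\<lambda>j. norm (?g j x)) J"
  have g: "integrable M (?g j)" if "j \<in> J" for j using assms(2)[OF that] by (simp add: set_integrable_def)
  have F: "indicator S x *\<^sub>R L2_set (\<lambda>j. norm (f j x)) J = ?F x" for x
    by (simp add: indicator_def L2_set_def)
  have "integrable M (\<lambda>x. \<Sum>j\<in>J. norm (?g j x))"
    using g by (intro Bochner_Integration.integrable_sum integrable_norm)
  moreover have "?F \<in> borel_measurable M"
  proof -
    have [measurable]: "(\<lambda>x. \<Sum>j\<in>J. (norm (?g j x))\<^sup>2) \<in> borel_measurable M"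
      using g by (intro borel_measurable_sum borel_measurable_power borel_measurable_integrable integrable_norm)
    show ?thesis unfolding L2_set_def by measurable
  qed
  moreover have "AE x in M. norm (?F x) \<le> norm (\<Sum>j\<in>J. norm (?g j x))"
  proof (rule AE_I2)
    fix x
    have "?F x \<le> (\<Sum>j\<in>J. norm (?g j x))" by (rule L2_set_le_sum) simp
    then show "norm (?F x) \<le> norm (\<Sum>j\<in>J. norm (?g j x))"
      using L2_set_nonneg[of "\<lambda>j. norm (?g j x)" J] by (simp del: norm_scaleR)
  qed
  ultimately have intF: "integrable M ?F"
    by (rule Bochner_Integration.integrable_bound)
  then show "set_integrable M S (\<lambda>x. L2_set (\<lambda>j. norm (f j x)) J)"
    by (simp only: set_integrable_def F)
  define v where "v j = (LINT x|M. ?g j x)" for j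
  let ?L = "L2_set (\<lambda>j. norm (v j)) J"
  have "?L\<^sup>2 = (\<Sum>j\<in>J. v j \<bullet> v j)"
    by (simp add: L2_set_def sum_nonneg power2_norm_eq_inner)
  also have "\<dots> = (\<Sum>j\<in>J. (LINT x|M. v j \<bullet> ?g j x))"
    using g by (intro sum.cong refl) (subst (2) v_def, subst integral_inner_right, auto)
  also have "\<dots> = (LINT x|M. (\<Sum>j\<in>J. v j \<bullet> ?g j x))"
    using g by (intro Bochner_Integration.integral_sum[symmetric] integrable_inner_right) auto
  also have "\<dots> \<le> (LINT x|M. ?L * ?F x)"
  proof (rule integral_mono)
    show "integrable M (\<lambda>x. \<Sum>j\<in>J. v j \<bullet> ?g j x)"
      using g by (intro Bochner_Integration.integrable_sum integrable_inner_right) auto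
    show "integrable M (\<lambda>x. ?L * ?F x)" using intF by simp
    fix x
    have "(\<Sum>j\<in>J. v j \<bullet> ?g j x) \<le> (\<Sum>j\<in>J. \<bar>norm (v j)\<bar> * \<bar>norm (?g j x)\<bar>)"
      by (intro sum_mono) (simp only: abs_norm_cancel norm_cauchy_schwarz)
    also have "\<dots> \<le> ?L * ?F x" by (rule L2_set_mult_ineq)
    finally show "(\<Sum>j\<in>J. v j \<bullet> ?g j x) \<le> ?L * ?F x" .
  qed
  finally have "?L * ?L \<le> ?L * (LINT x|M. ?F x)" by (simp add: power2_eq_square)
  moreover have "0 \<le> ?L" "0 \<le> (LINT x|M. ?F x)"
    by (auto intro!: L2_set_nonneg integral_nonneg)
  ultimately have "?L \<le> (LINT x|M. ?F x)"
    by (cases "?L = 0") (auto simp: mult_le_cancel_left)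
  then show "L2_set (\<lambda>j. norm (LINT x:S|M. f j x)) J \<le> (LINT x:S|M. L2_set (\<lambda>j. norm (f j x)) J)"
    by (simp only: set_lebesgue_integral_def F v_def)
qed

lemma martingale_cells:
  fixes f :: "'j \<Rightarrow> 'a::euclidean_space \<Rightarrow> complex"
  assumes "0 < \<theta>" "\<theta> < 1" "finite J" and f: "\<And>j Q. j \<in> J \<Longrightarrow> set_integrable lebesgue (cell Q) (f j)"
  shows "vtree_martingale children cvol (2 ^ DIM('a)) \<theta> J (\<lambda>j Q. LINT x:cell Q|lebesgue. f j x)
    (\<lambda>Q. LINT x:cell Q|lebesgue. L2_set (\<lambda>j. norm (f j x)) J)"
proof unfold_locales
  show "L2_set (\<lambda>j. norm (LINT x:cell Q|lebesgue. f j x)) J \<le> (LINT x:cell Q|lebesgue. L2_set (\<lambda>j. norm (f j x)) J)" for Q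
    by (rule L2_set_integral_le(2)[OF assms(3) f])
qed (use assms in \<open>auto intro!: additive_set_integral L2_set_integral_le(1)\<close>)

lemma
  fixes f :: "'j \<Rightarrow> 'a::euclidean_space \<Rightarrow> complex"
  assumes "0 < \<theta>" "\<theta> < 1" "finite J" and f: "\<And>j Q. j \<in> J \<Longrightarrow> set_integrable lebesgue (cell Q) (f j)"
  shows acoef_nonneg: "0 \<le> acoef \<theta> J f Q"
    and acoef_le: "acoef \<theta> J f Q \<le> 2 / (1 - \<theta>) * ((LINT x:cell Q|lebesgue. L2_set (\<lambda>j. norm (f j x)) J) / cvol Q)"
    and L2_set_acoef: "L2_set (\<lambda>j. acoef \<theta> {j} f Q) J \<le> acoef \<theta> J f Q"
proof -
  interpret vtree_martingale children cvol "2 ^ DIM('a)" \<theta> J "\<lambda>j Q. LINT x:cell Q|lebesgue. f j x"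
    "\<lambda>Q. LINT x:cell Q|lebesgue. L2_set (\<lambda>j. norm (f j x)) J"
    by (rule martingale_cells[OF assms])
  have eq: "acoef \<theta> J f Q = a Q" by (simp add: acoef_def a_def)
  show "0 \<le> acoef \<theta> J f Q" unfolding eq by (rule a_nonneg)
  show "acoef \<theta> J f Q \<le> 2 / (1 - \<theta>) * ((LINT x:cell Q|lebesgue. L2_set (\<lambda>j. norm (f j x)) J) / cvol Q)"
    unfolding eq by (rule a_le)
  let ?\<mu> = "\<lambda>j Q. LINT x:cell Q|lebesgue. f j x"
  have "(\<lambda>d. cubes.bdepth \<theta> {j} ?\<mu> d Q) \<longlonglongrightarrow> cubes.blim \<theta> {j} ?\<mu> Q" if "j \<in> J" for j
  proof -
    interpret one: vtree_martingale children cvol "2 ^ DIM('a)" \<theta> "{j}" ?\<mu>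
      "\<lambda>Q. LINT x:cell Q|lebesgue. L2_set (\<lambda>j. norm (f j x)) {j}"
      by (rule martingale_cells) (use assms that in auto)
    show ?thesis by (rule one.bdepth_tendsto)
  qed
  then have "(\<lambda>d. L2_set (\<lambda>j. cubes.bdepth \<theta> {j} ?\<mu> d Q) J) \<longlonglongrightarrow> L2_set (\<lambda>j. cubes.blim \<theta> {j} ?\<mu> Q) J"
    unfolding L2_set_def by (intro tendsto_intros)
  then have le: "L2_set (\<lambda>j. cubes.blim \<theta> {j} ?\<mu> Q) J \<le> b Q"
    using bdepth_tendsto by (rule LIMSEQ_le) (use assms in \<open>auto intro!: cubes.L2_set_bdepth\<close>)
  have "L2_set (\<lambda>j. acoef \<theta> {j} f Q) J = L2_set (\<lambda>j. cubes.blim \<theta> {j} ?\<mu> Q) J / cvol Q"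
    using cvol_pos[of Q] L2_set_left_distrib[of "1 / cvol Q" "\<lambda>j. cubes.blim \<theta> {j} ?\<mu> Q" J]
    by (simp add: acoef_def)
  also have "\<dots> \<le> b Q / cvol Q" using cvol_pos[of Q] by (intro divide_right_mono le) auto
  finally show "L2_set (\<lambda>j. acoef \<theta> {j} f Q) J \<le> acoef \<theta> J f Q" by (simp add: eq a_def)
qed

lemma conj_power:
  assumes "1 < p" "0 < x"
  shows "x powr (1 / p) * (x powr (- 1 / (p - 1))) powr (1 - 1 / p) = (1 :: real)"
proof -
  have "- 1 / (p - 1) * (1 - 1 / p) = - (1 / p)" using assms by (simp add: field_simps)
  then have "(x powr (- 1 / (p - 1))) powr (1 - 1 / p) = x powr (- (1 / p))"
    by (simp only: powr_powr)
  then show ?thesis using assms by (simp only: powr_add[symmetric]) simp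
qed

text \<open>Hoelder's inequality for the factorisation of 1 as w^(1/p) times w^(-1/p). It also
  forces both weights to have positive mass on sets of positive measure.\<close>

lemma measure_le_dual_weights:
  fixes w :: "'a \<Rightarrow> real"
  assumes p: "1 < p" and pos: "AE x in M. 0 < w x" and S: "S \<in> sets M" "emeasure M S < \<infinity>"
    and int: "set_integrable M S w" "set_integrable M S (\<lambda>x. w x powr (- 1 / (p - 1)))"
  shows "measure M S \<le> (LINT x:S|M. w x) powr (1 / p) * (LINT x:S|M. w x powr (- 1 / (p - 1))) powr (1 - 1 / p)"
proof -
  have one: "set_integrable M S (\<lambda>x. 1 :: real)"
    using S by (simp add: set_integrable_def)
  have "(LINT x:S|M. 1) \<le> (LINT x:S|M. w x) powr (1 / p) * (LINT x:S|M. w x powr (- 1 / (p - 1))) powr (1 - 1 / p)"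
  proof (rule Holder_set_integral[OF _ _ _ int one])
    show "AE x in M. x \<in> S \<longrightarrow> 1 \<le> w x powr (1 / p) * (w x powr (- 1 / (p - 1))) powr (1 - 1 / p)"
      using pos by eventually_elim (simp only: conj_power[OF p] order_refl simp_thms)
    show "AE x in M. x \<in> S \<longrightarrow> 0 \<le> w x" using pos by eventually_elim auto
  qed (use p in auto)
  also have "(LINT x:S|M. 1) = measure M S"
    using S by (simp add: set_lebesgue_integral_def)
  finally show ?thesis .
qed

section \<open>Transfer from the tree to integrals against the weight\<close>

locale Ap_cubes =
  fixes w :: "'a::euclidean_space \<Rightarrow> real" and p K :: real
  assumes p: "1 < p" and K: "0 < K"
    and w_measurable [measurable]: "w \<in> borel_measurable lebesgue"
    and w_pos_AE: "AE x in lebesgue. 0 < w x"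
    and w_integrable: "set_integrable lebesgue (cell Q) w"
    and sigma_integrable: "set_integrable lebesgue (cell Q) (\<lambda>x. w x powr (- 1 / (p - 1)))"
    and Ap: "(LINT x:cell Q|lebesgue. w x) powr (1 / p)
      * (LINT x:cell Q|lebesgue. w x powr (- 1 / (p - 1))) powr (1 - 1 / p) \<le> K * cvol Q"
begin

definition wm :: "'a cube \<Rightarrow> real" where "wm Q = (LINT x:cell Q|lebesgue. w x)"

definition \<sigma>m :: "'a cube \<Rightarrow> real" where "\<sigma>m Q = (LINT x:cell Q|lebesgue. w x powr (- 1 / (p - 1)))"

lemma exponents: "0 < 1 / p" "0 < 1 - 1 / p" "1 / p + (1 - 1 / p) = 1"
  using p by auto

lemma w_nn_AE: "AE x in lebesgue. x \<in> S \<longrightarrow> 0 \<le> w x"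
  using w_pos_AE by eventually_elim auto

lemma vol_le: "cvol Q \<le> wm Q powr (1 / p) * \<sigma>m Q powr (1 - 1 / p)"
  using measure_le_dual_weights[OF p w_pos_AE cell_lebesgue _ w_integrable sigma_integrable, of Q]
  unfolding wm_def \<sigma>m_def measure_cell emeasure_cell by simp

lemma wm_pos: "0 < wm Q" and \<sigma>m_pos: "0 < \<sigma>m Q"
proof -
  have "0 \<le> wm Q" "0 \<le> \<sigma>m Q"
    unfolding wm_def \<sigma>m_def set_lebesgue_integral_def using w_pos_AE
    by (auto intro!: integral_nonneg_AE elim!: eventually_mono)
  moreover have "wm Q \<noteq> 0" "\<sigma>m Q \<noteq> 0" using vol_le[of Q] cvol_pos[of Q] by auto
  ultimately show "0 < wm Q" "0 < \<sigma>m Q" by auto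
qed

lemma f_le_Holder:
  assumes "set_integrable lebesgue (cell Q) (\<lambda>x. F x powr p * w x)" "set_integrable lebesgue (cell Q) F"
    and "\<And>x. 0 \<le> F x"
  shows "(LINT x:cell Q|lebesgue. F x) \<le> (LINT x:cell Q|lebesgue. F x powr p * w x) powr (1 / p) * \<sigma>m Q powr (1 - 1 / p)"
  unfolding \<sigma>m_def
proof (rule Holder_set_integral[OF exponents assms(1) sigma_integrable assms(2)])
  show "AE x in lebesgue. x \<in> cell Q \<longrightarrow> 0 \<le> F x powr p * w x"
    using w_pos_AE by eventually_elim auto
  show "AE x in lebesgue. x \<in> cell Q \<longrightarrow> F x \<le> (F x powr p * w x) powr (1 / p) * (w x powr (- 1 / (p - 1))) powr (1 - 1 / p)"
    using w_pos_AE
  proof eventually_elim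
    case (elim x)
    have "(F x powr p * w x) powr (1 / p) * (w x powr (- 1 / (p - 1))) powr (1 - 1 / p)
       = F x * (w x powr (1 / p) * (w x powr (- 1 / (p - 1))) powr (1 - 1 / p))"
      using elim p assms(3)[of x] by (simp only: powr_mult powr_powr mult.assoc) simp
    then show ?case using elim by (simp only: conj_power[OF p]) simp
  qed
qed auto

end

locale Ap_cubes_data = Ap_cubes w p K for w :: "'a::euclidean_space \<Rightarrow> real" and p K +
  fixes \<theta> :: real and J :: "'j set" and f :: "'j \<Rightarrow> 'a \<Rightarrow> complex"
  assumes theta: "0 < \<theta>" "\<theta> < 1" and finite_J: "finite J"
    and f_integrable: "j \<in> J \<Longrightarrow> set_integrable lebesgue (cell Q) (f j)"
    and Fp_integrable: "set_integrable lebesgue (cell Q) (\<lambda>x. L2_set (\<lambda>j. norm (f j x)) J powr p * w x)"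
begin

abbreviation "F \<equiv> \<lambda>x. L2_set (\<lambda>j. norm (f j x)) J"
abbreviation "Fm \<equiv> \<lambda>Q. LINT x:cell Q|lebesgue. F x"
abbreviation "Fp \<equiv> \<lambda>Q. LINT x:cell Q|lebesgue. F x powr p * w x"

lemma F_integrable: "set_integrable lebesgue (cell Q) F"
  by (rule L2_set_integral_le(1)[OF finite_J f_integrable])

sublocale tree: vtree_weighted children cvol "2 ^ DIM('a)" \<theta> J "\<lambda>j Q. LINT x:cell Q|lebesgue. f j x" Fm p K wm \<sigma>m
proof (intro vtree_weighted.intro martingale_cells theta finite_J f_integrable, unfold_locales)
  show "cubes.additive wm" "cubes.additive \<sigma>m"
    unfolding wm_def \<sigma>m_def by (intro additive_set_integral w_integrable sigma_integrable)+
  show "wm Q powr (1 / p) * \<sigma>m Q powr (1 - 1 / p) \<le> K * cvol Q" for Q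
    unfolding wm_def \<sigma>m_def by (rule Ap)
qed (use p K wm_pos \<sigma>m_pos vol_le in auto)

lemma acoef_eq: "acoef \<theta> J f = tree.a"
  by (simp add: fun_eq_iff acoef_def tree.a_def)

definition C1 :: real where
  "C1 = tree.C0 * (2 * (p / (p - 1))) powr p + tree.C0 * (2 * p) powr (p / (p - 1))"

lemma C1_pos: "0 < C1"
  using K p tree.constants_pos by (simp add: C1_def tree.C0_def add_pos_pos)

text \<open>This is 2 C1 / l for the scaling \<open>l\<close> chosen in
  \<open>local_bound\<close>.\<close>

definition C2 :: real where "C2 = 2 * C1 / (1 / (2 * C1)) powr (p - 1)"

text \<open>The tree estimate applied to actual integrals. The right side is a sum and not a product
  of norms, so the size of \<open>g\<close> stays free and is fixed in
  \<open>local_bound\<close>.\<close>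

lemma duality_bound:
  assumes g [measurable]: "g \<in> borel_measurable lebesgue" and g_bound: "\<And>x. 0 \<le> g x \<and> g x \<le> M"
  shows "(LINT x:cell P|lebesgue. sqrt (Hsum (acoef \<theta> J f) e P x) * g x * w x)
    \<le> C1 * (Fp P + (LINT x:cell P|lebesgue. g x powr (p / (p - 1)) * w x))"
proof -
  let ?q = "p / (p - 1)"
  let ?a = "acoef \<theta> J f"
  let ?H = "Hsum ?a"
  have q: "?q > 0" using p by simp
  define Jf where "Jf e Q s = (LINT x:cell Q|lebesgue. sqrt (s + ?H e Q x) * g x * w x)" for e Q s
  define \<gamma> where "\<gamma> Q = (LINT x:cell Q|lebesgue. g x * w x)" for Q
  define Y where "Y Q = (LINT x:cell Q|lebesgue. g x powr ?q * w x)" for Q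
  have [measurable]: "(\<lambda>x. ?H e Q x) \<in> borel_measurable lebesgue" for e Q
    by (rule measurable_completion) measurable
  have int_g: "set_integrable lebesgue (cell Q) (\<lambda>x. g x * w x)" for Q
    using g_bound by (intro set_integrable_bounded_mult[OF w_integrable, where C = M]) auto
  have int_Y: "set_integrable lebesgue (cell Q) (\<lambda>x. g x powr ?q * w x)" for Q
    using g_bound q by (intro set_integrable_bounded_mult[OF w_integrable, where C = "M powr ?q"])
      (auto intro!: powr_mono2)
  have int_J: "set_integrable lebesgue (cell Q) (\<lambda>x. sqrt (s + ?H e R x) * g x * w x)" if "0 \<le> s" for Q R s e
  proof -
    obtain N where N: "\<And>x. ?H e R x \<le> N" using Hsum_bounded by blast
    have "\<bar>sqrt (s + ?H e R x) * g x\<bar> \<le> sqrt (s + N) * M" for x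
      using N[of x] g_bound[of x] that Hsum_nonneg[of ?a e R x]
      by (auto simp: abs_mult intro!: mult_mono)
    then show ?thesis by (intro set_integrable_bounded_mult[OF w_integrable]) auto
  qed
  have mono: "(LINT x:cell Q|lebesgue. u x * w x) \<le> (LINT x:cell Q|lebesgue. v x * w x)"
    if "set_integrable lebesgue (cell Q) (\<lambda>x. u x * w x)" "set_integrable lebesgue (cell Q) (\<lambda>x. v x * w x)"
      "\<And>x. u x \<le> v x" for Q u v
    unfolding set_lebesgue_integral_def
  proof (rule integral_mono_AE)
    show "AE x in lebesgue. indicat_real (cell Q) x *\<^sub>R (u x * w x) \<le> indicat_real (cell Q) x *\<^sub>R (v x * w x)"
      using w_pos_AE by eventually_elim (auto intro!: mult_left_mono mult_right_mono that)
  qed (use that in \<open>auto simp: set_integrable_def\<close>)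
  have nn: "0 \<le> (LINT x:cell Q|lebesgue. u x * w x)" if "\<And>x. 0 \<le> u x" for Q u
    unfolding set_lebesgue_integral_def using w_pos_AE that
    by (auto intro!: integral_nonneg_AE elim!: eventually_mono)
  have "Jf e P 0 \<le> tree.C0 * (2 * ?q) powr p * Fp P + tree.C0 * (2 * p) powr ?q * Y P"
  proof (rule tree.stopping_bound)
    show "Jf 0 Q s \<le> sqrt s * \<gamma> Q" for Q s
      by (simp add: Jf_def \<gamma>_def mult.assoc)
    show "Jf (Suc e) Q s \<le> (\<Sum>R\<in>children Q. Jf e R (s + (tree.a Q)\<^sup>2))" if "0 \<le> s" for e Q s
    proof -
      have "Jf (Suc e) Q s = (\<Sum>R\<in>children Q. LINT x:cell R|lebesgue. sqrt (s + ?H (Suc e) Q x) * g x * w x)"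
        unfolding Jf_def by (rule set_integral_cell_children[symmetric, OF int_J[OF that]])
      also have "\<dots> = (\<Sum>R\<in>children Q. Jf e R (s + (?a Q)\<^sup>2))"
        unfolding Jf_def
        by (intro sum.cong refl set_lebesgue_integral_cong) (auto simp: Hsum_child add.assoc simp del: Hsum.simps)
      finally show ?thesis by (simp add: acoef_eq)
    qed
    show "Jf e Q s \<le> sqrt s * \<gamma> Q + Jf e Q 0" if "0 \<le> s" for e Q s
    proof -
      have ig: "set_integrable lebesgue (cell Q) (\<lambda>x. sqrt s * (g x * w x))"
        by (intro set_integrable_mult_right int_g)
      have "Jf e Q s \<le> (LINT x:cell Q|lebesgue. (sqrt s * g x + sqrt (0 + ?H e Q x) * g x) * w x)"
        unfolding Jf_def
      proof (rule mono[OF int_J[OF that]])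
        show "sqrt (s + ?H e Q x) * g x \<le> sqrt s * g x + sqrt (0 + ?H e Q x) * g x" for x
          using mult_right_mono[OF sqrt_add_le_add_sqrt[OF that Hsum_nonneg[of ?a e Q x]], of "g x"] g_bound[of x]
          by (simp add: distrib_right)
        show "set_integrable lebesgue (cell Q) (\<lambda>x. (sqrt s * g x + sqrt (0 + ?H e Q x) * g x) * w x)"
          using set_integral_add(1)[OF ig int_J[of 0 Q e Q]]
          by (simp add: distrib_right mult.assoc)
      qed
      also have "\<dots> = sqrt s * \<gamma> Q + Jf e Q 0"
        using set_integral_add(2)[OF ig int_J[of 0 Q e Q]]
        by (simp add: distrib_right mult.assoc Jf_def \<gamma>_def)
      finally show ?thesis .
    qed
    show "cubes.additive \<gamma>" unfolding \<gamma>_def by (rule additive_set_integral[OF int_g])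
    show "0 \<le> \<gamma> Q" for Q unfolding \<gamma>_def using g_bound by (intro nn) auto
    show "cubes.additive Fp" by (rule additive_set_integral[OF Fp_integrable])
    show "cubes.additive Y" unfolding Y_def by (rule additive_set_integral[OF int_Y])
    show "0 \<le> Fp Q" "0 \<le> Y Q" for Q unfolding Y_def by (intro nn powr_ge_zero)+
    show "Fm Q \<le> Fp Q powr (1 / p) * \<sigma>m Q powr (1 - 1 / p)" for Q
      by (rule f_le_Holder[OF Fp_integrable F_integrable]) (rule L2_set_nonneg)
    show "\<gamma> Q \<le> Y Q powr (1 - 1 / p) * wm Q powr (1 / p)" for Q
      unfolding \<gamma>_def Y_def wm_def
    proof (rule Holder_set_integral[OF exponents(2,1) _ int_Y w_integrable int_g])
      show "AE x in lebesgue. x \<in> cell Q \<longrightarrow> 0 \<le> g x powr ?q * w x"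
        using w_pos_AE by eventually_elim auto
      show "AE x in lebesgue. x \<in> cell Q \<longrightarrow> g x * w x \<le> (g x powr ?q * w x) powr (1 - 1 / p) * w x powr (1 / p)"
        using w_pos_AE
      proof eventually_elim
        case (elim x)
        have "?q * (1 - 1 / p) = 1" using p by (simp add: field_simps)
        then have "(g x powr ?q * w x) powr (1 - 1 / p) * w x powr (1 / p) = g x * (w x powr (1 - 1 / p) * w x powr (1 / p))"
          using g_bound[of x] by (simp only: powr_mult powr_powr mult.assoc) simp
        also have "w x powr (1 - 1 / p) * w x powr (1 / p) = w x"
          using elim by (simp add: powr_add[symmetric])
        finally show ?case by simp
      qed
    qed (use w_nn_AE in auto)
  qed
  moreover have "0 \<le> Fp P" "0 \<le> Y P" unfolding Y_def by (intro nn powr_ge_zero)+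
  moreover have "0 \<le> tree.C0 * (2 * ?q) powr p" "0 \<le> tree.C0 * (2 * p) powr ?q"
    using tree.C0_nonneg by auto
  moreover have "X \<le> (u + v) * (y + z)" if "X \<le> u * y + v * z" "0 \<le> y" "0 \<le> z" "0 \<le> u" "0 \<le> v"
    for X u v y z :: real
  proof -
    have "(u + v) * (y + z) = (u * y + v * z) + (u * z + v * y)" by (simp add: algebra_simps)
    then show ?thesis using that mult_nonneg_nonneg[of u z] mult_nonneg_nonneg[of v y] by linarith
  qed
  ultimately have "Jf e P 0 \<le> C1 * (Fp P + Y P)"
    unfolding C1_def by blast
  then show ?thesis by (simp add: Jf_def Y_def)
qed

text \<open>The extremal choice in the duality: g is \<open>l\<close> times H to the power (p - 1) /
  2, so both integrals containing g become multiples of the left side. The truncated sum H is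
  bounded, hence the left side is a finite number and can be absorbed.\<close>

lemma local_bound:
  "(LINT x:cell P|lebesgue. Hsum (acoef \<theta> J f) e P x powr (p / 2) * w x) \<le> C2 * Fp P"
proof -
  let ?q = "p / (p - 1)" and ?H = "\<lambda>x. Hsum (acoef \<theta> J f) e P x"
  \<comment> \<open>Solves C1 l^q = l / 2, so that exactly half of the left side is
    absorbed.\<close>
  define l where "l = (1 / (2 * C1)) powr (p - 1)"
  have l: "0 < l" using C1_pos by (simp add: l_def)
  have lq: "C1 * l powr ?q = l / 2"
  proof -
    have "l powr ?q = (1 / (2 * C1)) powr p" using p C1_pos by (simp add: l_def powr_powr)
    also have "\<dots> = (1 / (2 * C1)) powr (1 + (p - 1))" by simp
    also have "\<dots> = 1 / (2 * C1) * l" using C1_pos by (simp only: powr_add l_def) simp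
    finally show ?thesis using C1_pos by simp
  qed
  define g where "g x = l * ?H x powr ((p - 1) / 2)" for x
  have [measurable]: "?H \<in> borel_measurable lebesgue"
    by (rule measurable_completion) measurable
  define X where "X = (LINT x:cell P|lebesgue. ?H x powr (p / 2) * w x)"
  obtain N where N: "\<And>x. ?H x \<le> N" using Hsum_bounded by blast
  have H0: "0 \<le> ?H x" for x by (rule Hsum_nonneg)
  have "(LINT x:cell P|lebesgue. sqrt (?H x) * g x * w x)
    \<le> C1 * (Fp P + (LINT x:cell P|lebesgue. g x powr ?q * w x))"
  proof (rule duality_bound)
    show "0 \<le> g x \<and> g x \<le> l * N powr ((p - 1) / 2)" for x
      using l N[of x] H0[of x] p by (auto simp: g_def intro!: mult_left_mono powr_mono2)
  qed (simp add: g_def[abs_def])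
  also have "(\<lambda>x. sqrt (?H x) * g x * w x) = (\<lambda>x. l * (?H x powr (p / 2) * w x))"
  proof
    fix x
    have "sqrt (?H x) * ?H x powr ((p - 1) / 2) = ?H x powr (p / 2)"
      using H0[of x] by (simp add: powr_half_sqrt[symmetric] powr_add[symmetric] diff_divide_distrib)
    then show "sqrt (?H x) * g x * w x = l * (?H x powr (p / 2) * w x)" by (simp add: g_def mult_ac)
  qed
  also have "(\<lambda>x. g x powr ?q * w x) = (\<lambda>x. l powr ?q * (?H x powr (p / 2) * w x))"
  proof -
    have "(p - 1) / 2 * ?q = p / 2" using p by (simp add: field_simps)
    then show ?thesis using l by (simp only: g_def powr_mult powr_powr mult.assoc)
  qed
  finally have "l * X \<le> C1 * Fp P + C1 * l powr ?q * X"
    by (simp add: X_def distrib_left)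
  then have "X \<le> (2 * C1 / l) * Fp P"
    unfolding lq using l by (simp add: field_simps)
  then show ?thesis by (simp add: X_def C2_def l_def)
qed

end

section \<open>Domination of the intrinsic square function\<close>

lemma set_integrable_mult_bounded:
  fixes \<psi> f :: "'a \<Rightarrow> complex"
  assumes "set_integrable M S f" "\<psi> \<in> borel_measurable M" "\<And>x. x \<in> S \<Longrightarrow> norm (\<psi> x) \<le> C"
  shows "set_integrable M S (\<lambda>x. \<psi> x * f x)"
proof -
  have "integrable M (\<lambda>x. C *\<^sub>R (indicator S x *\<^sub>R f x))"
    using assms(1) unfolding set_integrable_def by (rule integrable_scaleR_right)
  moreover have "(\<lambda>x. \<psi> x * (indicator S x *\<^sub>R f x)) \<in> borel_measurable M"
    using assms(1,2) by (intro borel_measurable_times) (auto simp: set_integrable_def)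
  then have "(\<lambda>x. indicator S x *\<^sub>R (\<psi> x * f x)) \<in> borel_measurable M"
    by simp
  moreover have "AE x in M. norm (indicator S x *\<^sub>R (\<psi> x * f x)) \<le> norm (C *\<^sub>R (indicator S x *\<^sub>R f x))"
    using assms(3) by (auto simp: indicator_def norm_mult intro!: mult_right_mono order_trans[OF assms(3)])
  ultimately show ?thesis
    unfolding set_integrable_def by (rule Bochner_Integration.integrable_bound)
qed

lemma Holder_imp_continuous_on:
  fixes \<psi> :: "'a::real_normed_vector \<Rightarrow> 'b::real_normed_vector"
  assumes "0 < \<alpha>" "\<And>x y. norm (\<psi> x - \<psi> y) \<le> M * norm (x - y) powr \<alpha>"
  shows "continuous_on UNIV \<psi>"
  unfolding continuous_on_def
proof
  fix x :: 'a
  have "((\<lambda>y. M * norm (y - x) powr \<alpha>) \<longlongrightarrow> M * norm (x - x) powr \<alpha>) (at x)"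
    using assms(1) by (intro tendsto_intros) auto
  then have "((\<lambda>y. M * norm (y - x) powr \<alpha>) \<longlongrightarrow> 0) (at x)" by simp
  then have "((\<lambda>y. \<psi> y - \<psi> x) \<longlongrightarrow> 0) (at x)"
    by (rule Lim_null_comparison[rotated]) (use assms(2) in auto)
  then show "(\<psi> \<longlongrightarrow> \<psi> x) (at x within UNIV)" by (simp add: LIM_zero_iff)
qed

lemma LINT_norm_bound:
  fixes f :: "'a \<Rightarrow> 'b::{banach, second_countable_topology}"
  assumes "integrable M f" "integrable M g" "\<And>x. norm (f x) \<le> g x"
  shows "norm (LINT x|M. f x) \<le> (LINT x|M. g x)"
  using integral_norm_bound[of M f] integral_mono[OF integrable_norm[OF assms(1)] assms(2,3)] by linarith

lemma theta_bounds:
  assumes "0 < \<alpha>"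
  shows "0 < (1 / 2) powr \<alpha>" "(1 / 2 :: real) powr \<alpha> < 1"
  using assms powr_less_mono2_neg[of "- \<alpha>" 1 2] by (auto simp: powr_divide powr_minus_divide)

locale holder_pairing =
  fixes \<psi> :: "'a::euclidean_space \<Rightarrow> complex" and \<alpha> M :: real
    and f :: "'j \<Rightarrow> 'a \<Rightarrow> complex" and j :: 'j
  assumes alpha: "0 < \<alpha>" and M: "0 \<le> M"
    and holder: "norm (\<psi> x - \<psi> y) \<le> M * norm (x - y) powr \<alpha>"
    and f_integrable: "set_integrable lebesgue (cell Q) (f j)"
begin

definition avg :: "'a cube \<Rightarrow> complex" where
  "avg Q = (1 / cvol Q) *\<^sub>R (LINT x:cell Q|lebesgue. \<psi> x)"

text \<open>A bound for the oscillation of \<psi> over \<open>Q\<close>. Halving the side multiplies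
  it by 2 to the power -\<alpha>, which is the origin of \<theta>.\<close>

definition L :: "'a cube \<Rightarrow> real" where
  "L Q = M * (DIM('a) * side (snd Q)) powr \<alpha>"

abbreviation "\<mu> \<equiv> \<lambda>j Q. LINT x:cell Q|lebesgue. f j x"

abbreviation "\<theta> \<equiv> (1 / 2) powr \<alpha>"

lemmas theta = theta_bounds[OF alpha]

lemma psi_measurable [measurable]: "\<psi> \<in> borel_measurable lebesgue"
  using Holder_imp_continuous_on[OF alpha holder]
  by (intro measurable_completion) (simp add: borel_measurable_continuous_onI)

lemma L_child: "R \<in> children Q \<Longrightarrow> L R = \<theta> * L Q"
  using snd_children[of R Q] side_half[of "snd Q"] by (simp add: L_def powr_mult powr_divide)

lemma psi_osc: "x \<in> cell Q \<Longrightarrow> y \<in> cell Q \<Longrightarrow> norm (\<psi> x - \<psi> y) \<le> L Q"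
  using M alpha norm_diff_cell[of x Q y] holder[of x y]
  unfolding L_def by (meson mult_left_mono norm_ge_zero order_trans powr_mono2 less_imp_le)

lemma one_integrable: "set_integrable lebesgue (cell Q) (\<lambda>x. c :: complex)"
  by (auto simp: set_integrable_def emeasure_cell less_top[symmetric])

lemma psi_bounded: "x \<in> cell Q \<Longrightarrow> norm (\<psi> x) \<le> norm (\<psi> (fst Q)) + L Q"
  using psi_osc[OF _ corner_in_cell, of x Q] norm_triangle_sub[of "\<psi> x" "\<psi> (fst Q)"] by simp

lemma psi_integrable: "set_integrable lebesgue (cell Q) \<psi>"
  using set_integrable_mult_bounded[OF one_integrable[of Q 1] psi_measurable psi_bounded] by simp

lemma psi_f_integrable: "set_integrable lebesgue (cell Q) (\<lambda>x. \<psi> x * f j x)"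
  by (rule set_integrable_mult_bounded[OF f_integrable psi_measurable psi_bounded])

lemma LINT_const: "(LINT x:cell Q|lebesgue. c) = cvol Q *\<^sub>R (c :: complex)"
  by (simp add: set_lebesgue_integral_def measure_cell emeasure_cell)

lemma avg_diff:
  assumes "\<And>x. x \<in> cell Q \<Longrightarrow> norm (\<psi> x - c) \<le> l"
  shows "norm (avg Q - c) \<le> l"
proof -
  have "avg Q - c = (1 / cvol Q) *\<^sub>R ((LINT x:cell Q|lebesgue. \<psi> x) - (LINT x:cell Q|lebesgue. c))"
    using cvol_pos[of Q] by (simp add: avg_def LINT_const scaleR_diff_right)
  also have "(LINT x:cell Q|lebesgue. \<psi> x) - (LINT x:cell Q|lebesgue. c) = (LINT x:cell Q|lebesgue. \<psi> x - c)"
    by (rule set_integral_diff(2)[symmetric, OF psi_integrable one_integrable])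
  finally have "norm (avg Q - c) = (1 / cvol Q) * norm (LINT x:cell Q|lebesgue. \<psi> x - c)"
    using cvol_pos[of Q] by simp
  also have "norm (LINT x:cell Q|lebesgue. \<psi> x - c) \<le> l * cvol Q"
  proof -
    have "norm (LINT x:cell Q|lebesgue. \<psi> x - c) \<le> (LINT x|lebesgue. l * indicator (cell Q) x)"
      unfolding set_lebesgue_integral_def
    proof (rule LINT_norm_bound)
      show "integrable lebesgue (\<lambda>x. indicat_real (cell Q) x *\<^sub>R (\<psi> x - c))"
        using set_integral_diff(1)[OF psi_integrable one_integrable] by (simp add: set_integrable_def)
      show "integrable lebesgue (\<lambda>x. l * indicat_real (cell Q) x)"
        by (intro integrable_mult_right integrable_real_indicator) (auto simp: emeasure_cell)
      show "norm (indicat_real (cell Q) x *\<^sub>R (\<psi> x - c)) \<le> l * indicat_real (cell Q) x" for x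
        using assms[of x] by (auto simp: indicator_def)
    qed
    then show ?thesis by (simp add: measure_cell)
  qed
  finally show ?thesis using cvol_pos[of Q] by (simp add: divide_right_mono field_simps)
qed

lemma psi_avg: "x \<in> cell Q \<Longrightarrow> norm (\<psi> x - avg Q) \<le> L Q"
  using avg_diff[of Q "\<psi> x" "L Q"] psi_osc[of _ Q x] by (simp add: norm_minus_commute)

lemma avg_child: "R \<in> children Q \<Longrightarrow> norm (avg R - avg Q) \<le> L Q"
  by (rule avg_diff) (use psi_avg cell_child_subset in blast)

text \<open>Replacing the average of \<psi> on \<open>Q\<close> by its averages on the children
  costs at most \<open>L Q\<close> times \<open>osc\<close>, since only the martingale difference of
  \<open>f\<close> is paired with the change of averages. After \<open>d\<close> generations the
  remainder is an oscillation of \<psi> of size \<open>\<theta> ^ d * L Q\<close> against the norm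
  of \<open>f\<close>.\<close>

lemma pairing_depth:
  "norm ((LINT x:cell Q|lebesgue. \<psi> x * f j x) - avg Q * \<mu> j Q)
    \<le> L Q * (cubes.bdepth \<theta> {j} \<mu> d Q + \<theta> ^ d * (LINT x:cell Q|lebesgue. norm (f j x)))"
proof (induction d arbitrary: Q)
  case 0
  have int: "set_integrable lebesgue (cell Q) (\<lambda>x. avg Q * f j x)"
    using f_integrable by simp
  have "(LINT x:cell Q|lebesgue. \<psi> x * f j x) - avg Q * \<mu> j Q = (LINT x:cell Q|lebesgue. \<psi> x * f j x - avg Q * f j x)"
    using set_integral_diff(2)[OF psi_f_integrable int] by simp
  also have "norm \<dots> \<le> (LINT x:cell Q|lebesgue. L Q * norm (f j x))"
    unfolding set_lebesgue_integral_def
  proof (rule LINT_norm_bound)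
    show "integrable lebesgue (\<lambda>x. indicat_real (cell Q) x *\<^sub>R (\<psi> x * f j x - avg Q * f j x))"
      using set_integral_diff(1)[OF psi_f_integrable int] by (simp add: set_integrable_def)
    show "integrable lebesgue (\<lambda>x. indicat_real (cell Q) x *\<^sub>R (L Q * norm (f j x)))"
      using set_integrable_mult_right[OF set_integrable_norm[OF f_integrable[of Q]], of "L Q"] by (simp add: set_integrable_def)
    show "norm (indicat_real (cell Q) x *\<^sub>R (\<psi> x * f j x - avg Q * f j x)) \<le> indicat_real (cell Q) x *\<^sub>R (L Q * norm (f j x))" for x
      using psi_avg[of x Q] by (auto simp: indicator_def left_diff_distrib[symmetric] norm_mult intro: mult_right_mono)
  qed
  finally show ?case by simp
next
  case (Suc d)
  let ?ch = "children Q"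
  let ?r = "\<lambda>R. cvol R / cvol Q"
  define I where "I R = (LINT x:cell R|lebesgue. \<psi> x * f j x)" for R
  define N where "N R = (LINT x:cell R|lebesgue. norm (f j x))" for R
  have I: "(\<Sum>R\<in>?ch. I R) = I Q" unfolding I_def by (rule set_integral_cell_children[OF psi_f_integrable])
  have N: "(\<Sum>R\<in>?ch. N R) = N Q" unfolding N_def by (intro set_integral_cell_children set_integrable_norm f_integrable)
  have \<mu>: "(\<Sum>R\<in>?ch. \<mu> j R) = \<mu> j Q" by (rule set_integral_cell_children[OF f_integrable])
  have "(\<Sum>R\<in>?ch. cvol R *\<^sub>R avg R) = cvol Q *\<^sub>R avg Q"
  proof -
    have c0: "cvol R \<noteq> 0" for R :: "'a cube" using cvol_pos[of R] by simp
    show ?thesis using set_integral_cell_children[OF psi_integrable, of Q] by (simp add: avg_def c0)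
  qed
  \<comment> \<open>The weighted mean of the changes of averages is zero, which allows the constant
    part of \<open>f\<close> on \<open>Q\<close> to be subtracted.\<close>
  then have zero: "(\<Sum>R\<in>?ch. cvol R *\<^sub>R (avg R - avg Q)) = 0"
    using cvol_sum[of Q] by (simp add: scaleR_diff_right sum_subtractf scaleR_sum_left[symmetric])
  have "(\<Sum>R\<in>?ch. (avg R - avg Q) * (?r R *\<^sub>R \<mu> j Q)) = (\<Sum>R\<in>?ch. cvol R *\<^sub>R (avg R - avg Q)) * ((1 / cvol Q) *\<^sub>R \<mu> j Q)"
    unfolding sum_distrib_right by (rule sum.cong) (simp_all add: divide_inverse mult.commute)
  then have zero': "(\<Sum>R\<in>?ch. (avg R - avg Q) * (?r R *\<^sub>R \<mu> j Q)) = 0" by (simp only: zero mult_zero_left)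
  have "I Q - avg Q * \<mu> j Q = (\<Sum>R\<in>?ch. I R - avg R * \<mu> j R) + (\<Sum>R\<in>?ch. (avg R - avg Q) * \<mu> j R)"
    by (simp add: I[symmetric] \<mu>[symmetric] left_diff_distrib sum_subtractf sum_distrib_left)
  also have "(\<Sum>R\<in>?ch. (avg R - avg Q) * \<mu> j R) = (\<Sum>R\<in>?ch. (avg R - avg Q) * (\<mu> j R - ?r R *\<^sub>R \<mu> j Q))"
    by (simp only: right_diff_distrib sum_subtractf zero' diff_zero)
  finally have "norm (I Q - avg Q * \<mu> j Q)
    \<le> (\<Sum>R\<in>?ch. norm (I R - avg R * \<mu> j R)) + (\<Sum>R\<in>?ch. norm ((avg R - avg Q) * (\<mu> j R - ?r R *\<^sub>R \<mu> j Q)))"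
    by (simp only:) (intro order_trans[OF norm_triangle_ineq] add_mono norm_sum)
  also have "\<dots> \<le> (\<Sum>R\<in>?ch. (\<theta> * L Q) * (cubes.bdepth \<theta> {j} \<mu> d R + \<theta> ^ d * N R))
      + (\<Sum>R\<in>?ch. L Q * norm (\<mu> j R - ?r R *\<^sub>R \<mu> j Q))"
  proof (intro add_mono sum_mono)
    fix R assume R: "R \<in> ?ch"
    show "norm (I R - avg R * \<mu> j R) \<le> (\<theta> * L Q) * (cubes.bdepth \<theta> {j} \<mu> d R + \<theta> ^ d * N R)"
      using Suc.IH[of R] by (simp add: I_def N_def L_child[OF R])
    show "norm ((avg R - avg Q) * (\<mu> j R - ?r R *\<^sub>R \<mu> j Q)) \<le> L Q * norm (\<mu> j R - ?r R *\<^sub>R \<mu> j Q)"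
      unfolding norm_mult by (intro mult_right_mono avg_child R) auto
  qed
  also have "(\<Sum>R\<in>?ch. L Q * norm (\<mu> j R - ?r R *\<^sub>R \<mu> j Q)) = L Q * cubes.osc {j} \<mu> Q"
    by (simp add: cubes.osc_def L2_set_def sum_distrib_left)
  also have "(\<Sum>R\<in>?ch. (\<theta> * L Q) * (cubes.bdepth \<theta> {j} \<mu> d R + \<theta> ^ d * N R))
     = \<theta> * L Q * ((\<Sum>R\<in>?ch. cubes.bdepth \<theta> {j} \<mu> d R) + \<theta> ^ d * (\<Sum>R\<in>?ch. N R))"
    by (simp add: sum_distrib_left sum.distrib distrib_left)
  also have "\<dots> + L Q * cubes.osc {j} \<mu> Q
     = L Q * (cubes.bdepth \<theta> {j} \<mu> (Suc d) Q + \<theta> ^ Suc d * N Q)"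
    by (simp add: N algebra_simps)
  finally show ?case by (simp add: I_def N_def)
qed

text \<open>Support in \<open>Q\<close> and mean zero make the average of \<psi> on \<open>Q\<close>
  vanish, so the cubes above \<open>Q\<close> contribute nothing; the remainder of
  \<open>pairing_depth\<close> tends to zero with the depth.\<close>

lemma pairing_bound:
  assumes supp: "\<And>x. \<psi> x \<noteq> 0 \<Longrightarrow> x \<in> cell Q" and mean: "(LINT x|lebesgue. \<psi> x) = 0"
  shows "norm (LINT x|lebesgue. \<psi> x * f j x) \<le> L Q * (cvol Q * acoef \<theta> {j} f Q)"
proof -
  have ind: "indicator (cell Q) x *\<^sub>R (\<psi> x * g) = \<psi> x * g" for x g
    using supp[of x] by (auto simp: indicator_def)
  have "(LINT x:cell Q|lebesgue. \<psi> x * f j x) = (LINT x|lebesgue. \<psi> x * f j x)"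
    by (simp only: set_lebesgue_integral_def ind)
  moreover have "(LINT x:cell Q|lebesgue. \<psi> x) = 0"
    using ind[of _ 1] by (simp add: set_lebesgue_integral_def mean)
  then have "avg Q = 0" by (simp add: avg_def)
  ultimately have le: "norm (LINT x|lebesgue. \<psi> x * f j x)
     \<le> L Q * (cubes.bdepth \<theta> {j} \<mu> d Q + \<theta> ^ d * (LINT x:cell Q|lebesgue. norm (f j x)))" for d
    using pairing_depth[of Q d] by simp
  interpret vtree_martingale children cvol "2 ^ DIM('a)" \<theta> "{j}" \<mu> "\<lambda>Q. LINT x:cell Q|lebesgue. L2_set (\<lambda>j. norm (f j x)) {j}"
    by (rule martingale_cells) (use theta f_integrable in auto)
  have "(\<lambda>d. L Q * (cubes.bdepth \<theta> {j} \<mu> d Q + \<theta> ^ d * (LINT x:cell Q|lebesgue. norm (f j x))))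
     \<longlonglongrightarrow> L Q * (b Q + 0 * (LINT x:cell Q|lebesgue. norm (f j x)))"
    using theta by (intro tendsto_mult tendsto_add tendsto_const bdepth_tendsto LIMSEQ_power_zero) auto
  then have "norm (LINT x|lebesgue. \<psi> x * f j x) \<le> L Q * (b Q + 0 * (LINT x:cell Q|lebesgue. norm (f j x)))"
    by (rule LIMSEQ_le_const) (use le in blast)
  then show ?thesis using cvol_pos[of Q] by (simp add: acoef_def)
qed

end

section \<open>Bounds by dyadic coefficients for dilated test functions\<close>

lemma integral_dilate:
  fixes \<phi> :: "'a::euclidean_space \<Rightarrow> complex"
  assumes "continuous_on UNIV \<phi>" "0 < t"
  shows "(LINT z|lebesgue. dilate \<phi> t (y - z)) = (LINT z|lebesgue. \<phi> z)"
proof -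
  have \<phi> [measurable]: "\<phi> \<in> borel_measurable borel"
    using assms(1) by (rule borel_measurable_continuous_onI)
  let ?T = "\<lambda>z. (1 / t) *\<^sub>R y + (- 1 / t) *\<^sub>R z"
  have "(LINT z|lebesgue. \<phi> z) = (LINT z|lborel. \<phi> z)"
    by (simp add: integral_completion)
  also have "\<dots> = (LINT z|density (distr lborel borel ?T) (\<lambda>_. \<bar>- 1 / t\<bar> ^ DIM('a)). \<phi> z)"
    using lborel_affine[of "- 1 / t" "(1 / t) *\<^sub>R y"] assms(2) by simp
  also have "\<dots> = (LINT z|lborel. (1 / t) ^ DIM('a) *\<^sub>R \<phi> (?T z))"
    using assms(2) by (simp add: integral_density integral_distr)
  also have "(\<lambda>z. (1 / t) ^ DIM('a) *\<^sub>R \<phi> (?T z)) = (\<lambda>z. dilate \<phi> t (y - z))"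
    by (simp add: dilate_def fun_eq_iff scaleR_diff_right power_divide)
  also have "(LINT z|lborel. dilate \<phi> t (y - z)) = (LINT z|lebesgue. dilate \<phi> t (y - z))"
    by (subst integral_completion) (simp_all add: dilate_def)
  finally show ?thesis by simp
qed

text \<open>12 bounds the side of the cube divided by t. Its n-th power compares the volumes, and
  the other factor is the Hoelder bound across a cube of diameter at most n times its side.\<close>

definition CA :: "real \<Rightarrow> nat \<Rightarrow> real" where
  "CA \<alpha> n = 12 ^ n * (12 * n) powr \<alpha>"

text \<open>The grid depends only on y and t, and all points within t of y lie in the same cube of
  level k. Naming that cube through \<open>x\<close> expresses the bound by cubes containing the
  vertex of the cone.\<close>

lemma A_fun_le:
  fixes f :: "'j \<Rightarrow> 'a::euclidean_space \<Rightarrow> complex"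
  assumes alpha: "0 < \<alpha>" and t: "0 < t" "6 * t < side k" "side k \<le> 12 * t"
    and f: "\<And>Q. set_integrable lebesgue (cell Q) (f j)"
  obtains S where "S \<subseteq> Basis"
    "\<And>x. x \<in> cball y t \<Longrightarrow> A_fun \<alpha> (f j) y t \<le> ennreal (CA \<alpha> DIM('a) * acoef ((1 / 2) powr \<alpha>) {j} f (cube_at S k x))"
proof -
  obtain S where S: "S \<subseteq> Basis" "\<And>x. x \<in> cball y t \<Longrightarrow> cball y t \<subseteq> cell (cube_at S k x)"
    using one_third_trick[OF t(1,2)] by blast
  show thesis
  proof (rule that[OF S(1)])
    fix x assume x: "x \<in> cball y t"
    let ?Q = "cube_at S k x"
    show "A_fun \<alpha> (f j) y t \<le> ennreal (CA \<alpha> DIM('a) * acoef ((1 / 2) powr \<alpha>) {j} f ?Q)"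
      unfolding A_fun_def
    proof (rule SUP_least)
      fix \<phi> :: "'a \<Rightarrow> complex" assume "\<phi> \<in> C_class \<alpha>"
      then have \<phi>: "\<And>x. \<phi> x \<noteq> 0 \<Longrightarrow> norm x \<le> 1" "(LINT x|lebesgue. \<phi> x) = 0"
        "\<And>x x'. norm (\<phi> x - \<phi> x') \<le> norm (x - x') powr \<alpha>" by (auto simp: C_class_def)
      define M where "M = (1 / t ^ DIM('a)) * (1 / t) powr \<alpha>"
      let ?\<psi> = "\<lambda>z. dilate \<phi> t (y - z)"
      interpret holder_pairing ?\<psi> \<alpha> M f j
      proof
        show "norm (?\<psi> u - ?\<psi> v) \<le> M * norm (u - v) powr \<alpha>" for u v
        proof -
          have "norm (?\<psi> u - ?\<psi> v) = (1 / t ^ DIM('a)) * norm (\<phi> ((1 / t) *\<^sub>R (y - u)) - \<phi> ((1 / t) *\<^sub>R (y - v)))"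
            using t by (simp add: dilate_def scaleR_diff_right[symmetric])
          also have "\<dots> \<le> (1 / t ^ DIM('a)) * norm ((1 / t) *\<^sub>R (y - u) - (1 / t) *\<^sub>R (y - v)) powr \<alpha>"
            using t by (intro mult_left_mono \<phi>) auto
          also have "norm ((1 / t) *\<^sub>R (y - u) - (1 / t) *\<^sub>R (y - v)) = (1 / t) * norm (u - v)"
            using t by (simp add: scaleR_diff_right[symmetric] norm_minus_commute)
          finally show ?thesis using t by (simp only: powr_mult M_def mult.assoc)
        qed
      qed (use alpha t f in \<open>auto simp: M_def\<close>)
      have "norm (LINT z|lebesgue. ?\<psi> z * f j z) \<le> L ?Q * (cvol ?Q * acoef \<theta> {j} f ?Q)"
      proof (rule pairing_bound)
        fix z assume "?\<psi> z \<noteq> 0"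
        then have "norm ((1 / t) *\<^sub>R (y - z)) \<le> 1" by (intro \<phi>) (auto simp: dilate_def)
        then have "z \<in> cball y t" using t by (simp add: dist_norm)
        then show "z \<in> cell ?Q" using S(2)[OF x] by blast
      next
        have "continuous_on UNIV \<phi>"
          using Holder_imp_continuous_on[of \<alpha> \<phi> 1] alpha \<phi> by simp
        then show "(LINT z|lebesgue. ?\<psi> z) = 0" using integral_dilate t \<phi>(2) by metis
      qed
      also have "\<dots> = (L ?Q * cvol ?Q) * acoef \<theta> {j} f ?Q" by simp
      also have "\<dots> \<le> CA \<alpha> DIM('a) * acoef \<theta> {j} f ?Q"
      proof (rule mult_right_mono)
        have "L ?Q * cvol ?Q = (side k / t) ^ DIM('a) * (DIM('a) * (side k / t)) powr \<alpha>"
          using t unfolding L_def unfolding M_def cvol_def by (simp add: powr_mult powr_divide power_divide)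
        also have "\<dots> \<le> 12 ^ DIM('a) * (DIM('a) * 12) powr \<alpha>"
          using t alpha by (intro mult_mono power_mono powr_mono2 mult_left_mono) (auto simp: field_simps)
        finally show "L ?Q * cvol ?Q \<le> CA \<alpha> DIM('a)" by (simp add: CA_def mult.commute)
        show "0 \<le> acoef \<theta> {j} f ?Q" by (intro acoef_nonneg theta) (use f in auto)
      qed
      finally show "ennreal (norm (LINT z|lebesgue. ?\<psi> z * f j z)) \<le> ennreal (CA \<alpha> DIM('a) * acoef \<theta> {j} f ?Q)"
        by (rule ennreal_leI)
    qed
  qed
qed

lemma ex_side:
  assumes "0 < t"
  obtains k where "6 * t < side k" "side k \<le> 12 * t"
proof
  define m where "m = \<lfloor>log 2 (6 * t)\<rfloor>"
  have side: "side (- n) = 2 powr of_int n" for n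
    by (simp add: side_def powr_real_of_int')
  have "2 powr of_int m \<le> 2 powr (log 2 (6 * t))" "2 powr (log 2 (6 * t)) < 2 powr (of_int m + 1)"
    unfolding m_def by (intro powr_mono powr_less_mono; linarith)+
  then have "2 powr of_int m \<le> 6 * t" "6 * t < 2 * 2 powr of_int m"
    using assms by (auto simp: powr_add)
  then show "6 * t < side (- (m + 1))" "side (- (m + 1)) \<le> 12 * t"
    unfolding side by (auto simp: powr_add)
qed

text \<open>The power of 2 is (s/6)^n (s/12) / (s/12)^(n+1), the size of a slab of the cone (up to
  the ball constant) against the smallest value of t^(n+1) on it.\<close>

definition CS :: "real \<Rightarrow> nat \<Rightarrow> real" where
  "CS \<alpha> n = (CA \<alpha> n)\<^sup>2 * unit_ball_vol n * 2 ^ n"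

lemma CA_nonneg: "0 \<le> CA \<alpha> n"
  by (simp add: CA_def)

lemma CS_nonneg: "0 \<le> CS \<alpha> n"
  by (simp add: CS_def)

text \<open>The cone is cut into slabs of heights t in [s/12, s/6), one for each dyadic side s, and
  each slab lies over the ball of radius s/6 about \<open>x\<close>. The grid that serves (y, t) is
  unknown, so all grids are summed; \<open>int_decode\<close> turns the sum over all levels into a
  series over naturals.\<close>

lemma square_fun_le:
  fixes f :: "'j \<Rightarrow> 'a::euclidean_space \<Rightarrow> complex" and x :: 'a
  assumes alpha: "0 < \<alpha>" and f: "\<And>Q. set_integrable lebesgue (cell Q) (f j)"
  shows "(\<integral>\<^sup>+ q \<in> cone x. ((A_fun \<alpha> (f j) (fst q) (snd q))\<^sup>2 / ennreal (snd q ^ (DIM('a) + 1))) \<partial>lebesgue)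
    \<le> ennreal (CS \<alpha> DIM('a)) *
      (\<Sum>i. ennreal (\<Sum>S\<in>Pow Basis. (acoef ((1 / 2) powr \<alpha>) {j} f (cube_at S (int_decode i) x))\<^sup>2))"
proof -
  let ?n = "DIM('a)" and ?a = "\<lambda>S k. acoef ((1 / 2) powr \<alpha>) {j} f (cube_at S k x)"
  define G where "G i = (\<Sum>S\<in>Pow Basis. (?a S (int_decode i))\<^sup>2)" for i
  define s where "s i = side (int_decode i)" for i
  define bx where "bx i = ball x (s i / 6) \<times> {s i / 12..<s i / 6}" for i
  define c where "c i = (CA \<alpha> ?n)\<^sup>2 * G i / (s i / 12) ^ (?n + 1)" for i
  have G: "0 \<le> G i" for i by (simp add: G_def sum_nonneg)
  have s: "0 < s i" for i by (simp add: s_def)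
  have c: "0 \<le> c i" for i using G[of i] s[of i] by (simp add: c_def)
  have bx [measurable]: "bx i \<in> sets borel" for i
    unfolding bx_def by (intro borel_Times) auto
  have bxl [measurable]: "bx i \<in> sets lebesgue" for i
    using bx by (simp add: sets_completionI_sets)
  have ptw: "(A_fun \<alpha> (f j) (fst q) (snd q))\<^sup>2 / ennreal (snd q ^ (?n + 1)) * indicator (cone x) q
     \<le> (\<Sum>i. ennreal (c i) * indicator (bx i) q)" for q
  proof (cases "q \<in> cone x")
    case True
    obtain y t where q: "q = (y, t)" by (cases q)
    have t: "0 < t" "norm (x - y) < t" using True by (auto simp: cone_def q)
    obtain k where k: "6 * t < side k" "side k \<le> 12 * t" using ex_side[OF t(1)] .
    define i where "i = int_encode k"
    have si: "s i = side k" by (simp add: s_def i_def)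
    have mem: "q \<in> bx i" using t k by (simp add: bx_def q si dist_norm)
    obtain S where S: "S \<subseteq> Basis"
      "\<And>x. x \<in> cball y t \<Longrightarrow> A_fun \<alpha> (f j) y t \<le> ennreal (CA \<alpha> ?n * acoef ((1 / 2) powr \<alpha>) {j} f (cube_at S k x))"
      using A_fun_le[where f = f and j = j and y = y, OF alpha t(1) k f] by blast
    have "x \<in> cball y t" using t by (simp add: dist_norm norm_minus_commute)
    from S(2)[OF this] have "(A_fun \<alpha> (f j) y t)\<^sup>2 \<le> (ennreal (CA \<alpha> ?n * ?a S k))\<^sup>2"
      by (intro power_mono) auto
    also have "\<dots> = ennreal ((CA \<alpha> ?n * ?a S k)\<^sup>2)"
    proof -
      have "0 \<le> ?a S k"
        by (intro acoef_nonneg theta_bounds alpha) (auto simp: f)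
      then show ?thesis by (intro ennreal_power mult_nonneg_nonneg CA_nonneg)
    qed
    also have "\<dots> \<le> ennreal ((CA \<alpha> ?n)\<^sup>2 * G i)"
      unfolding power_mult_distrib G_def i_def int_encode_inverse using S(1)
      by (intro ennreal_leI mult_left_mono member_le_sum) auto
    finally have "(A_fun \<alpha> (f j) y t)\<^sup>2 / ennreal (t ^ (?n + 1)) \<le> ennreal ((CA \<alpha> ?n)\<^sup>2 * G i) / ennreal (t ^ (?n + 1))"
      by (rule divide_right_mono_ennreal)
    also have "\<dots> = ennreal ((CA \<alpha> ?n)\<^sup>2 * G i / t ^ (?n + 1))"
      using t G[of i] by (intro divide_ennreal) auto
    also have "\<dots> \<le> ennreal (c i)"
      unfolding c_def using k t G[of i] s[of i] by (intro ennreal_leI divide_left_mono power_mono mult_pos_pos) (auto simp: si)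
    also have "\<dots> = ennreal (c i) * indicator (bx i) q" using mem by simp
    also have "\<dots> \<le> (\<Sum>i. ennreal (c i) * indicator (bx i) q)"
    proof -
      have "(\<Sum>i\<in>{i}. ennreal (c i) * indicator (bx i) q) \<le> (\<Sum>i. ennreal (c i) * indicator (bx i) q)"
        by (intro sum_le_suminf) auto
      then show ?thesis by (simp only: sum.insert finite.emptyI sum.empty empty_iff not_False_eq_True add_0_right)
    qed
    finally show ?thesis using True by (simp add: q)
  qed simp
  have em: "emeasure lebesgue (bx i) = ennreal (unit_ball_vol ?n * (s i / 6) ^ ?n * (s i / 12))" for i
  proof -
    have "emeasure lebesgue (bx i) = emeasure (lborel \<Otimes>\<^sub>M lborel) (bx i)"
      using bx by (simp add: lborel_prod)
    also have "\<dots> = emeasure lborel (ball x (s i / 6)) * emeasure lborel {s i / 12..<s i / 6}"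
      unfolding bx_def by (intro lborel.emeasure_pair_measure_Times) auto
    also have "emeasure lborel (ball x (s i / 6)) = ennreal (unit_ball_vol ?n * (s i / 6) ^ ?n)"
      using s[of i] by (intro emeasure_ball) auto
    also have "emeasure lborel {s i / 12..<s i / 6} = ennreal (s i / 12)"
      using s[of i] by simp
    finally show ?thesis using s[of i] by (simp add: ennreal_mult''[symmetric])
  qed
  have "(\<integral>\<^sup>+ q \<in> cone x. ((A_fun \<alpha> (f j) (fst q) (snd q))\<^sup>2 / ennreal (snd q ^ (?n + 1))) \<partial>lebesgue)
     \<le> (\<integral>\<^sup>+ q. (\<Sum>i. ennreal (c i) * indicator (bx i) q) \<partial>lebesgue)"
    by (intro nn_integral_mono ptw)
  also have "\<dots> = (\<Sum>i. \<integral>\<^sup>+ q. ennreal (c i) * indicator (bx i) q \<partial>lebesgue)"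
    by (intro nn_integral_suminf) measurable
  also have "\<dots> = (\<Sum>i. ennreal (c i) * emeasure lebesgue (bx i))"
    by (simp add: nn_integral_cmult_indicator)
  also have "\<dots> = (\<Sum>i. ennreal (CS \<alpha> ?n) * ennreal (G i))"
  proof (rule suminf_cong)
    fix i
    have "c i * (unit_ball_vol ?n * (s i / 6) ^ ?n * (s i / 12)) = CS \<alpha> ?n * G i"
    proof -
      define h where "h = s i / 12"
      have h: "s i / 6 = 2 * h" "h \<noteq> 0" using s[of i] by (auto simp: h_def)
      show ?thesis
        unfolding c_def CS_def h(1) h_def[symmetric] using h(2) by (simp add: power_mult_distrib)
    qed
    then show "ennreal (c i) * emeasure lebesgue (bx i) = ennreal (CS \<alpha> ?n) * ennreal (G i)"
      unfolding em using c[of i] CS_nonneg[of \<alpha> ?n] by (simp add: ennreal_mult'[symmetric])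
  qed
  also have "\<dots> = ennreal (CS \<alpha> ?n) * (\<Sum>i. ennreal (G i))"
    by simp
  finally show ?thesis by (simp add: G_def)
qed

section \<open>Muckenhoupt weights\<close>

lemma set_integral_mono_set:
  fixes u :: "'a \<Rightarrow> real"
  assumes "set_integrable M B u" "A \<in> sets M" "A \<subseteq> B" "AE x in M. 0 \<le> u x"
  shows "(LINT x:A|M. u x) \<le> (LINT x:B|M. u x)"
  unfolding set_lebesgue_integral_def
proof (rule integral_mono_AE)
  show "AE x in M. indicat_real A x *\<^sub>R u x \<le> indicat_real B x *\<^sub>R u x"
    using assms(4) by eventually_elim (use assms(3) in \<open>auto simp: indicator_def\<close>)
qed (use assms set_integrable_subset[OF assms(1-3)] in \<open>auto simp: set_integrable_def\<close>)

lemma measure_ball_lebesgue: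
  "0 \<le> r \<Longrightarrow> measure lebesgue (ball (c :: 'a::euclidean_space) r) = unit_ball_vol DIM('a) * r ^ DIM('a)"
  by (simp add: content_ball)

text \<open>The volume of a ball of radius 2 n times the side of a cube, divided by the volume of
  the cube.\<close>

definition vB :: "nat \<Rightarrow> real" where "vB n = unit_ball_vol n * (2 * n) ^ n"

lemma vB_pos: "0 < vB DIM('a::euclidean_space)"
  by (simp add: vB_def)

locale Ap_weight =
  fixes w :: "'a::euclidean_space \<Rightarrow> real" and p Cw :: real
  assumes p: "1 < p" and Cw: "0 < Cw"
    and w_measurable [measurable]: "w \<in> borel_measurable lebesgue"
    and w_nonneg: "0 \<le> w x"
    and w_pos_AE: "AE x in lebesgue. 0 < w x"
    and w_integrable_ball: "set_integrable lebesgue (ball c r) w"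
    and sigma_integrable_ball: "set_integrable lebesgue (ball c r) (\<lambda>x. w x powr (- 1 / (p - 1)))"
    and Ap_ball: "0 < r \<Longrightarrow> (LINT x:ball c r|lebesgue. w x)
      * (LINT x:ball c r|lebesgue. w x powr (- 1 / (p - 1))) powr (p - 1)
      \<le> Cw * measure lebesgue (ball c r) powr p"
begin

definition W :: "'a set \<Rightarrow> real" where "W S = (LINT x:S|lebesgue. w x)"

definition Sg :: "'a set \<Rightarrow> real" where "Sg S = (LINT x:S|lebesgue. w x powr (- 1 / (p - 1)))"

lemma DIM_ge_1_real: "1 \<le> real DIM('a)"
  using DIM_positive[where 'a = 'a] by linarith

lemma W_mono: "E \<in> sets lebesgue \<Longrightarrow> E \<subseteq> ball c r \<Longrightarrow> W E \<le> W (ball c r)"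
  unfolding W_def using w_nonneg by (intro set_integral_mono_set w_integrable_ball) auto

lemma Sg_mono: "E \<in> sets lebesgue \<Longrightarrow> E \<subseteq> ball c r \<Longrightarrow> Sg E \<le> Sg (ball c r)"
  unfolding Sg_def by (intro set_integral_mono_set sigma_integrable_ball) auto

lemma W_nonneg: "0 \<le> W S" and Sg_nonneg: "0 \<le> Sg S"
  unfolding W_def Sg_def set_lebesgue_integral_def using w_nonneg by (auto intro!: integral_nonneg)

lemma measure_le_weights:
  assumes "E \<in> sets lebesgue" "E \<subseteq> ball c r"
  shows "measure lebesgue E \<le> W E powr (1 / p) * Sg E powr (1 - 1 / p)"
  unfolding W_def Sg_def
proof (rule measure_le_dual_weights[OF p w_pos_AE assms(1)])
  show "emeasure lebesgue E < \<infinity>"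
    using emeasure_mono[OF assms(2), of lebesgue] emeasure_lborel_ball_finite[of c r]
    by (auto simp: less_top top_unique)
qed (rule set_integrable_subset[OF w_integrable_ball assms] set_integrable_subset[OF sigma_integrable_ball assms])+

text \<open>Hoelder's inequality bounds |E|^p by the w-mass of E times the (p-1)-th power of the
  dual mass of E. The dual mass is enlarged to the whole ball, where the Muckenhoupt condition
  bounds its product with the w-mass of the ball.\<close>

lemma doubling:
  assumes E: "E \<in> sets lebesgue" "E \<subseteq> ball c r" and r: "0 < r"
    and D: "measure lebesgue (ball c r) \<le> D * measure lebesgue E" and D0: "0 \<le> D" and pos: "0 < measure lebesgue E"
  shows "W (ball c r) \<le> Cw * D powr p * W E"
proof -
  let ?B = "ball c r" and ?e = "measure lebesgue E"
  have "?e powr p \<le> (W E powr (1 / p) * Sg E powr (1 - 1 / p)) powr p"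
    using p by (intro powr_mono2 measure_le_weights[OF E]) auto
  also have "\<dots> = W E * Sg E powr (p - 1)"
    using p W_nonneg[of E] by (simp add: powr_mult powr_powr left_diff_distrib)
  also have "\<dots> \<le> W E * Sg ?B powr (p - 1)"
    using p by (intro mult_left_mono powr_mono2 Sg_mono E W_nonneg Sg_nonneg) auto
  finally have 1: "?e powr p \<le> W E * Sg ?B powr (p - 1)" .
  have "W ?B * ?e powr p \<le> W E * (W ?B * Sg ?B powr (p - 1))"
    using mult_left_mono[OF 1 W_nonneg[of ?B]] by (simp add: mult_ac)
  also have "\<dots> \<le> W E * (Cw * measure lebesgue ?B powr p)"
    using Ap_ball[OF r, of c] by (intro mult_left_mono W_nonneg) (simp add: W_def Sg_def)
  also have "\<dots> \<le> W E * (Cw * (D * ?e) powr p)"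
    using D p Cw by (intro mult_left_mono W_nonneg powr_mono2) auto
  also have "\<dots> = (Cw * D powr p * W E) * ?e powr p"
    using D0 by (simp add: powr_mult mult_ac)
  finally show ?thesis
    using pos by (simp add: mult_le_cancel_right)
qed

definition Kc :: real where "Kc = Cw powr (1 / p) * vB DIM('a)"

lemma cell_subset_ball: "x \<in> cell (Q :: 'a cube) \<Longrightarrow> cell Q \<subseteq> ball x (2 * DIM('a) * side (snd Q))"
proof -
  assume "x \<in> cell Q"
  have "0 < DIM('a) * side (snd Q)" using DIM_ge_1_real by (simp add: mult_pos_pos)
  then have "norm (x - y) < 2 * DIM('a) * side (snd Q)" if "y \<in> cell Q" for y
    using norm_diff_cell[OF \<open>x \<in> cell Q\<close> that] unfolding of_nat_mult of_nat_numeral by linarith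
  then show ?thesis by (auto simp: dist_norm)
qed

lemma measure_ball_cell:
  "measure lebesgue (ball (x :: 'a) (2 * DIM('a) * side (snd Q))) = vB DIM('a) * cvol (Q :: 'a cube)"
  by (subst measure_ball_lebesgue) (simp_all add: vB_def cvol_def power_mult_distrib)

sublocale Ap_cubes w p Kc
proof
  show "0 < Kc" using Cw vB_pos[where 'a = 'a] by (simp add: Kc_def)
  fix Q :: "'a cube"
  let ?B = "ball (fst Q) (2 * DIM('a) * side (snd Q))"
  have sub: "cell Q \<subseteq> ?B" by (rule cell_subset_ball[OF corner_in_cell])
  have r: "0 < 2 * DIM('a) * side (snd Q)" using DIM_ge_1_real by simp
  show "set_integrable lebesgue (cell Q) w" "set_integrable lebesgue (cell Q) (\<lambda>x. w x powr (- 1 / (p - 1)))"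
    by (rule set_integrable_subset[OF w_integrable_ball _ sub] set_integrable_subset[OF sigma_integrable_ball _ sub]; simp)+
  have "W (cell Q) powr (1 / p) * Sg (cell Q) powr (1 - 1 / p) \<le> W ?B powr (1 / p) * Sg ?B powr (1 - 1 / p)"
    using p by (intro mult_mono powr_mono2 W_mono Sg_mono sub W_nonneg Sg_nonneg) auto
  also have "\<dots> = (W ?B * Sg ?B powr (p - 1)) powr (1 / p)"
  proof -
    have "(p - 1) * (1 / p) = 1 - 1 / p" using p by (simp add: field_simps)
    then show ?thesis by (simp only: powr_mult powr_powr)
  qed
  also have "\<dots> \<le> (Cw * measure lebesgue ?B powr p) powr (1 / p)"
    using p Ap_ball[OF r, of "fst Q"] W_nonneg Sg_nonneg
    by (intro powr_mono2) (auto simp: W_def Sg_def)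
  also have "\<dots> = Kc * cvol Q"
    unfolding measure_ball_cell Kc_def using p cvol_pos[of Q] vB_pos[where 'a = 'a]
    by (simp add: powr_mult powr_powr less_imp_le)
  finally show "(LINT x:cell Q|lebesgue. w x) powr (1 / p) * (LINT x:cell Q|lebesgue. w x powr (- 1 / (p - 1))) powr (1 - 1 / p) \<le> Kc * cvol Q"
    by (simp add: W_def Sg_def)
qed (use p w_pos_AE in auto)

lemma wm_W: "wm Q = W (cell Q)"
  by (simp add: wm_def W_def)

definition Cq :: real where "Cq = Cw * vB DIM('a) powr p"

lemma Cq_pos: "0 < Cq"
  using Cw vB_pos[where 'a = 'a] by (simp add: Cq_def)

lemma W_ball_cell: "x \<in> cell Q \<Longrightarrow> W (ball x (2 * DIM('a) * side (snd Q))) \<le> Cq * wm Q"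
  unfolding wm_W Cq_def
proof (rule doubling)
  show "measure lebesgue (ball x (2 * DIM('a) * side (snd Q))) \<le> vB DIM('a) * measure lebesgue (cell Q)"
    by (simp only: measure_ball_cell measure_cell order_refl)
qed (use DIM_ge_1_real vB_pos[where 'a = 'a] cvol_pos[of Q] cell_subset_ball in \<open>auto simp: measure_cell\<close>)

text \<open>The added 1 ensures that 1 - 1 / Cr lies strictly between 0 and 1.\<close>

definition Cr :: real where "Cr = 1 + Cw * (2 * vB DIM('a)) powr p"

lemma Cr_gt_1: "1 < Cr"
  using Cw vB_pos[where 'a = 'a] by (simp add: Cr_def)

text \<open>\<open>doubling\<close> applied to \<open>Q\<close> without \<open>R\<close>, which
  fills at least half of \<open>Q\<close>: this complement has at least the fraction 1 / Cr of the
  weight of \<open>Q\<close>.\<close>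

lemma reverse_doubling:
  assumes R: "R \<in> children Q"
  shows "wm R \<le> (1 - 1 / Cr) * wm Q"
proof -
  let ?E = "cell Q - cell R" and ?B = "ball (fst Q) (2 * DIM('a) * side (snd Q))"
  have sub: "cell R \<subseteq> cell Q" by (rule cell_child_subset[OF R])
  have E: "?E \<in> sets lebesgue" "?E \<subseteq> ?B"
    using cell_subset_ball[OF corner_in_cell, of Q] by auto
  have mE: "measure lebesgue ?E = cvol Q - cvol R"
    using sub by (subst measure_Diff) (auto simp: emeasure_cell measure_cell)
  have "(2 :: real) \<le> 2 ^ DIM('a)" using power_increasing[of 1 "DIM('a)" "2::real"] by simp
  then have "2 * cvol R \<le> cvol Q"
    unfolding cvol_child[OF R] using cvol_pos[of R] by (intro mult_right_mono) auto
  then have half: "cvol Q \<le> 2 * measure lebesgue ?E" by (simp add: mE)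
  have "wm Q \<le> W ?B" unfolding wm_W by (intro W_mono cell_subset_ball corner_in_cell) simp
  also have "\<dots> \<le> Cw * (2 * vB DIM('a)) powr p * W ?E"
  proof (rule doubling[OF E])
    show "measure lebesgue ?B \<le> 2 * vB DIM('a) * measure lebesgue ?E"
      using mult_left_mono[OF half less_imp_le[OF vB_pos[where 'a = 'a]]]
      unfolding measure_ball_cell by (simp only: mult_ac)
    show "0 < measure lebesgue ?E" using half cvol_pos[of Q] by linarith
  qed (use DIM_ge_1_real vB_pos[where 'a = 'a] in auto)
  also have "\<dots> \<le> Cr * W ?E" using W_nonneg[of ?E] by (intro mult_right_mono) (auto simp: Cr_def)
  also have "W ?E = wm Q - wm R"
  proof -
    have "wm Q = (LINT x:cell R \<union> ?E|lebesgue. w x)"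
      using sub by (simp add: wm_def Un_absorb1)
    also have "\<dots> = wm R + W ?E"
      unfolding wm_def W_def
      by (rule set_integral_Un) (auto intro: w_integrable set_integrable_subset[OF w_integrable])
    finally show ?thesis by simp
  qed
  finally show ?thesis using Cr_gt_1 by (simp add: field_simps)
qed

lemma wm_ancestor: "wm (cube_at S k x) \<le> (1 - 1 / Cr) ^ l * wm (cube_at S (k - int l) x)"
proof (induction l)
  case (Suc l)
  have "cube_at S (k - int l) x \<in> children (cube_at S (k - int (Suc l)) x)"
    using cube_at_child[of S "k - int (Suc l)" x] by (simp add: algebra_simps)
  then have "wm (cube_at S (k - int l) x) \<le> (1 - 1 / Cr) * wm (cube_at S (k - int (Suc l)) x)"
    by (rule reverse_doubling)
  moreover have "0 \<le> (1 - 1 / Cr) ^ l" using Cr_gt_1 by simp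
  ultimately have "(1 - 1 / Cr) ^ l * wm (cube_at S (k - int l) x)
     \<le> (1 - 1 / Cr) ^ l * ((1 - 1 / Cr) * wm (cube_at S (k - int (Suc l)) x))"
    by (rule mult_left_mono)
  with Suc show ?case unfolding power_Suc2 mult.assoc by (rule order_trans)
qed simp

lemma W_pos: "0 < r \<Longrightarrow> 0 < W (ball c r)"
proof -
  assume r: "0 < r"
  have "0 < measure lebesgue (ball c r)" using r by simp
  also have "\<dots> \<le> W (ball c r) powr (1 / p) * Sg (ball c r) powr (1 - 1 / p)"
    by (rule measure_le_weights) auto
  finally have "W (ball c r) \<noteq> 0" by auto
  then show ?thesis using W_nonneg[of "ball c r"] by simp
qed

text \<open>In each coordinate the ball projects to an interval shorter than the side, so a point
  shares its grid interval with one of the two end points. Hence the cubes through the vertices of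
  the circumscribed cube cover the ball; \<open>T\<close> lists the coordinates of the upper
  end.\<close>

lemma ball_cover:
  assumes "2 * r < side k" "x \<in> ball c r"
  obtains T where "T \<subseteq> Basis" "x \<in> cell (cube_at S k (\<Sum>b\<in>Basis. (if b \<in> T then c \<bullet> b + r else c \<bullet> b - r) *\<^sub>R b))"
proof
  define T where "T = {b\<in>Basis. \<lfloor>x \<bullet> b / side k - shift S k b\<rfloor> = \<lfloor>(c \<bullet> b + r) / side k - shift S k b\<rfloor>}"
  show "T \<subseteq> Basis" by (auto simp: T_def)
  have "\<lfloor>x \<bullet> b / side k - shift S k b\<rfloor> = \<lfloor>(if b \<in> T then c \<bullet> b + r else c \<bullet> b - r) / side k - shift S k b\<rfloor>"
    if b: "b \<in> Basis" for b
  proof -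
    have "\<bar>(c - x) \<bullet> b\<bar> \<le> r" using Basis_le_norm[OF b, of "c - x"] assms(2) by (simp add: dist_norm)
    then have "c \<bullet> b - r \<le> x \<bullet> b" "x \<bullet> b \<le> c \<bullet> b + r" by (auto simp: inner_diff_left)
    then have 1: "(c \<bullet> b - r) / side k \<le> x \<bullet> b / side k" "x \<bullet> b / side k \<le> (c \<bullet> b + r) / side k"
      by (simp_all add: divide_right_mono)
    have "2 * r / side k < 1" using assms(1) side_pos[of k] by (simp add: field_simps)
    then have "(c \<bullet> b + r) / side k < (c \<bullet> b - r) / side k + 1"
      by (simp add: add_divide_distrib diff_divide_distrib)
    moreover have "\<lfloor>x'\<rfloor> = \<lfloor>hi\<rfloor> \<or> \<lfloor>x'\<rfloor> = \<lfloor>lo\<rfloor>" if "lo \<le> x'" "x' \<le> hi" "hi < lo + 1" for lo x' hi :: real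
      using that by linarith
    ultimately have "\<lfloor>x \<bullet> b / side k - shift S k b\<rfloor> = \<lfloor>(c \<bullet> b + r) / side k - shift S k b\<rfloor>
        \<or> \<lfloor>x \<bullet> b / side k - shift S k b\<rfloor> = \<lfloor>(c \<bullet> b - r) / side k - shift S k b\<rfloor>"
      using 1 by simp
    then show ?thesis using b by (auto simp: T_def)
  qed
  then show "x \<in> cell (cube_at S k (\<Sum>b\<in>Basis. (if b \<in> T then c \<bullet> b + r else c \<bullet> b - r) *\<^sub>R b))"
    unfolding mem_cell_cube_at by (intro ballI) (simp only: inner_sum_left_Basis)
qed

end

section \<open>Morrey estimates\<close>

text \<open>Comparison with the largest term treats exponents below and above 1 alike; it is used
  with p / 2, which may be either.\<close>

lemma sum_powr_le:
  fixes x :: "'i \<Rightarrow> real"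
  assumes "finite I" "\<And>i. i \<in> I \<Longrightarrow> 0 \<le> x i" "0 < a"
  shows "(\<Sum>i\<in>I. x i) powr a \<le> real (card I) powr a * (\<Sum>i\<in>I. x i powr a)"
proof (cases "I = {}")
  case False
  define M where "M = Max (x ` I)"
  have "M \<in> x ` I" unfolding M_def using assms(1) False by (intro Max_in) auto
  then obtain i where i: "i \<in> I" "x i = M" by blast
  have "x j \<le> M" if "j \<in> I" for j using that assms(1) by (simp add: M_def)
  then have "(\<Sum>i\<in>I. x i) \<le> real (card I) * M" using sum_bounded_above[of I x M] by simp
  then have "(\<Sum>i\<in>I. x i) powr a \<le> (real (card I) * M) powr a"
    using assms by (intro powr_mono2 sum_nonneg) auto
  also have "\<dots> = real (card I) powr a * x i powr a" using i assms(2)[OF i(1)] by (simp add: powr_mult)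
  also have "\<dots> \<le> real (card I) powr a * (\<Sum>i\<in>I. x i powr a)"
    using i assms(1) by (intro mult_left_mono member_le_sum) auto
  finally show ?thesis .
qed simp

lemma add_powr_le:
  fixes x y :: real
  assumes "0 \<le> x" "0 \<le> y" "0 < a"
  shows "(x + y) powr a \<le> 2 powr a * (x powr a + y powr a)"
proof -
  have "(\<Sum>b\<in>UNIV. if b then x else y) powr a
      \<le> real (card (UNIV :: bool set)) powr a * (\<Sum>b\<in>UNIV. (if b then x else y) powr a)"
    using assms by (intro sum_powr_le) auto
  then show ?thesis by (simp add: UNIV_bool add.commute)
qed

lemma countable_range_cube_at: "countable (range (cube_at S k :: 'a::euclidean_space \<Rightarrow> _))"
proof (rule countable_subset)
  let ?g = "\<lambda>z :: 'a \<Rightarrow> int. (\<Sum>b\<in>Basis. (side k * (of_int (z b) + shift S k b)) *\<^sub>R b, k)"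
  show "range (cube_at S k) \<subseteq> ?g ` (Basis \<rightarrow>\<^sub>E UNIV)"
  proof (rule image_subsetI)
    fix x :: 'a
    show "cube_at S k x \<in> ?g ` (Basis \<rightarrow>\<^sub>E UNIV)"
      by (rule image_eqI[where x = "\<lambda>b\<in>Basis. \<lfloor>x \<bullet> b / side k - shift S k b\<rfloor>"]) (simp_all add: cube_at_def)
  qed
  show "countable (?g ` (Basis \<rightarrow>\<^sub>E (UNIV :: int set)))"
    by (intro countable_image countable_PiE) auto
qed

lemma cube_at_measurable [measurable]:
  fixes h :: "'a::euclidean_space cube \<Rightarrow> real"
  shows "(\<lambda>x. h (cube_at S k x)) \<in> borel_measurable borel"
proof (rule measurableI)
  fix A :: "real set"
  let ?C = "{Q \<in> range (cube_at S k :: 'a \<Rightarrow> _). h Q \<in> A}"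
  have "(\<lambda>x. h (cube_at S k x)) -` A \<inter> space borel = (\<Union>Q\<in>?C. cell Q)"
  proof (intro set_eqI iffI)
    fix x assume "x \<in> (\<lambda>x. h (cube_at S k x)) -` A \<inter> space borel"
    then show "x \<in> (\<Union>Q\<in>?C. cell Q)" by (intro UN_I[of "cube_at S k x"]) auto
  next
    fix x assume "x \<in> (\<Union>Q\<in>?C. cell Q)"
    then obtain y where y: "h (cube_at S k y) \<in> A" "x \<in> cell (cube_at S k y)" by blast
    then show "x \<in> (\<lambda>x. h (cube_at S k x)) -` A \<inter> space borel"
      using cube_at_eq[OF y(2)] by simp
  qed
  moreover have "countable ?C" by (rule countable_subset[OF _ countable_range_cube_at[of S k]]) auto
  ultimately show "(\<lambda>x. h (cube_at S k x)) -` A \<inter> space borel \<in> sets borel"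
    by auto
qed simp

lemma cube_at_measurable_lebesgue [measurable]:
  fixes h :: "'a::euclidean_space cube \<Rightarrow> real"
  shows "(\<lambda>x. h (cube_at S k x)) \<in> borel_measurable lebesgue"
  by (rule measurable_completion) measurable

text \<open>Finitely many levels fit into a window around \<open>k\<close>, split into cubes of
  level at least \<open>k\<close> and larger ones. The width \<open>d\<close> depends on
  \<open>N\<close> and \<open>k\<close>, but the estimates applied to both halves are uniform in
  \<open>d\<close>.\<close>

lemma window_sum_le:
  fixes u :: "int \<Rightarrow> real" and k :: int
  obtains d where "\<And>u :: int \<Rightarrow> real. (\<And>z. 0 \<le> u z) \<Longrightarrow>
    (\<Sum>i<N. u (int_decode i)) \<le> (\<Sum>l<d. u (k + int l)) + (\<Sum>l<d. u (k - 1 - int l))"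
proof
  define d where "d = Suc (\<Sum>i<N. nat \<bar>int_decode i - k\<bar>)"
  fix u :: "int \<Rightarrow> real" assume u: "\<And>z. 0 \<le> u z"
  let ?P = "(\<lambda>l. k + int l) ` {..<d}" and ?M = "(\<lambda>l. k - 1 - int l) ` {..<d}"
  have "int_decode ` {..<N} \<subseteq> ?P \<union> ?M"
  proof safe
    fix i assume "i < N" "int_decode i \<notin> ?M"
    have "nat \<bar>int_decode i - k\<bar> \<le> (\<Sum>i<N. nat \<bar>int_decode i - k\<bar>)"
      using \<open>i < N\<close> by (intro member_le_sum) auto
    then have d: "nat \<bar>int_decode i - k\<bar> < d" by (simp add: d_def)
    show "int_decode i \<in> ?P"
    proof (rule ccontr)
      assume "int_decode i \<notin> ?P"
      moreover have "int_decode i = k + int (nat (int_decode i - k))" if "k \<le> int_decode i" using that by simp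
      ultimately have "int_decode i < k" using d by (force simp: image_iff)
      then have "int_decode i = k - 1 - int (nat (k - 1 - int_decode i))" "nat (k - 1 - int_decode i) < d"
        using d by auto
      with \<open>int_decode i \<notin> ?M\<close> show False by blast
    qed
  qed
  moreover have "(\<Sum>i<N. u (int_decode i)) = sum u (int_decode ` {..<N})"
    by (subst sum.reindex) (auto intro: inj_on_subset[OF inj_int_decode])
  ultimately have "(\<Sum>i<N. u (int_decode i)) \<le> sum u (?P \<union> ?M)"
    using u by (auto intro: sum_mono2)
  also have "\<dots> \<le> sum u ?P + sum u ?M"
    using u by (simp add: sum_Un sum_nonneg)
  also have "sum u ?P = (\<Sum>l<d. u (k + int l))" by (subst sum.reindex) (auto intro: inj_onI)
  also have "sum u ?M = (\<Sum>l<d. u (k - 1 - int l))" by (subst sum.reindex) (auto intro: inj_onI)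
  finally show "(\<Sum>i<N. u (int_decode i)) \<le> (\<Sum>l<d. u (k + int l)) + (\<Sum>l<d. u (k - 1 - int l))" .
qed

text \<open>\<open>\<Lambda>\<close> is the p-th power of the Morrey norm of the ell2 norm of the
  sequence, or any larger number.\<close>

locale morrey_data = Ap_weight w p Cw for w :: "'a::euclidean_space \<Rightarrow> real" and p Cw +
  fixes \<kappa> \<theta> \<Lambda> :: real and J :: "'j set" and f :: "'j \<Rightarrow> 'a \<Rightarrow> complex"
  assumes kappa: "0 < \<kappa>" "\<kappa> < 1" and theta: "0 < \<theta>" "\<theta> < 1" and Lambda: "0 \<le> \<Lambda>" and finite_J: "finite J"
    and f_integrable: "j \<in> J \<Longrightarrow> set_integrable lebesgue (cell Q) (f j)"
    and Fp_integrable_ball: "set_integrable lebesgue (ball c r) (\<lambda>x. L2_set (\<lambda>j. norm (f j x)) J powr p * w x)"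
    and Fp_ball: "0 < r \<Longrightarrow> (LINT x:ball c r|lebesgue. L2_set (\<lambda>j. norm (f j x)) J powr p * w x)
      \<le> \<Lambda> * W (ball c r) powr \<kappa>"
begin

sublocale Ap_cubes_data w p Kc \<theta> J f
proof
  show "set_integrable lebesgue (cell Q) (\<lambda>x. L2_set (\<lambda>j. norm (f j x)) J powr p * w x)" for Q
    by (rule set_integrable_subset[OF Fp_integrable_ball _ cell_subset_ball[OF corner_in_cell]]) simp
qed (use theta finite_J f_integrable in auto)

abbreviation "a \<equiv> acoef \<theta> J f"

lemma a_nonneg: "0 \<le> a Q"
  by (rule acoef_nonneg[OF theta finite_J f_integrable])

lemma Fp_nonneg: "0 \<le> Fp Q"
  unfolding set_lebesgue_integral_def using w_nonneg by (auto intro!: integral_nonneg)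

lemma Fp_cell: "Fp Q \<le> \<Lambda> * (Cq * wm Q) powr \<kappa>"
proof -
  let ?B = "ball (fst Q) (2 * DIM('a) * side (snd Q))"
  have "Fp Q \<le> (LINT x:?B|lebesgue. F x powr p * w x)"
    using w_nonneg by (intro set_integral_mono_set Fp_integrable_ball cell_subset_ball corner_in_cell) auto
  also have "\<dots> \<le> \<Lambda> * W ?B powr \<kappa>"
    using DIM_ge_1_real by (intro Fp_ball) (simp add: mult_pos_pos)
  also have "\<dots> \<le> \<Lambda> * (Cq * wm Q) powr \<kappa>"
    using Lambda kappa by (intro mult_left_mono powr_mono2 W_ball_cell corner_in_cell W_nonneg) auto
  finally show ?thesis .
qed

section \<open>Cubes larger and smaller than a given ball\<close>

definition C4 :: real where "C4 = 2 / (1 - \<theta>) * Kc * Cq powr (\<kappa> / p)"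

lemma C4_pos: "0 < C4"
  using theta K Cq_pos by (simp add: C4_def)

text \<open>Hoelder's inequality and the Muckenhoupt condition bound the average of the ell2 norm by
  the p-th root of \<open>Fp Q / wm Q\<close>; the Morrey bound for \<open>Fp\<close> leaves a
  negative power of \<open>wm Q\<close>, which is small on heavy cubes.\<close>

lemma a_le_wm: "a Q \<le> C4 * \<Lambda> powr (1 / p) * wm Q powr ((\<kappa> - 1) / p)"
proof -
  have vQ: "0 < cvol Q" "0 < wm Q" by (rule cvol_pos wm_pos)+
  have "Fm Q * wm Q powr (1 / p) \<le> (Fp Q powr (1 / p) * \<sigma>m Q powr (1 - 1 / p)) * wm Q powr (1 / p)"
    by (intro mult_right_mono f_le_Holder[OF Fp_integrable F_integrable] L2_set_nonneg) auto
  also have "\<dots> = Fp Q powr (1 / p) * (wm Q powr (1 / p) * \<sigma>m Q powr (1 - 1 / p))" by simp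
  also have "\<dots> \<le> Fp Q powr (1 / p) * (Kc * cvol Q)"
    using Ap[of Q] by (intro mult_left_mono) (auto simp: wm_def \<sigma>m_def)
  finally have "Fm Q / cvol Q \<le> Kc * Fp Q powr (1 / p) * wm Q powr (- (1 / p))"
    using vQ by (simp add: powr_minus field_simps)
  also have "\<dots> \<le> Kc * (\<Lambda> * (Cq * wm Q) powr \<kappa>) powr (1 / p) * wm Q powr (- (1 / p))"
    using K p Fp_nonneg by (intro mult_right_mono mult_left_mono powr_mono2 Fp_cell) auto
  also have "\<dots> = Kc * \<Lambda> powr (1 / p) * Cq powr (\<kappa> / p) * (wm Q powr (\<kappa> / p) * wm Q powr (- (1 / p)))"
    using Lambda vQ Cq_pos by (simp add: powr_mult powr_powr)
  also have "wm Q powr (\<kappa> / p) * wm Q powr (- (1 / p)) = wm Q powr ((\<kappa> - 1) / p)"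
    using vQ by (simp add: powr_add[symmetric] diff_divide_distrib)
  finally have "2 / (1 - \<theta>) * (Fm Q / cvol Q) \<le> 2 / (1 - \<theta>) * (Kc * \<Lambda> powr (1 / p) * Cq powr (\<kappa> / p) * wm Q powr ((\<kappa> - 1) / p))"
    using theta by (intro mult_left_mono) auto
  moreover have "a Q \<le> 2 / (1 - \<theta>) * (Fm Q / cvol Q)"
    by (rule acoef_le[OF theta finite_J f_integrable])
  ultimately show ?thesis by (simp add: C4_def mult_ac)
qed

text \<open>The factor gained in the bound \<open>a_le_wm\<close> when a cube is replaced by its
  parent. It is below 1 precisely because \<kappa> is.\<close>

definition \<eta> :: real where "\<eta> = (1 - 1 / Cr) powr ((1 - \<kappa>) / p)"

lemma eta: "0 < \<eta>" "\<eta> < 1"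
proof -
  have "0 < 1 - 1 / Cr" "1 - 1 / Cr < 1" "0 < (1 - \<kappa>) / p" using Cr_gt_1 kappa p by auto
  then show "0 < \<eta>" "\<eta> < 1"
    using powr_less_mono2[of "(1 - \<kappa>) / p" "1 - 1 / Cr" 1] by (auto simp: \<eta>_def)
qed

definition C5 :: real where
  "C5 = C4 powr p * Cq powr (1 - \<kappa>) * (1 / (1 - \<eta>\<^sup>2)) powr (p / 2)"

text \<open>A sum over the 2^n cubes of \<open>ball_cover\<close>; the power of 6 n compares the
  given ball with the ball of radius 6 n r containing all of them.\<close>

definition C6 :: real where
  "C6 = 2 ^ DIM('a) * (C2 * (Cq * (Cw * ((6 * DIM('a)) ^ DIM('a)) powr p)) powr \<kappa>)"

context
  fixes c :: 'a and r :: real and k :: int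
  assumes r: "0 < r" and k: "2 * r < side k" "side k \<le> 4 * r"
begin

lemma W_ball_le_wm:
  assumes "x \<in> ball c r"
  shows "W (ball c r) \<le> Cq * wm (cube_at S k x)"
proof -
  let ?B' = "ball x (2 * DIM('a) * side (snd (cube_at S k x)))"
  have "1 \<le> real (2 * DIM('a))" using DIM_ge_1_real by linarith
  then have "side k \<le> 2 * DIM('a) * side k" using mult_right_mono[of 1 "real (2 * DIM('a))" "side k"] by simp
  moreover have "dist x y < 2 * r" if "y \<in> ball c r" for y
    using that assms dist_triangle3[of x y c] by simp
  ultimately have "dist x y < 2 * DIM('a) * side k" if "y \<in> ball c r" for y
    using k that by (meson less_le_trans less_trans)
  then have "ball c r \<subseteq> ?B'" by (auto simp del: mem_ball simp: subset_iff mem_ball[of _ x])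
  then have "W (ball c r) \<le> W ?B'" by (intro W_mono) auto
  also have "\<dots> \<le> Cq * wm (cube_at S k x)" by (rule W_ball_cell) simp
  finally show ?thesis .
qed

text \<open>A pointwise estimate. Reverse doubling makes the weight grow geometrically along the
  ancestors, the negative exponent in \<open>a_le_wm\<close> turns this into decay like \<eta>^l,
  and the squares form a geometric series.\<close>

lemma far_bound:
  assumes x: "x \<in> ball c r"
  shows "(\<Sum>l<d. (a (cube_at S (k - 1 - int l) x))\<^sup>2) powr (p / 2) \<le> C5 * \<Lambda> * W (ball c r) powr (\<kappa> - 1)"
proof -
  let ?e = "(\<kappa> - 1) / p" and ?\<delta> = "1 - 1 / Cr"
  let ?W = "W (ball c r)"
  have W: "0 < ?W" by (rule W_pos[OF r])
  have \<delta>: "0 < ?\<delta>" "?\<delta> < 1" using Cr_gt_1 by auto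
  have e: "?e \<le> 0" using kappa p by (simp add: divide_nonpos_pos)
  define Z where "Z = C4 * \<Lambda> powr (1 / p) * (?W / Cq) powr ?e"
  have Z: "0 \<le> Z" using C4_pos by (simp add: Z_def)
  have al: "a (cube_at S (k - 1 - int l) x) \<le> Z * \<eta> ^ l" for l
  proof -
    let ?Q = "cube_at S (k - 1 - int l) x"
    have "?W / Cq \<le> wm (cube_at S k x)"
      using W_ball_le_wm[OF x, of S] Cq_pos by (simp add: field_simps)
    also have "\<dots> \<le> ?\<delta> ^ Suc l * wm ?Q"
      using wm_ancestor[of S k x "Suc l"] by (simp add: algebra_simps)
    \<comment> \<open>Index l is the ancestor l + 1 generations up; one factor below 1 is given away
      so that the decay starts with exponent 0.\<close>
    also have "\<dots> \<le> ?\<delta> ^ l * wm ?Q"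
      using \<delta> wm_pos[of ?Q] by (intro mult_right_mono power_decreasing) auto
    finally have "?W / Cq / ?\<delta> ^ l \<le> wm ?Q" using zero_less_power[OF \<delta>(1), of l] by (simp only: pos_divide_le_eq mult.commute)
    then have "wm ?Q powr ?e \<le> (?W / Cq / ?\<delta> ^ l) powr ?e"
      using W Cq_pos \<delta> e by (intro powr_mono2') auto
    also have "\<dots> = (?W / Cq) powr ?e * \<eta> ^ l"
    proof -
      have "(?\<delta> ^ l) powr ?e = 1 / \<eta> ^ l"
      proof -
        have "(?\<delta> ^ l) powr ?e = ?\<delta> powr (- (real l * ((1 - \<kappa>) / p)))"
          using \<delta> by (simp add: powr_realpow[symmetric] powr_powr minus_divide_left[symmetric] algebra_simps diff_divide_distrib)
        also have "\<dots> = 1 / \<eta> ^ l"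
          using \<delta> by (simp add: \<eta>_def powr_minus_divide powr_realpow[symmetric] powr_powr mult.commute)
        finally show ?thesis .
      qed
      moreover have "(?W / Cq / ?\<delta> ^ l) powr ?e = (?W / Cq) powr ?e / (?\<delta> ^ l) powr ?e"
        by (rule powr_divide)
      ultimately show ?thesis by simp
    qed
    finally have "C4 * \<Lambda> powr (1 / p) * wm ?Q powr ?e \<le> C4 * \<Lambda> powr (1 / p) * ((?W / Cq) powr ?e * \<eta> ^ l)"
      using C4_pos by (intro mult_left_mono) auto
    then show ?thesis using a_le_wm[of ?Q] by (simp add: Z_def mult.assoc)
  qed
  have eta2: "0 \<le> \<eta>\<^sup>2" "\<eta>\<^sup>2 < 1" using eta by (auto simp: power_less_one_iff)
  have "(\<Sum>l<d. (a (cube_at S (k - 1 - int l) x))\<^sup>2) \<le> (\<Sum>l<d. Z\<^sup>2 * (\<eta>\<^sup>2) ^ l)"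
  proof (rule sum_mono)
    fix l
    have "(a (cube_at S (k - 1 - int l) x))\<^sup>2 \<le> (Z * \<eta> ^ l)\<^sup>2" by (intro power_mono al a_nonneg)
    then show "(a (cube_at S (k - 1 - int l) x))\<^sup>2 \<le> Z\<^sup>2 * (\<eta>\<^sup>2) ^ l"
      by (simp add: power_mult_distrib power_mult[symmetric] mult.commute)
  qed
  also have "\<dots> = Z\<^sup>2 * (\<Sum>l<d. (\<eta>\<^sup>2) ^ l)" by (simp add: sum_distrib_left)
  also have "(\<Sum>l<d. (\<eta>\<^sup>2) ^ l) \<le> 1 / (1 - \<eta>\<^sup>2)"
  proof -
    have "(\<Sum>l<d. (\<eta>\<^sup>2) ^ l) = (1 - (\<eta>\<^sup>2) ^ d) / (1 - \<eta>\<^sup>2)"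
      using eta2 by (simp add: sum_gp_strict)
    also have "\<dots> \<le> 1 / (1 - \<eta>\<^sup>2)" using eta2 by (intro divide_right_mono) auto
    finally show ?thesis .
  qed
  finally have "(\<Sum>l<d. (a (cube_at S (k - 1 - int l) x))\<^sup>2) \<le> Z\<^sup>2 * (1 / (1 - \<eta>\<^sup>2))"
    by (simp add: mult_left_mono)
  then have "(\<Sum>l<d. (a (cube_at S (k - 1 - int l) x))\<^sup>2) powr (p / 2) \<le> (Z\<^sup>2 * (1 / (1 - \<eta>\<^sup>2))) powr (p / 2)"
    using p by (intro powr_mono2 sum_nonneg) auto
  also have "\<dots> = (Z\<^sup>2) powr (p / 2) * (1 / (1 - \<eta>\<^sup>2)) powr (p / 2)"
    using eta2 by (simp only: powr_mult)
  also have "(Z\<^sup>2) powr (p / 2) = Z powr p"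
  proof (cases "Z = 0")
    case False
    then have "Z\<^sup>2 = Z powr 2" using Z by (simp add: powr_numeral)
    then show ?thesis by (simp add: powr_powr)
  qed simp
  also have "Z powr p = C4 powr p * \<Lambda> * (?W / Cq) powr (\<kappa> - 1)"
    using C4_pos Lambda p by (simp add: Z_def powr_mult powr_powr)
  also have "(?W / Cq) powr (\<kappa> - 1) = ?W powr (\<kappa> - 1) * Cq powr (1 - \<kappa>)"
  proof -
    have "Cq powr (\<kappa> - 1) = 1 / Cq powr (1 - \<kappa>)" using Cq_pos powr_minus_divide[of Cq "1 - \<kappa>"] by simp
    then show ?thesis using W Cq_pos by (simp add: powr_divide)
  qed
  finally show ?thesis by (simp add: C5_def mult_ac)
qed

text \<open>Inside each of the 2^n covering cubes the sum is a truncated \<open>Hsum\<close>, so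
  \<open>local_bound\<close> applies. The resulting mass on the cube is controlled by the Morrey
  condition, and doubling compares the weight of the cube with that of the ball.\<close>

lemma local_part:
  "(\<integral>\<^sup>+x\<in>ball c r. ennreal ((\<Sum>l<d. (a (cube_at S (k + int l) x))\<^sup>2) powr (p / 2) * w x) \<partial>lebesgue)
    \<le> ennreal (C6 * \<Lambda> * W (ball c r) powr \<kappa>)"
proof -
  define v where "v T = (\<Sum>b\<in>Basis. (if b \<in> T then c \<bullet> b + r else c \<bullet> b - r) *\<^sub>R b)" for T :: "'a set"
  define Q where "Q T = cube_at S k (v T)" for T
  let ?h = "\<lambda>T x. Hsum a d (Q T) x powr (p / 2) * w x"
  let ?Cd = "Cw * ((6 * DIM('a)) ^ DIM('a)) powr p"
  have meas [measurable]: "(\<lambda>x. Hsum a d R x) \<in> borel_measurable lebesgue" for R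
    by (rule measurable_completion) measurable
  have ptw: "ennreal ((\<Sum>l<d. (a (cube_at S (k + int l) x))\<^sup>2) powr (p / 2) * w x) * indicator (ball c r) x
     \<le> (\<Sum>T\<in>Pow Basis. ennreal (?h T x) * indicator (cell (Q T)) x)" for x
  proof (cases "x \<in> ball c r")
    case True
    obtain T where T: "T \<subseteq> Basis" "x \<in> cell (Q T)"
    proof (rule ball_cover[OF k(1) True, where S = S])
      fix T :: "'a set"
      assume "T \<subseteq> Basis" "x \<in> cell (cube_at S k (\<Sum>b\<in>Basis. (if b \<in> T then c \<bullet> b + r else c \<bullet> b - r) *\<^sub>R b))"
      then show thesis by (intro that) (simp_all only: Q_def v_def)
    qed
    have "cube_at S k x = Q T" using cube_at_eq T(2) by (simp add: Q_def)
    then have "ennreal ((\<Sum>l<d. (a (cube_at S (k + int l) x))\<^sup>2) powr (p / 2) * w x) * indicator (ball c r) x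
       = ennreal (?h T x) * indicator (cell (Q T)) x"
      using True T Hsum_cube_at[of a d S k x] by simp
    also have "\<dots> \<le> (\<Sum>T\<in>Pow Basis. ennreal (?h T x) * indicator (cell (Q T)) x)"
      using T by (intro member_le_sum) auto
    finally show ?thesis .
  qed simp
  have wmQ: "wm (Q T) \<le> ?Cd * W (ball c r)" if "T \<subseteq> Basis" for T
  proof -
    \<comment> \<open>The vertices lie within n r of the centre and the cubes have diameter at most
      4 n r; 5 n r is rounded up to get an open ball.\<close>
    let ?B = "ball c (6 * DIM('a) * r)"
    have "norm (v T - c) \<le> (\<Sum>b\<in>Basis. \<bar>(v T - c) \<bullet> b\<bar>)" by (rule norm_le_l1)
    also have "\<dots> = (\<Sum>b\<in>(Basis :: 'a set). r)"
      by (intro sum.cong refl) (use r in \<open>auto simp: v_def inner_diff_left\<close>)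
    finally have vc: "norm (v T - c) \<le> DIM('a) * r" by simp
    have "cell (Q T) \<subseteq> ?B"
    proof
      fix y assume "y \<in> cell (Q T)"
      then have "norm (v T - y) \<le> DIM('a) * side k"
        using norm_diff_cell[of "v T" "Q T" y] by (simp add: Q_def)
      also have "\<dots> \<le> DIM('a) * (4 * r)" using k by (intro mult_left_mono) auto
      finally have "norm (v T - y) \<le> DIM('a) * (4 * r)" .
      moreover have "norm (c - y) \<le> norm (v T - c) + norm (v T - y)"
        using norm_triangle_ineq[of "c - v T" "v T - y"] norm_minus_commute[of c "v T"] by simp
      ultimately have "norm (c - y) \<le> DIM('a) * r + DIM('a) * (4 * r)" using vc by linarith
      moreover have "0 < DIM('a) * r" using DIM_ge_1_real r by simp
      ultimately have "norm (c - y) < 6 * DIM('a) * r" by (simp add: algebra_simps)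
      then show "y \<in> ?B" by (simp add: dist_norm)
    qed
    then have "wm (Q T) \<le> W ?B" unfolding wm_W by (intro W_mono) auto
    also have "\<dots> \<le> Cw * ((6 * DIM('a)) ^ DIM('a)) powr p * W (ball c r)"
    proof (rule doubling)
      have "1 \<le> real (6 * DIM('a))" using DIM_ge_1_real by linarith
      then have "1 * r \<le> 6 * DIM('a) * r" using r by (intro mult_right_mono) auto
      then show "ball c r \<subseteq> ?B" by (intro subset_ball) simp
      have "measure lebesgue ?B = unit_ball_vol DIM('a) * (6 * DIM('a) * r) ^ DIM('a)"
        using r by (intro measure_ball_lebesgue) auto
      also have "\<dots> = (6 * DIM('a)) ^ DIM('a) * measure lebesgue (ball c r)"
        using r by (subst measure_ball_lebesgue) (auto simp: power_mult_distrib)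
      finally show "measure lebesgue ?B \<le> (6 * DIM('a)) ^ DIM('a) * measure lebesgue (ball c r)" by simp
    qed (use r DIM_ge_1_real in auto)
    finally show ?thesis .
  qed
  have each: "(\<integral>\<^sup>+x. ennreal (?h T x) * indicator (cell (Q T)) x \<partial>lebesgue)
     \<le> ennreal (C2 * (Cq * ?Cd) powr \<kappa> * \<Lambda> * W (ball c r) powr \<kappa>)" if T: "T \<subseteq> Basis" for T
  proof -
    obtain N where N: "\<And>x. Hsum a d (Q T) x \<le> N" using Hsum_bounded by blast
    have int: "set_integrable lebesgue (cell (Q T)) (?h T)"
      using N Hsum_nonneg[of a d "Q T"] p
      by (intro set_integrable_bounded_mult[OF w_integrable, where C = "N powr (p / 2)"]) (auto intro!: powr_mono2)
    have "(\<integral>\<^sup>+x. ennreal (?h T x) * indicator (cell (Q T)) x \<partial>lebesgue)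
        = ennreal (LINT x:cell (Q T)|lebesgue. ?h T x)"
      using w_nonneg by (intro nn_set_integral_eq int) auto
    also have "(LINT x:cell (Q T)|lebesgue. ?h T x) \<le> C2 * Fp (Q T)"
      by (rule local_bound)
    also have "\<dots> \<le> C2 * (\<Lambda> * (Cq * (?Cd * W (ball c r))) powr \<kappa>)"
    proof (intro mult_left_mono order_trans[OF Fp_cell] powr_mono2 wmQ T)
      show "0 \<le> C2" using C1_pos by (simp add: C2_def)
      show "0 \<le> Cq * wm (Q T)" using Cq_pos wm_pos[of "Q T"] by simp
    qed (use Lambda kappa Cq_pos in auto)
    also have "\<dots> = C2 * (Cq * ?Cd) powr \<kappa> * \<Lambda> * W (ball c r) powr \<kappa>"
      using W_nonneg Cq_pos Cw by (simp add: powr_mult mult_ac)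
    finally show ?thesis by (simp add: ennreal_leI)
  qed
  have "(\<integral>\<^sup>+x\<in>ball c r. ennreal ((\<Sum>l<d. (a (cube_at S (k + int l) x))\<^sup>2) powr (p / 2) * w x) \<partial>lebesgue)
     \<le> (\<integral>\<^sup>+x. (\<Sum>T\<in>Pow Basis. ennreal (?h T x) * indicator (cell (Q T)) x) \<partial>lebesgue)"
    by (intro nn_integral_mono ptw)
  also have "\<dots> = (\<Sum>T\<in>Pow Basis. \<integral>\<^sup>+x. ennreal (?h T x) * indicator (cell (Q T)) x \<partial>lebesgue)"
    by (intro nn_integral_sum) measurable
  also have "\<dots> \<le> (\<Sum>T\<in>Pow (Basis :: 'a set). ennreal (C2 * (Cq * ?Cd) powr \<kappa> * \<Lambda> * W (ball c r) powr \<kappa>))"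
    by (intro sum_mono each) auto
  also have "\<dots> = ennreal (C6 * \<Lambda> * W (ball c r) powr \<kappa>)"
    using C1_pos Lambda by (simp add: C6_def C2_def card_Pow ennreal_of_nat_eq_real_of_nat ennreal_mult'[symmetric] mult_ac)
  finally show ?thesis .
qed

end

end

context morrey_data
begin

lemma C5_nonneg: "0 \<le> C5"
  by (simp add: C5_def)

lemma C6_nonneg: "0 \<le> C6"
  using C1_pos by (simp add: C6_def C2_def)

definition C7 :: "real \<Rightarrow> real" where
  "C7 s = (s * (2 ^ DIM('a) * 2)) powr (p / 2) * (2 ^ DIM('a) * (C6 + C5))"

text \<open>Splits every grid at the scale of the ball. The bound is uniform in \<open>N\<close>,
  and \<open>C7\<close> depends neither on the functions nor on \<open>J\<close>, as the later
  monotone limit requires.\<close>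

lemma morrey_finite:
  assumes r: "0 < r" and s: "0 \<le> s"
  shows "(\<integral>\<^sup>+x\<in>ball c r. ennreal ((s * (\<Sum>S\<in>Pow Basis. \<Sum>i<N. (a (cube_at S (int_decode i) x))\<^sup>2)) powr (p / 2) * w x) \<partial>lebesgue)
    \<le> ennreal (C7 s * \<Lambda> * W (ball c r) powr \<kappa>)"
proof -
  let ?G = "\<lambda>x. (\<Sum>S\<in>Pow Basis. \<Sum>i<N. (a (cube_at S (int_decode i) x))\<^sup>2)"
  \<comment> \<open>Six and twelve times r / 3 are the bounds 2 r and 4 r.\<close>
  obtain k where k: "2 * r < side k" "side k \<le> 4 * r"
    using ex_side[of "r / 3"] r by auto
  obtain d where d: "\<And>u :: int \<Rightarrow> real. (\<And>z. 0 \<le> u z) \<Longrightarrow>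
    (\<Sum>i<N. u (int_decode i)) \<le> (\<Sum>l<d. u (k + int l)) + (\<Sum>l<d. u (k - 1 - int l))"
    using window_sum_le[of N k] by blast
  define lo where "lo S x = (\<Sum>l<d. (a (cube_at S (k + int l) x))\<^sup>2)" for S x
  define fa where "fa S x = (\<Sum>l<d. (a (cube_at S (k - 1 - int l) x))\<^sup>2)" for S x
  note [measurable] = cube_at_measurable_lebesgue[of a]
  have ball [measurable]: "ball c r \<in> sets lebesgue" by simp
  have [measurable]: "lo S \<in> borel_measurable lebesgue" "fa S \<in> borel_measurable lebesgue" for S
    unfolding lo_def[abs_def] fa_def[abs_def] by measurable
  have nn: "0 \<le> lo S x" "0 \<le> fa S x" for S x by (auto simp: lo_def fa_def sum_nonneg)
  let ?W = "W (ball c r)" and ?e = "p / 2"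
  define K where "K = (s * (2 ^ DIM('a) * 2)) powr ?e"
  have K: "0 \<le> K" by (simp add: K_def)
  have W: "0 < ?W" by (rule W_pos[OF r])
  have e: "0 < ?e" using p by simp
  have ptw: "(s * ?G x) powr ?e
     \<le> K * (\<Sum>S\<in>Pow Basis. lo S x powr ?e + fa S x powr ?e)" for x
  proof -
    have "?G x \<le> (\<Sum>S\<in>Pow Basis. lo S x + fa S x)"
      unfolding lo_def fa_def using d[of "\<lambda>z. (a (cube_at _ z x))\<^sup>2"] by (intro sum_mono) simp
    then have "?G x powr ?e \<le> (\<Sum>S\<in>Pow Basis. lo S x + fa S x) powr ?e"
      using e by (intro powr_mono2 sum_nonneg) auto
    also have "\<dots> \<le> real (card (Pow (Basis :: 'a set))) powr ?e * (\<Sum>S\<in>Pow Basis. (lo S x + fa S x) powr ?e)"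
      using e nn by (intro sum_powr_le) (auto intro: add_nonneg_nonneg)
    also have "\<dots> \<le> real (card (Pow (Basis :: 'a set))) powr ?e * (\<Sum>S\<in>Pow Basis. 2 powr ?e * (lo S x powr ?e + fa S x powr ?e))"
      using e nn by (intro mult_left_mono sum_mono add_powr_le) auto
    also have "\<dots> = (2 ^ DIM('a) * 2) powr ?e * (\<Sum>S\<in>Pow Basis. lo S x powr ?e + fa S x powr ?e)"
      by (simp add: sum_distrib_left[symmetric] card_Pow powr_mult)
    finally have "s powr ?e * ?G x powr ?e
      \<le> s powr ?e * ((2 ^ DIM('a) * 2) powr ?e * (\<Sum>S\<in>Pow Basis. lo S x powr ?e + fa S x powr ?e))"
      by (intro mult_left_mono) auto
    then show ?thesis unfolding K_def powr_mult mult.assoc .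
  qed
  have ptw': "ennreal ((s * ?G x) powr ?e * w x) * indicator (ball c r) x
     \<le> ennreal K * (\<Sum>S\<in>Pow Basis. ennreal (lo S x powr ?e * w x) * indicator (ball c r) x
          + ennreal (fa S x powr ?e * w x) * indicator (ball c r) x)" for x
  proof (cases "x \<in> ball c r")
    case True
    have "(s * ?G x) powr ?e * w x
      \<le> (K * (\<Sum>S\<in>Pow Basis. lo S x powr ?e + fa S x powr ?e)) * w x"
      by (intro mult_right_mono ptw w_nonneg)
    also have "\<dots> = K * (\<Sum>S\<in>Pow Basis. lo S x powr ?e * w x + fa S x powr ?e * w x)"
      by (simp add: sum_distrib_right distrib_right mult.assoc)
    finally have "ennreal ((s * ?G x) powr ?e * w x)
      \<le> ennreal (K * (\<Sum>S\<in>Pow Basis. lo S x powr ?e * w x + fa S x powr ?e * w x))"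
      by (rule ennreal_leI)
    also have "\<dots> = ennreal K * (\<Sum>S\<in>Pow Basis. ennreal (lo S x powr ?e * w x) + ennreal (fa S x powr ?e * w x))"
      using K w_nonneg by (simp add: ennreal_mult' sum_ennreal[symmetric] sum_nonneg)
    finally show ?thesis using True by simp
  qed simp
  have far: "(\<integral>\<^sup>+x\<in>ball c r. ennreal (fa S x powr ?e * w x) \<partial>lebesgue) \<le> ennreal (C5 * \<Lambda> * ?W powr \<kappa>)" for S
  proof -
    have "(\<integral>\<^sup>+x\<in>ball c r. ennreal (fa S x powr ?e * w x) \<partial>lebesgue)
      \<le> (\<integral>\<^sup>+x. ennreal (C5 * \<Lambda> * ?W powr (\<kappa> - 1)) * (ennreal (w x) * indicator (ball c r) x) \<partial>lebesgue)"
    proof (rule nn_integral_mono)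
      fix x
      show "ennreal (fa S x powr ?e * w x) * indicator (ball c r) x
        \<le> ennreal (C5 * \<Lambda> * ?W powr (\<kappa> - 1)) * (ennreal (w x) * indicator (ball c r) x)"
      proof (cases "x \<in> ball c r")
        case True
        have "fa S x powr ?e * w x \<le> (C5 * \<Lambda> * ?W powr (\<kappa> - 1)) * w x"
          unfolding fa_def by (intro mult_right_mono far_bound[OF r k True] w_nonneg)
        then have "ennreal (fa S x powr ?e * w x) \<le> ennreal ((C5 * \<Lambda> * ?W powr (\<kappa> - 1)) * w x)"
          by (rule ennreal_leI)
        then show ?thesis using True C5_nonneg Lambda w_nonneg by (simp add: ennreal_mult'')
      qed simp
    qed
    also have "\<dots> = ennreal (C5 * \<Lambda> * ?W powr (\<kappa> - 1)) * ennreal ?W"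
    proof (subst nn_integral_cmult)
      have "(\<lambda>x. ennreal (w x)) \<in> borel_measurable lebesgue"
        by (rule measurable_compose[OF w_measurable]) simp
      then show "(\<lambda>x. ennreal (w x) * indicator (ball c r) x) \<in> borel_measurable lebesgue"
        by (rule borel_measurable_times_ennreal) (rule borel_measurable_indicator[OF ball])
    qed (simp only: nn_set_integral_eq[OF w_integrable_ball w_nonneg] W_def)
    also have "\<dots> = ennreal (C5 * \<Lambda> * (?W powr (\<kappa> - 1) * ?W))"
      using W by (simp add: ennreal_mult''[symmetric] mult.assoc)
    also have "?W powr (\<kappa> - 1) * ?W = ?W powr \<kappa>"
      using W powr_mult_base[of ?W "\<kappa> - 1"] by (simp add: mult.commute)
    finally show ?thesis .
  qed
  have "(\<integral>\<^sup>+x\<in>ball c r. ennreal ((s * ?G x) powr ?e * w x) \<partial>lebesgue)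
    \<le> (\<integral>\<^sup>+x. ennreal K * (\<Sum>S\<in>Pow Basis. ennreal (lo S x powr ?e * w x) * indicator (ball c r) x
          + ennreal (fa S x powr ?e * w x) * indicator (ball c r) x) \<partial>lebesgue)"
    by (intro nn_integral_mono ptw')
  also have "\<dots> = ennreal K * (\<integral>\<^sup>+x. (\<Sum>S\<in>Pow Basis. ennreal (lo S x powr ?e * w x) * indicator (ball c r) x
          + ennreal (fa S x powr ?e * w x) * indicator (ball c r) x) \<partial>lebesgue)"
    by (rule nn_integral_cmult) measurable
  also have "(\<integral>\<^sup>+x. (\<Sum>S\<in>Pow Basis. ennreal (lo S x powr ?e * w x) * indicator (ball c r) x
          + ennreal (fa S x powr ?e * w x) * indicator (ball c r) x) \<partial>lebesgue)
     = (\<Sum>S\<in>Pow Basis. (\<integral>\<^sup>+x\<in>ball c r. ennreal (lo S x powr ?e * w x) \<partial>lebesgue)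
          + (\<integral>\<^sup>+x\<in>ball c r. ennreal (fa S x powr ?e * w x) \<partial>lebesgue))"
  proof (subst nn_integral_sum)
    show "(\<Sum>S\<in>Pow Basis. \<integral>\<^sup>+x. ennreal (lo S x powr ?e * w x) * indicator (ball c r) x
          + ennreal (fa S x powr ?e * w x) * indicator (ball c r) x \<partial>lebesgue) =
       (\<Sum>S\<in>Pow Basis. (\<integral>\<^sup>+x\<in>ball c r. ennreal (lo S x powr ?e * w x) \<partial>lebesgue)
          + (\<integral>\<^sup>+x\<in>ball c r. ennreal (fa S x powr ?e * w x) \<partial>lebesgue))"
      by (intro sum.cong refl nn_integral_add) measurable
  qed measurable
  also have "ennreal K * \<dots> \<le> ennreal K * (\<Sum>S\<in>Pow (Basis :: 'a set). ennreal (C6 * \<Lambda> * ?W powr \<kappa>) + ennreal (C5 * \<Lambda> * ?W powr \<kappa>))"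
    using local_part[OF r k] far by (intro mult_left_mono sum_mono add_mono) (auto simp: lo_def)
  also have "\<dots> = ennreal (K * (2 ^ DIM('a) * (C6 * \<Lambda> * ?W powr \<kappa> + C5 * \<Lambda> * ?W powr \<kappa>)))"
  proof -
    have "ennreal K * (\<Sum>S\<in>Pow (Basis :: 'a set). ennreal X + ennreal Y) = ennreal (K * (2 ^ DIM('a) * (X + Y)))"
      if "0 \<le> X" "0 \<le> Y" for X Y
      using K that by (simp add: card_Pow ennreal_mult' ennreal_power[symmetric])
    then show ?thesis using C5_nonneg C6_nonneg Lambda by simp
  qed
  also have "K * (2 ^ DIM('a) * (C6 * \<Lambda> * ?W powr \<kappa> + C5 * \<Lambda> * ?W powr \<kappa>)) = C7 s * \<Lambda> * ?W powr \<kappa>"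
    by (simp add: C7_def K_def algebra_simps)
  finally show ?thesis .
qed

end

text \<open>Enlarging the family enlarges every oscillation and hence every depth of the recursion.
  This supplies the monotone convergence when the number of functions grows.\<close>

lemma acoef_mono:
  fixes f :: "'j \<Rightarrow> 'a::euclidean_space \<Rightarrow> complex"
  assumes th: "0 < \<theta>" "\<theta> < 1" and fin: "finite J'" and sub: "J \<subseteq> J'"
    and f: "\<And>j Q. j \<in> J' \<Longrightarrow> set_integrable lebesgue (cell Q) (f j)"
  shows "acoef \<theta> J f Q \<le> acoef \<theta> J' f Q"
proof -
  let ?\<mu> = "\<lambda>j Q. LINT x:cell Q|lebesgue. f j x"
  interpret M: vtree_martingale children cvol "2 ^ DIM('a)" \<theta> J ?\<mu> "\<lambda>Q. LINT x:cell Q|lebesgue. L2_set (\<lambda>j. norm (f j x)) J"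
    by (rule martingale_cells) (use assms finite_subset in auto)
  interpret M': vtree_martingale children cvol "2 ^ DIM('a)" \<theta> J' ?\<mu> "\<lambda>Q. LINT x:cell Q|lebesgue. L2_set (\<lambda>j. norm (f j x)) J'"
    by (rule martingale_cells) (use assms in auto)
  have osc: "cubes.osc J ?\<mu> R \<le> cubes.osc J' ?\<mu> R" for R
    unfolding cubes.osc_def L2_set_def
    by (intro sum_mono real_sqrt_le_mono sum_mono2 fin sub) auto
  have "cubes.bdepth \<theta> J ?\<mu> d R \<le> cubes.bdepth \<theta> J' ?\<mu> d R" for d R
  proof (induction d arbitrary: R)
    case (Suc d)
    then show ?case using th by (auto intro!: add_mono osc mult_left_mono sum_mono)
  qed simp
  then have "M.b Q \<le> M'.b Q"
    by (intro LIMSEQ_le[OF M.bdepth_tendsto M'.bdepth_tendsto]) auto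
  then show ?thesis
    using cvol_pos[of Q] by (simp add: acoef_def divide_right_mono)
qed

section \<open>The main theorem\<close>

lemma ennpow_ennreal: "0 \<le> x \<Longrightarrow> ennpow (ennreal x) a = ennreal (x powr a)"
  by (simp add: ennpow_def)

lemma ennpow_top [simp]: "ennpow top a = top"
  by (simp add: ennpow_def)

lemma ennpow_0: "ennpow 0 a = 0"
  by (simp add: ennpow_def)

lemma ennpow_mono:
  assumes "x \<le> y" "0 \<le> a"
  shows "ennpow x a \<le> ennpow y a"
proof (cases "y = top")
  case False
  then have "x \<noteq> top" using assms(1) by (auto simp: top_unique)
  with False assms show ?thesis
    by (auto simp: ennpow_def less_top intro!: ennreal_leI powr_mono2 enn2real_mono)
qed simp

lemma ennpow_ennpow: "ennpow (ennpow x a) b = ennpow x (a * b)"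
  by (simp add: ennpow_def powr_powr)

lemma ennpow_1: "ennpow x 1 = x"
  by (cases x) (auto simp: ennpow_def)

lemma ennpow_half_power2: "(ennpow x (1 / 2))\<^sup>2 = x"
  by (cases x) (auto simp: ennpow_ennreal powr_half_sqrt ennreal_power)

lemma ennpow_le_imp:
  assumes "0 < p" "0 \<le> y" "ennpow x (1 / p) \<le> ennreal y"
  shows "x \<le> ennreal (y powr p)"
proof -
  have "ennpow (ennpow x (1 / p)) p \<le> ennpow (ennreal y) p"
    using assms by (intro ennpow_mono) auto
  then show ?thesis using assms by (simp add: ennpow_ennpow ennpow_1 ennpow_ennreal)
qed

lemma ennpow_SUP_le:
  assumes "0 < a" "\<And>n. 0 \<le> h n"
  shows "ennpow (SUP n. ennreal (h n)) a \<le> (SUP n. ennreal (h n powr a))"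
proof (cases "SUP n. ennreal (h n powr a)")
  case (real z)
  have "ennreal (h n) \<le> ennreal (z powr (1 / a))" for n
  proof -
    have "ennreal (h n powr a) \<le> ennreal z" unfolding real(2)[symmetric] by (rule SUP_upper) simp
    then have "h n powr a \<le> z" using real(1) by simp
    then have "(h n powr a) powr (1 / a) \<le> z powr (1 / a)" using assms by (intro powr_mono2) auto
    then show ?thesis using assms by (simp add: powr_powr ennreal_leI)
  qed
  then have "ennpow (SUP n. ennreal (h n)) a \<le> ennpow (ennreal (z powr (1 / a))) a"
    using assms by (intro ennpow_mono SUP_least) auto
  also have "\<dots> = ennreal z" using assms real(1) by (simp add: ennpow_ennreal powr_powr)
  finally show ?thesis using real by simp
next
  case top
  then show ?thesis by (simp only: top_greatest)
qed

lemma locally_integrable_bounded: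
  assumes "locally_integrable f" "bounded S" "S \<in> sets lebesgue"
  shows "set_integrable lebesgue S f"
proof -
  have "set_integrable lebesgue (closure S) f"
    using assms by (simp add: locally_integrable_def compact_closure)
  then show ?thesis
    using assms(3) closure_subset by (rule set_integrable_subset)
qed

lemma locally_integrable_measurable:
  fixes f :: "'a::euclidean_space \<Rightarrow> 'b::{banach, second_countable_topology}"
  assumes "locally_integrable f"
  shows "f \<in> borel_measurable lebesgue"
proof (rule borel_measurable_LIMSEQ_metric)
  show "(\<lambda>x. indicator (ball 0 (real i)) x *\<^sub>R f x) \<in> borel_measurable lebesgue" for i
    using locally_integrable_bounded[OF assms bounded_ball, of 0 "real i"] by (simp add: set_integrable_def)
  fix x :: 'a
  obtain m :: nat where m: "norm x < real m" using reals_Archimedean2 by blast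
  have "\<forall>\<^sub>F i in sequentially. indicator (ball 0 (real i)) x *\<^sub>R f x = f x"
    using eventually_ge_at_top[of m] by eventually_elim (use m in \<open>auto simp: indicator_def\<close>)
  then show "(\<lambda>i. indicator (ball 0 (real i)) x *\<^sub>R f x) \<longlonglongrightarrow> f x"
    by (rule tendsto_eventually)
qed

lemma bounded_cell: "bounded (cell Q)"
  using cell_subset_cball[OF corner_in_cell] bounded_cball bounded_subset by blast

lemma set_integrable_nonneg:
  fixes u :: "'a \<Rightarrow> real"
  assumes "u \<in> borel_measurable M" "S \<in> sets M" "\<And>x. 0 \<le> u x" "(\<integral>\<^sup>+x\<in>S. ennreal (u x) \<partial>M) < \<infinity>"
  shows "set_integrable M S u"
proof -
  have "(\<integral>\<^sup>+x\<in>S. ennreal (u x) \<partial>M) = (\<integral>\<^sup>+x. ennreal (norm (indicator S x *\<^sub>R u x)) \<partial>M)"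
    by (intro nn_integral_cong) (use assms(3) in \<open>auto simp: indicator_def\<close>)
  then show ?thesis
    unfolding set_integrable_def using assms by (intro integrableI_bounded) auto
qed

text \<open>If the dual weight had infinite integral over some ball, then on a larger ball that also
  carries positive w-mass the Muckenhoupt product would be infinite. So the dual weight is locally
  integrable, hence finite almost everywhere, which means w > 0 almost everywhere.\<close>

lemma ex_Ap_weight:
  fixes w :: "'a::euclidean_space \<Rightarrow> real"
  assumes p: "1 < p" and w: "w \<in> A_class p" and nz: "\<not> (AE x in lebesgue. w x = 0)"
  obtains Cw where "Ap_weight w p Cw"
proof -
  let ?b = "1 / (p - 1)"
  let ?s = "\<lambda>x. ennpow (inverse (ennreal (w x))) ?b"
  let ?\<sigma> = "\<lambda>x. w x powr (- 1 / (p - 1))"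
  have w0: "\<And>x. 0 \<le> w x" and loc: "locally_integrable w" using w by (auto simp: A_class_def weight_def)
  have wm [measurable]: "w \<in> borel_measurable lebesgue" by (rule locally_integrable_measurable[OF loc])
  have sm: "?s \<in> borel_measurable lebesgue"
    unfolding ennpow_def by measurable
  have wint: "set_integrable lebesgue (ball c r) w" for c r
    by (rule locally_integrable_bounded[OF loc]) auto
  obtain C where C: "C > 0" "\<And>c r. r > 0 \<Longrightarrow>
        ((\<integral>\<^sup>+ x \<in> ball c r. ennreal (w x) \<partial>lebesgue) / emeasure lebesgue (ball c r)) *
        ennpow ((\<integral>\<^sup>+ x \<in> ball c r. ?s x \<partial>lebesgue) / emeasure lebesgue (ball c r)) (p - 1) \<le> ennreal C"
    using w unfolding A_class_def by blast
  define vol where "vol r = unit_ball_vol DIM('a) * r ^ DIM('a)" for r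
  have em: "emeasure lebesgue (ball c r) = ennreal (vol r)" if "0 < r" for c :: 'a and r
    using that emeasure_ball[of r c] by (simp add: vol_def)
  have vol: "0 < vol r" if "0 < r" for r using that by (simp add: vol_def)
  have "\<exists>R>0. (\<integral>\<^sup>+ x \<in> ball 0 R. ennreal (w x) \<partial>lebesgue) \<noteq> 0"
  proof (rule ccontr)
    assume "\<not> ?thesis"
    then have "(\<integral>\<^sup>+ x \<in> ball 0 (real (Suc i)). ennreal (w x) \<partial>lebesgue) = 0" for i :: nat by force
    then have "AE x in lebesgue. ennreal (w x) * indicator (ball 0 (real (Suc i))) x = 0" for i :: nat
      by (subst (asm) nn_integral_0_iff_AE) (intro borel_measurable_times_ennreal measurable_compose[OF wm] borel_measurable_indicator; simp)+
    then have "AE x in lebesgue. \<forall>i::nat. ennreal (w x) * indicator (ball 0 (real (Suc i))) x = 0"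
      by (subst AE_all_countable) blast
    then have "AE x in lebesgue. w x = 0"
    proof eventually_elim
      case (elim x)
      obtain i :: nat where "norm x < real i" using reals_Archimedean2 by blast
      then have "x \<in> ball 0 (real (Suc i))" by simp
      with elim[rule_format, of i] show ?case using w0[of x] by simp
    qed
    with nz show False by blast
  qed
  then obtain R0 where R0: "R0 > 0" "(\<integral>\<^sup>+ x \<in> ball 0 R0. ennreal (w x) \<partial>lebesgue) \<noteq> 0" by blast
  have sfin: "(\<integral>\<^sup>+ x \<in> ball c r. ?s x \<partial>lebesgue) < \<infinity>" for c r
  proof (rule ccontr)
    assume inf: "\<not> ?thesis"
    \<comment> \<open>Large enough to contain both the ball of positive mass and the ball with
      infinite dual integral.\<close>
    define R where "R = max R0 (norm c + \<bar>r\<bar>)"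
    have R: "0 < R" using R0 by (simp add: R_def)
    have sub: "ball c r \<subseteq> ball 0 R"
    proof
      fix x assume "x \<in> ball c r"
      then show "x \<in> ball 0 R" using norm_triangle_ineq2[of x c] by (simp add: R_def dist_norm norm_minus_commute)
    qed
    have "(\<integral>\<^sup>+ x \<in> ball c r. ?s x \<partial>lebesgue) \<le> (\<integral>\<^sup>+ x \<in> ball 0 R. ?s x \<partial>lebesgue)"
      using sub by (intro nn_integral_mono) (auto simp: indicator_def)
    with inf have "(\<integral>\<^sup>+ x \<in> ball 0 R. ?s x \<partial>lebesgue) = \<infinity>" by (simp add: top_unique less_top[symmetric])
    moreover have "(\<integral>\<^sup>+ x \<in> ball 0 R0. ennreal (w x) \<partial>lebesgue) \<le> (\<integral>\<^sup>+ x \<in> ball 0 R. ennreal (w x) \<partial>lebesgue)"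
      by (intro nn_integral_mono) (auto simp: R_def indicator_def)
    then have "(\<integral>\<^sup>+ x \<in> ball 0 R. ennreal (w x) \<partial>lebesgue) \<noteq> 0" using R0(2) by auto
    moreover have "X / ennreal v * ennpow (\<infinity> / ennreal v) (p - 1) = \<infinity>" if "X \<noteq> 0" "0 < v" for X v
      using that by (simp add: ennreal_top_divide ennreal_mult_top ennreal_divide_eq_0_iff)
    ultimately have "((\<integral>\<^sup>+ x \<in> ball 0 R. ennreal (w x) \<partial>lebesgue) / ennreal (vol R)) *
        ennpow ((\<integral>\<^sup>+ x \<in> ball 0 R. ?s x \<partial>lebesgue) / ennreal (vol R)) (p - 1) = \<infinity>"
      using vol[OF R] by simp
    then have "\<infinity> \<le> ennreal C" using C(2)[OF R, of 0] unfolding em[OF R] by (simp only:)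
    then show False by (simp add: top_unique)
  qed
  have wpos: "AE x in lebesgue. 0 < w x"
  proof -
    have "AE x in lebesgue. ?s x * indicator (ball 0 (real i)) x \<noteq> \<infinity>" for i :: nat
    proof (rule nn_integral_PInf_AE)
      show "(\<lambda>x. ?s x * indicator (ball 0 (real i)) x) \<in> borel_measurable lebesgue"
        by (intro borel_measurable_times_ennreal sm borel_measurable_indicator) simp
      show "(\<integral>\<^sup>+ x \<in> ball 0 (real i). ?s x \<partial>lebesgue) \<noteq> \<infinity>" using sfin[of 0 "real i"] by simp
    qed
    then have "AE x in lebesgue. \<forall>i::nat. ?s x * indicator (ball 0 (real i)) x \<noteq> \<infinity>"
      by (subst AE_all_countable) blast
    then show ?thesis
    proof eventually_elim
      case (elim x)
      obtain i :: nat where "norm x < real i" using reals_Archimedean2 by blast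
      then have "?s x \<noteq> \<infinity>" using elim[rule_format, of i] by simp
      then have "w x \<noteq> 0" by auto
      then show ?case using w0[of x] by simp
    qed
  qed
  have s\<sigma>: "(\<integral>\<^sup>+ x \<in> ball c r. ?s x \<partial>lebesgue) = (\<integral>\<^sup>+ x \<in> ball c r. ennreal (?\<sigma> x) \<partial>lebesgue)" for c r
  proof (rule nn_integral_cong_AE)
    show "AE x in lebesgue. ?s x * indicator (ball c r) x = ennreal (?\<sigma> x) * indicator (ball c r) x"
      using wpos
    proof eventually_elim
      case (elim x)
      have "?s x = ennreal (inverse (w x) powr ?b)"
        using elim by (simp add: inverse_ennreal ennpow_ennreal)
      also have "inverse (w x) powr ?b = ?\<sigma> x"
        using elim by (simp add: powr_minus inverse_powr)
      finally show ?case by simp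
    qed
  qed
  have \<sigma>int: "set_integrable lebesgue (ball c r) ?\<sigma>" for c r
    using sfin[of c r] unfolding s\<sigma> by (intro set_integrable_nonneg) auto
  show thesis
  proof (rule that, unfold_locales)
    fix c :: 'a and r :: real assume r: "0 < r"
    define X where "X = (LINT x:ball c r|lebesgue. w x)"
    define Y where "Y = (LINT x:ball c r|lebesgue. ?\<sigma> x)"
    have XY: "0 \<le> X" "0 \<le> Y"
      unfolding X_def Y_def set_lebesgue_integral_def using w0 by (auto intro!: integral_nonneg)
    have "(ennreal X / ennreal (vol r)) * ennpow (ennreal Y / ennreal (vol r)) (p - 1) \<le> ennreal C"
      using C(2)[OF r, of c] unfolding s\<sigma> em[OF r] nn_set_integral_eq[OF wint w0]
        nn_set_integral_eq[OF \<sigma>int powr_ge_zero] X_def Y_def .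
    then have "ennreal (X / vol r * (Y / vol r) powr (p - 1)) \<le> ennreal C"
      using XY vol[OF r] by (subst ennreal_mult'') (simp_all add: divide_ennreal ennpow_ennreal)
    then have "X / vol r * (Y / vol r) powr (p - 1) \<le> C"
      using C(1) by simp
    then have "X * Y powr (p - 1) / (vol r * vol r powr (p - 1)) \<le> C"
      using XY vol[OF r] by (simp add: powr_divide)
    then have "X * Y powr (p - 1) \<le> C * (vol r * vol r powr (p - 1))"
      using vol[OF r] by (simp add: pos_divide_le_eq)
    also have "vol r * vol r powr (p - 1) = vol r powr p"
      using vol[OF r] by (simp add: powr_mult_base)
    finally show "(LINT x:ball c r|lebesgue. w x) * (LINT x:ball c r|lebesgue. ?\<sigma> x) powr (p - 1)
      \<le> C * measure lebesgue (ball c r) powr p"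
      using r by (subst measure_ball_lebesgue) (auto simp: X_def Y_def vol_def)
  qed (use p C(1) wpos wint \<sigma>int w0 in auto)
qed

lemma morrey_norm_AE_zero:
  fixes w :: "'a::euclidean_space \<Rightarrow> real"
  assumes "AE x in lebesgue. w x = 0"
  shows "morrey_norm p \<kappa> w g = 0"
proof -
  have "(\<integral>\<^sup>+ x \<in> ball c r. (ennpow (g x) p * ennreal (w x)) \<partial>lebesgue) = (\<integral>\<^sup>+ (x::'a). 0 \<partial>lebesgue)" for c r
  proof (rule nn_integral_cong_AE)
    show "AE x in lebesgue. ennpow (g x) p * ennreal (w x) * indicator (ball c r) x = 0"
      using assms by eventually_elim simp
  qed
  then have "morrey_norm p \<kappa> w g \<le> 0"
    unfolding morrey_norm_def by (intro SUP_least) (auto simp: ennpow_0)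
  then show ?thesis by simp
qed

text \<open>The double series over functions and levels is bounded through its finite rectangles,
  each lying in a square of size N. Within such a square \<open>L2_set_acoef\<close> moves the ell2
  sum over the functions inside the coefficient.\<close>

lemma sum_square_fun_le:
  fixes f :: "nat \<Rightarrow> 'a::euclidean_space \<Rightarrow> complex"
  assumes alpha: "0 < \<alpha>" and f: "\<And>j Q. set_integrable lebesgue (cell Q) (f j)"
  shows "(\<Sum>j. (intrinsic_square_fun \<alpha> (f j) x)\<^sup>2) \<le>
    (SUP N. ennreal (CS \<alpha> DIM('a) * (\<Sum>S\<in>Pow Basis. \<Sum>i<N.
       (acoef ((1 / 2) powr \<alpha>) {..<N} f (cube_at S (int_decode i) x))\<^sup>2)))"
proof -
  let ?a = "\<lambda>J S i. acoef ((1 / 2) powr \<alpha>) J f (cube_at S (int_decode i) x)"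
  let ?s = "CS \<alpha> DIM('a)"
  define g where "g j i = (\<Sum>S\<in>Pow Basis. (?a {j} S i)\<^sup>2)" for j i
  define G where "G N = (\<Sum>S\<in>Pow Basis. \<Sum>i<N. (?a {..<N} S i)\<^sup>2)" for N
  have g: "0 \<le> g j i" for j i by (simp add: g_def sum_nonneg)
  have G: "(\<Sum>i<m. \<Sum>j<n. g j i) \<le> G (max m n)" for m n
  proof -
    let ?N = "max m n"
    have "(\<Sum>i<m. \<Sum>j<n. g j i) \<le> (\<Sum>i<?N. \<Sum>j<?N. g j i)"
      using g by (intro order_trans[OF sum_mono sum_mono2] sum_mono2) (auto intro: sum_nonneg)
    also have "\<dots> = (\<Sum>i<?N. \<Sum>S\<in>Pow Basis. \<Sum>j<?N. (?a {j} S i)\<^sup>2)"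
      unfolding g_def by (intro sum.cong refl sum.swap)
    also have "\<dots> \<le> (\<Sum>i<?N. \<Sum>S\<in>Pow Basis. (?a {..<?N} S i)\<^sup>2)"
    proof (intro sum_mono)
      fix i S
      have "(\<Sum>j<?N. (?a {j} S i)\<^sup>2) = (L2_set (\<lambda>j. ?a {j} S i) {..<?N})\<^sup>2"
        by (simp add: L2_set_def sum_nonneg)
      also have "\<dots> \<le> (?a {..<?N} S i)\<^sup>2"
        by (intro power_mono L2_set_acoef theta_bounds alpha f L2_set_nonneg) simp
      finally show "(\<Sum>j<?N. (?a {j} S i)\<^sup>2) \<le> (?a {..<?N} S i)\<^sup>2" .
    qed
    also have "\<dots> = G ?N" unfolding G_def by (rule sum.swap)
    finally show ?thesis .
  qed
  have "(\<Sum>j. \<Sum>i. ennreal (g j i)) \<le> (SUP N. ennreal (G N))"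
  proof (rule suminf_le_const)
    fix n
    have "(\<Sum>j<n. \<Sum>i. ennreal (g j i)) = (\<Sum>i. \<Sum>j<n. ennreal (g j i))"
      by (rule suminf_sum[symmetric]) simp
    also have "\<dots> \<le> (SUP N. ennreal (G N))"
    proof (rule suminf_le_const)
      fix m
      have "(\<Sum>i<m. \<Sum>j<n. ennreal (g j i)) = ennreal (\<Sum>i<m. \<Sum>j<n. g j i)"
        using g by (simp add: sum_nonneg)
      also have "\<dots> \<le> ennreal (G (max m n))" by (rule ennreal_leI[OF G])
      also have "\<dots> \<le> (SUP N. ennreal (G N))" by (rule SUP_upper) simp
      finally show "(\<Sum>i<m. \<Sum>j<n. ennreal (g j i)) \<le> (SUP N. ennreal (G N))" .
    qed simp
    finally show "(\<Sum>j<n. \<Sum>i. ennreal (g j i)) \<le> (SUP N. ennreal (G N))" .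
  qed simp
  then have le: "ennreal ?s * (\<Sum>j. \<Sum>i. ennreal (g j i)) \<le> ennreal ?s * (SUP N. ennreal (G N))"
    by (rule mult_left_mono) simp
  have "(\<Sum>j. (intrinsic_square_fun \<alpha> (f j) x)\<^sup>2) \<le> (\<Sum>j. ennreal ?s * (\<Sum>i. ennreal (g j i)))"
    unfolding intrinsic_square_fun_def ennpow_half_power2 g_def
    by (intro suminf_le square_fun_le alpha f) auto
  also have "\<dots> = ennreal ?s * (\<Sum>j. \<Sum>i. ennreal (g j i))" by simp
  also note le
  also have "ennreal ?s * (SUP N. ennreal (G N)) = (SUP N. ennreal (?s * G N))"
    by (simp add: SUP_mult_left_ennreal ennreal_mult' CS_nonneg)
  finally show ?thesis by (simp add: G_def)
qed

theorem theorem1p1: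
  fixes \<alpha> p \<kappa> :: real and w :: "'a::euclidean_space \<Rightarrow> real"
  assumes "0 < \<alpha>" "\<alpha> \<le> 1"
    and "1 < p"
    and "0 < \<kappa>" "\<kappa> < 1"
    and "w \<in> A_class p"
  shows "\<exists>C::real. C > 0 \<and>
    (\<forall>f :: nat \<Rightarrow> 'a \<Rightarrow> complex. (\<forall>j. locally_integrable (f j)) \<longrightarrow>
       morrey_norm p \<kappa> w (\<lambda>x. ell2 (\<lambda>j. intrinsic_square_fun \<alpha> (f j) x))
       \<le> ennreal C * morrey_norm p \<kappa> w (\<lambda>x. ell2 (\<lambda>j. ennreal (norm (f j x)))))"
proof (cases "AE x in lebesgue. w x = 0")
  \<comment> \<open>For the zero weight both norms vanish, the quotient 0 / 0 being 0, so any
    positive constant serves.\<close>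
  case True
  show ?thesis by (intro exI[of _ 1]) (simp add: morrey_norm_AE_zero[OF True])
next
  case False
  obtain Cw where "Ap_weight w p Cw" using ex_Ap_weight[OF assms(3,6) False] .
  then interpret Ap_weight w p Cw .
  define \<theta> :: real where "\<theta> = (1 / 2) powr \<alpha>"
  have theta: "0 < \<theta>" "\<theta> < 1" using theta_bounds[OF assms(1)] by (auto simp: \<theta>_def)
  define s where "s = CS \<alpha> DIM('a)"
  have s: "0 \<le> s" by (simp add: s_def CS_nonneg)
  \<comment> \<open>\<open>C7\<close> is evaluated before any sequence is chosen: its arguments are
    the dimension, the exponents, \<theta>, the Muckenhoupt constant and \<open>s\<close>. The
    maximum with 1 makes the constant positive.\<close>
  define M where "M = max 1 (morrey_data.C7 TYPE('a) p Cw \<kappa> \<theta> s)"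
  have M: "1 \<le> M" by (simp add: M_def)
  have p0: "0 < p" using assms(3) by simp
  show ?thesis
  proof (intro exI[of _ "M powr (1 / p)"] conjI allI impI)
    show "0 < M powr (1 / p)" using M by simp
    fix f :: "nat \<Rightarrow> 'a \<Rightarrow> complex"
    assume f: "\<forall>j. locally_integrable (f j)"
    let ?g = "\<lambda>x. ell2 (\<lambda>j. ennreal (norm (f j x)))"
    let ?S = "\<lambda>x. ell2 (\<lambda>j. intrinsic_square_fun \<alpha> (f j) x)"
    have fc: "set_integrable lebesgue (cell Q) (f j)" for j Q
      using f by (intro locally_integrable_bounded bounded_cell) auto
    have wW: "weight_meas w (ball c r) = ennreal (W (ball c r))" for c r
      unfolding weight_meas_def W_def by (rule nn_set_integral_eq[OF w_integrable_ball w_nonneg])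
    show "morrey_norm p \<kappa> w ?S \<le> ennreal (M powr (1 / p)) * morrey_norm p \<kappa> w ?g"
    proof (cases "morrey_norm p \<kappa> w ?g")
      case top
      then show ?thesis using M by (simp add: ennreal_mult_top)
    next
      case (real \<nu>)
      define \<Lambda> where "\<Lambda> = \<nu> powr p"
      let ?F = "\<lambda>N x. L2_set (\<lambda>j. norm (f j x)) {..<N}"
      have gball: "(\<integral>\<^sup>+ x \<in> ball c r. (ennpow (?g x) p * ennreal (w x)) \<partial>lebesgue) \<le> ennreal (\<Lambda> * W (ball c r) powr \<kappa>)"
        if r: "0 < r" for c r
      proof -
        let ?X = "\<integral>\<^sup>+ x \<in> ball c r. (ennpow (?g x) p * ennreal (w x)) \<partial>lebesgue"
        let ?d = "W (ball c r) powr \<kappa>"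
        have d: "0 < ?d" using W_pos[OF r, of c] by simp
        have "ennpow (?X / ennpow (weight_meas w (ball c r)) \<kappa>) (1 / p) \<le> morrey_norm p \<kappa> w ?g"
          unfolding morrey_norm_def by (rule SUP_upper2[where i = "(c, r)"]) (use r in auto)
        also have "\<dots> = ennreal \<nu>" by (rule real)
        finally have "?X / ennreal ?d \<le> ennreal \<Lambda>"
          unfolding \<Lambda>_def wW ennpow_ennreal[OF W_nonneg] by (rule ennpow_le_imp[OF p0 real(1)])
        then have "?X / ennreal ?d * ennreal ?d \<le> ennreal \<Lambda> * ennreal ?d" by (rule mult_right_mono) simp
        then show ?thesis using d by (simp add: ennreal_divide_times ennreal_mult''[symmetric])
      qed
      have Fg: "ennreal (?F N x powr p) \<le> ennpow (?g x) p" for N x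
      proof -
        have "ennreal (?F N x) = ennpow (\<Sum>j<N. (ennreal (norm (f j x)))\<^sup>2) (1 / 2)"
          by (simp add: L2_set_def ennreal_power ennpow_ennreal sum_nonneg powr_half_sqrt)
        also have "\<dots> \<le> ?g x" unfolding ell2_def by (intro ennpow_mono sum_le_suminf) auto
        finally have "ennpow (ennreal (?F N x)) p \<le> ennpow (?g x) p" using p0 by (intro ennpow_mono) auto
        then show ?thesis by (simp add: ennpow_ennreal L2_set_nonneg)
      qed
      have fm [measurable]: "f j \<in> borel_measurable lebesgue" for j
        using f locally_integrable_measurable by blast
      have Fm [measurable]: "(\<lambda>x. ?F N x powr p * w x) \<in> borel_measurable lebesgue" for N
        unfolding L2_set_def by measurable
      have Fball: "(\<integral>\<^sup>+ x \<in> ball c r. ennreal (?F N x powr p * w x) \<partial>lebesgue) \<le> ennreal (\<Lambda> * W (ball c r) powr \<kappa>)"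
        if r: "0 < r" for N c r
      proof -
        have "(\<integral>\<^sup>+ x \<in> ball c r. ennreal (?F N x powr p * w x) \<partial>lebesgue)
          \<le> (\<integral>\<^sup>+ x \<in> ball c r. (ennpow (?g x) p * ennreal (w x)) \<partial>lebesgue)"
          using Fg w_nonneg by (intro nn_integral_mono mult_right_mono) (auto simp: ennreal_mult'' intro!: mult_right_mono)
        with gball[OF r] show ?thesis by (rule order_trans[rotated])
      qed
      have F0: "0 \<le> ?F N x powr p * w x" for N x by (simp add: w_nonneg)
      have Fint: "set_integrable lebesgue (ball c r) (\<lambda>x. ?F N x powr p * w x)" for N c r
      proof (cases "0 < r")
        case True
        have "(\<integral>\<^sup>+ x \<in> ball c r. ennreal (?F N x powr p * w x) \<partial>lebesgue) < \<infinity>"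
          using le_less_trans[OF Fball[OF True] ennreal_less_top] by simp
        then show ?thesis by (intro set_integrable_nonneg Fm F0) simp_all
      next
        case False
        then show ?thesis by (simp add: set_integrable_def ball_empty)
      qed
      have md: "morrey_data w p Cw \<kappa> \<theta> \<Lambda> {..<N} f" for N
      proof (unfold_locales)
        show "(LINT x:ball c r|lebesgue. ?F N x powr p * w x) \<le> \<Lambda> * W (ball c r) powr \<kappa>" if r: "0 < r" for c r
        proof -
          have "ennreal (LINT x:ball c r|lebesgue. ?F N x powr p * w x) \<le> ennreal (\<Lambda> * W (ball c r) powr \<kappa>)"
            using Fball[OF r, where c = c and N = N] by (simp only: nn_set_integral_eq[OF Fint F0])
          then show ?thesis by (simp add: \<Lambda>_def)
        qed
      qed (use assms theta fc Fint in \<open>auto simp: \<Lambda>_def\<close>)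
      \<comment> \<open>One index truncates both the sequence and the levels, so a single increasing
        limit dominates both infinite sums.\<close>
      define G where "G N x = (\<Sum>S\<in>Pow Basis. \<Sum>i<N. (acoef \<theta> {..<N} f (cube_at S (int_decode i) x))\<^sup>2)" for N x
      have G0: "0 \<le> s * G N x" for N x using s by (simp add: G_def sum_nonneg)
      have G_mono: "G N x \<le> G N' x" if "N \<le> N'" for N N' x
      proof -
        have "G N x \<le> (\<Sum>S\<in>Pow Basis. \<Sum>i<N. (acoef \<theta> {..<N'} f (cube_at S (int_decode i) x))\<^sup>2)"
          unfolding G_def using that
          by (intro sum_mono power_mono acoef_mono acoef_nonneg theta fc) auto
        also have "\<dots> \<le> G N' x" unfolding G_def using that by (intro sum_mono sum_mono2) auto
        finally show ?thesis .
      qed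
      have [measurable]: "G N \<in> borel_measurable lebesgue" for N
      proof -
        note [measurable] = cube_at_measurable_lebesgue[of "acoef \<theta> {..<N} f"]
        show ?thesis unfolding G_def[abs_def] by measurable
      qed
      have key: "(\<integral>\<^sup>+ x \<in> ball c r. (ennpow (?S x) p * ennreal (w x)) \<partial>lebesgue) \<le> ennreal (M * \<Lambda> * W (ball c r) powr \<kappa>)"
        if r: "0 < r" for c r
      proof -
        let ?h = "\<lambda>N x. ennreal ((s * G N x) powr (p / 2) * w x) * indicator (ball c r) x"
        have ball [measurable]: "ball c r \<in> sets lebesgue" by simp
        have "ennpow (?S x) p \<le> (SUP N. ennreal ((s * G N x) powr (p / 2)))" for x
        proof -
          have "ennpow (?S x) p = ennpow (\<Sum>j. (intrinsic_square_fun \<alpha> (f j) x)\<^sup>2) (p / 2)"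
            by (simp add: ell2_def ennpow_ennpow)
          also have "\<dots> \<le> ennpow (SUP N. ennreal (s * G N x)) (p / 2)"
            using sum_square_fun_le[where f = f and x = x, OF assms(1) fc] p0
            by (intro ennpow_mono) (auto simp: G_def s_def \<theta>_def)
          also have "\<dots> \<le> (SUP N. ennreal ((s * G N x) powr (p / 2)))"
            using p0 G0 by (intro ennpow_SUP_le) auto
          finally show ?thesis .
        qed
        then have "(\<integral>\<^sup>+ x \<in> ball c r. (ennpow (?S x) p * ennreal (w x)) \<partial>lebesgue)
          \<le> (\<integral>\<^sup>+ x. (SUP N. ennreal ((s * G N x) powr (p / 2))) * ennreal (w x) * indicator (ball c r) x \<partial>lebesgue)"
          by (intro nn_integral_mono mult_right_mono) auto
        also have "\<dots> = (\<integral>\<^sup>+ x. (SUP N. ?h N x) \<partial>lebesgue)"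
          by (simp add: SUP_mult_right_ennreal ennreal_mult'' w_nonneg)
        \<comment> \<open>Monotone convergence removes both truncations; the bound below holds for
          every N with the same \<open>M\<close>.\<close>
        also have "\<dots> = (SUP N. \<integral>\<^sup>+ x. ?h N x \<partial>lebesgue)"
        proof (rule nn_integral_monotone_convergence_SUP)
          show "incseq ?h"
          proof (intro incseq_def[THEN iffD2] allI impI le_funI mult_right_mono ennreal_leI powr_mono2 mult_left_mono)
            show "G N x \<le> G N' x" if "N \<le> N'" for N N' x using that by (rule G_mono)
          qed (use p0 G0 s w_nonneg in auto)
          show "?h N \<in> borel_measurable lebesgue" for N by measurable
        qed
        also have "\<dots> \<le> ennreal (M * \<Lambda> * W (ball c r) powr \<kappa>)"
        proof (rule SUP_least)
          fix N :: nat
          interpret md: morrey_data w p Cw \<kappa> \<theta> \<Lambda> "{..<N}" f by (rule md)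
          have "(\<integral>\<^sup>+ x. ?h N x \<partial>lebesgue) \<le> ennreal (md.C7 s * \<Lambda> * W (ball c r) powr \<kappa>)"
            unfolding G_def by (rule md.morrey_finite[OF r s])
          also have "\<dots> \<le> ennreal (M * \<Lambda> * W (ball c r) powr \<kappa>)"
            by (intro ennreal_leI mult_right_mono) (auto simp: M_def \<Lambda>_def)
          finally show "(\<integral>\<^sup>+ x. ?h N x \<partial>lebesgue) \<le> ennreal (M * \<Lambda> * W (ball c r) powr \<kappa>)" .
        qed
        finally show ?thesis .
      qed
      have bound: "ennpow ((\<integral>\<^sup>+ x \<in> ball c r. (ennpow (?S x) p * ennreal (w x)) \<partial>lebesgue)
          / ennpow (weight_meas w (ball c r)) \<kappa>) (1 / p) \<le> ennreal (M powr (1 / p)) * ennreal \<nu>"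
        if r: "0 < r" for c r
      proof -
        let ?Y = "\<integral>\<^sup>+ x \<in> ball c r. (ennpow (?S x) p * ennreal (w x)) \<partial>lebesgue"
        let ?d = "W (ball c r) powr \<kappa>"
        have d: "0 < ?d" using W_pos[OF r, of c] by simp
        have "?Y / ennreal ?d \<le> ennreal (M * \<Lambda> * ?d) / ennreal ?d"
          by (rule divide_right_mono_ennreal[OF key[OF r]])
        also have "\<dots> = ennreal (M * \<Lambda>)"
          using d M by (subst divide_ennreal) (auto simp: \<Lambda>_def)
        finally have "ennpow (?Y / ennpow (weight_meas w (ball c r)) \<kappa>) (1 / p) \<le> ennpow (ennreal (M * \<Lambda>)) (1 / p)"
          unfolding wW ennpow_ennreal[OF W_nonneg] using p0 by (intro ennpow_mono) auto
        also have "\<dots> = ennreal (M powr (1 / p)) * ennreal \<nu>"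
        proof -
          have "ennpow (ennreal (M * \<Lambda>)) (1 / p) = ennreal ((M * \<Lambda>) powr (1 / p))"
            using M by (intro ennpow_ennreal) (simp add: \<Lambda>_def)
          also have "(M * \<Lambda>) powr (1 / p) = M powr (1 / p) * \<nu>"
            using p0 real(1) by (simp add: \<Lambda>_def powr_mult powr_powr)
          finally show ?thesis by (simp add: ennreal_mult')
        qed
        finally show ?thesis .
      qed
      show ?thesis
        unfolding real(2) unfolding morrey_norm_def
        by (rule SUP_least, clarify, rule bound)
    qed
  qed
qed

end
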